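(* Let $\mathcal C$ be a pre-modular tensor category, let $\mathcal D$ be a pivotal monoidal category and let $\mathcal M\colon\mathcal C\to\mathcal D$ be a pivotal monoidal functor. Then $\mathcal{T}\mathcal{M}$ is T-invariant.
   Context: $K$ is an algebraically closed field; all categories are $K$-linear with finite-dimensional Hom-spaces and all functors are $K$-linear. A pre-modular tensor category $\mathcal C$ is a spherical fusion category over $K$ with a (balanced) braiding $c_{X,Y}\colon XY\to YX$; $\mathcal I$ is a complete set of simple objects containing the unit $\mathbf 1$. The symbol $\otimes$ is omitted in $\mathcal C$, and associators, unit isomorphisms, pivotal structures and the monoidal structure isomorphisms of $\mathcal M$ are suppressed. $X^\vee$ is a dual of $X$, with $\mathrm{ev}_X\colon X^\vee X\to\mathbf 1$ and (using the pivotal structure) $\widetilde{\mathrm{coev}}_X\colon\mathbf 1\to X^\vee X$. $d(X)$ is the dimension of $X$ and $d(\mathcal C)=\sum_{S\in\mathcal I}d(S)^2$, taken to be nonzero. The T-matrix is $\mathcal T_{IJ}=\delta_{I,J}\theta_I$, where $\theta_I\in K$ is the scalar by which the twist of $I$ (the right partial trace of $c_{I,I}$) acts. Tube category $\mathcal{T}\mathcal{C}$: its objects are those of $\mathcal C$, and $\mathrm{Hom}_{\mathcal{TC}}(X,Y)=\bigoplus_{S\in\mathcal I}\mathrm{Hom}_{\mathcal C}(SX,YS)$. For any object $G$ and $\alpha\in\mathrm{Hom}_{\mathcal C}(GX,YG)$, $\alpha_G\in\mathrm{Hom}_{\mathcal{TC}}(X,Y)$ is the morphism with $S$-component $\sum_b(\mathrm{id}_Y\otimes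 b^* )\circ\alpha\circ(b\otimes\mathrm{id}_X)$, where $\{b\}$ is a basis of $\mathrm{Hom}_{\mathcal C}(S,G)$ and $\{b^*\}\subset\mathrm{Hom}_{\mathcal C}(G,S)$ the dual basis ($b_i^*\circ b_j=\delta_{ij}\mathrm{id}_S$). Composition is determined by $\beta_H\circ\alpha_G=\big((\beta\otimes\mathrm{id}_G)\circ(\mathrm{id}_H\otimes\alpha)\big)_{HG}$. $\mathcal{T}\mathcal{M}$ is the contravariant functor from $\mathcal{T}\mathcal{C}$ to finite-dimensional vector spaces with $\mathcal{TM}(X)=\mathrm{Hom}_{\mathcal D}(\mathcal M(X),\mathbf 1)$ and, for $\alpha\in\mathrm{Hom}_{\mathcal C}(GX,YG)$ and $\beta\in\mathrm{Hom}_{\mathcal D}(\mathcal M(Y),\mathbf 1)$, $\mathcal{TM}(\alpha_G)(\beta)=\mathcal M(\mathrm{ev}_G)\circ(\mathrm{id}\otimes\beta\otimes\mathrm{id})\circ\mathcal M(\mathrm{id}_{G^\vee}\otimes\alpha)\circ\mathcal M(\widetilde{\mathrm{coev}}_G\otimes\mathrm{id}_X)$. $\epsilon_X^Y\in\mathrm{End}_{\mathcal{TC}}(XY)$ is the idempotent with $S$-component $\frac{d(S)}{d(\mathcal C)}(\mathrm{id}_X\otimes c_{Y,S}^{-1})\circ(c_{S,X}\otimes\mathrm{id}_Y)$. For a contravariant functor $F$ from $\mathcal{TC}$ to finite-dimensional vector spaces put $F_X^Y=\{\alpha\in F(XY)\mid F(\epsilon_X^Y)(\alpha)=\alpha\}$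 and $Z(F)=(\dim F_I^J)_{I,J\in\mathcal I}$. $F$ is called T-invariant if $Z(F)$ commutes with $\mathcal T$; as $\mathcal T$ is diagonal, this is understood as: $Z(F)_{IJ}\neq0$ (as an integer) implies $\mathcal T_{II}=\mathcal T_{JJ}$. *)

theory Defs
  imports "HOL-Computational_Algebra.Polynomial"
begin

text \<open>
  Categories are small: their objects are the elements of a type. All morphisms of a
  \<open>K\<close>-linear category live in one \<open>K\<close>-vector space (for instance the direct sum
  of all Hom-spaces), of which the Hom-spaces are subspaces. Distinct Hom-spaces therefore share
  the vector \<open>0\<close>; nothing below depends on their being disjoint. Nothing is strict:
  associators, unit isomorphisms, pivotal structures and the structure isomorphisms of monoidal
  functors are part of the data. All operations on morphisms are meaningful on the
  Hom-spaces only.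
\<close>

section \<open>Linear categories\<close>

record ('o, 'm, 'k) lin_cat =
  Hom :: "'o \<Rightarrow> 'o \<Rightarrow> 'm set"
  Comp :: "'m \<Rightarrow> 'm \<Rightarrow> 'm"  (infixl "\<cdot>\<index>" 68)
  Idm :: "'o \<Rightarrow> 'm"  ("\<iota>\<index>")
  Scale :: "'k \<Rightarrow> 'm \<Rightarrow> 'm"  (infixr "\<star>\<index>" 75)

locale linear_category =
  fixes C :: "('o, 'm::ab_group_add, 'k::field, 'z) lin_cat_scheme" (structure)
  assumes vector_space: "vector_space (Scale C)"
    and Hom_subspace: "module.subspace (Scale C) (Hom C X Y)"
    and Hom_finite_dim: "\<exists>B. finite B \<and> module.span (Scale C) B = Hom C X Y"
    and id_in_Hom: "\<iota> X \<in> Hom C X X"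
    and comp_in_Hom: "\<lbrakk>f \<in> Hom C X Y; g \<in> Hom C Y Z\<rbrakk> \<Longrightarrow> g \<cdot> f \<in> Hom C X Z"
    and comp_id: "f \<in> Hom C X Y \<Longrightarrow> f \<cdot> \<iota> X = f"
    and id_comp: "f \<in> Hom C X Y \<Longrightarrow> \<iota> Y \<cdot> f = f"
    and comp_assoc: "\<lbrakk>f \<in> Hom C X Y; g \<in> Hom C Y Z; h \<in> Hom C Z W\<rbrakk>
      \<Longrightarrow> (h \<cdot> g) \<cdot> f = h \<cdot> (g \<cdot> f)"
    and comp_add_left: "\<lbrakk>f \<in> Hom C X Y; g \<in> Hom C Y Z; g' \<in> Hom C Y Z\<rbrakk>
      \<Longrightarrow> (g + g') \<cdot> f = g \<cdot> f + g' \<cdot> f"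
    and comp_add_right: "\<lbrakk>f \<in> Hom C X Y; f' \<in> Hom C X Y; g \<in> Hom C Y Z\<rbrakk>
      \<Longrightarrow> g \<cdot> (f + f') = g \<cdot> f + g \<cdot> f'"
    and comp_scale_left: "\<lbrakk>f \<in> Hom C X Y; g \<in> Hom C Y Z\<rbrakk>
      \<Longrightarrow> (k \<star> g) \<cdot> f = k \<star> (g \<cdot> f)"
    and comp_scale_right: "\<lbrakk>f \<in> Hom C X Y; g \<in> Hom C Y Z\<rbrakk>
      \<Longrightarrow> g \<cdot> (k \<star> f) = k \<star> (g \<cdot> f)"

context
  fixes C :: "('o, 'm::ab_group_add, 'k::field, 'z) lin_cat_scheme" (structure)
begin

definition inverse_pair :: "'o \<Rightarrow> 'o \<Rightarrow> 'm \<Rightarrow> 'm \<Rightarrow> bool" where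
  "inverse_pair X Y f g \<longleftrightarrow>
     f \<in> Hom C X Y \<and> g \<in> Hom C Y X \<and> g \<cdot> f = \<iota> X \<and> f \<cdot> g = \<iota> Y"

definition is_iso :: "'o \<Rightarrow> 'o \<Rightarrow> 'm \<Rightarrow> bool" where
  "is_iso X Y f \<longleftrightarrow> (\<exists>g. inverse_pair X Y f g)"

definition inv_mor :: "'o \<Rightarrow> 'o \<Rightarrow> 'm \<Rightarrow> 'm" where
  "inv_mor X Y f = (THE g. inverse_pair X Y f g)"

definition isomorphic :: "'o \<Rightarrow> 'o \<Rightarrow> bool" where
  "isomorphic X Y \<longleftrightarrow> (\<exists>f. is_iso X Y f)"

definition monic :: "'o \<Rightarrow> 'o \<Rightarrow> 'm \<Rightarrow> bool" where
  "monic X Y f \<longleftrightarrow> f \<in> Hom C X Y \<and>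
     (\<forall>W. \<forall>g\<in>Hom C W X. \<forall>h\<in>Hom C W X. f \<cdot> g = f \<cdot> h \<longrightarrow> g = h)"

definition epic :: "'o \<Rightarrow> 'o \<Rightarrow> 'm \<Rightarrow> bool" where
  "epic X Y f \<longleftrightarrow> f \<in> Hom C X Y \<and>
     (\<forall>W. \<forall>g\<in>Hom C Y W. \<forall>h\<in>Hom C Y W. g \<cdot> f = h \<cdot> f \<longrightarrow> g = h)"

definition kernel_of :: "'o \<Rightarrow> 'o \<Rightarrow> 'm \<Rightarrow> 'o \<Rightarrow> 'm \<Rightarrow> bool" where
  "kernel_of X Y f A i \<longleftrightarrow> i \<in> Hom C A X \<and> f \<cdot> i = 0 \<and>
     (\<forall>W. \<forall>h\<in>Hom C W X. f \<cdot> h = 0 \<longrightarrow> (\<exists>!u. u \<in> Hom C W A \<and> i \<cdot> u = h))"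

definition cokernel_of :: "'o \<Rightarrow> 'o \<Rightarrow> 'm \<Rightarrow> 'o \<Rightarrow> 'm \<Rightarrow> bool" where
  "cokernel_of X Y f A p \<longleftrightarrow> p \<in> Hom C Y A \<and> p \<cdot> f = 0 \<and>
     (\<forall>W. \<forall>h\<in>Hom C Y W. h \<cdot> f = 0 \<longrightarrow> (\<exists>!u. u \<in> Hom C A W \<and> u \<cdot> p = h))"

definition zero_object :: "'o \<Rightarrow> bool" where
  "zero_object Z \<longleftrightarrow> (\<forall>X. Hom C Z X = {0} \<and> Hom C X Z = {0})"

text \<open>\<open>X\<close> is the direct sum of \<open>S 0, \<dots>, S (n - 1)\<close>.\<close>

definition direct_sum :: "nat \<Rightarrow> (nat \<Rightarrow> 'o) \<Rightarrow> 'o \<Rightarrow> bool" where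
  "direct_sum n S X \<longleftrightarrow> (\<exists>i p.
     (\<forall>j<n. i j \<in> Hom C (S j) X \<and> p j \<in> Hom C X (S j)) \<and>
     (\<forall>j<n. \<forall>l<n. p j \<cdot> i l = (if j = l then \<iota> (S j) else 0)) \<and>
     (\<Sum>j<n. i j \<cdot> p j) = \<iota> X)"

definition simple_object :: "'o \<Rightarrow> bool" where
  "simple_object X \<longleftrightarrow> \<not> zero_object X \<and> (\<forall>Y f. monic Y X f \<longrightarrow> zero_object Y \<or> is_iso Y X f)"

definition complete_set_of_simples :: "'o set \<Rightarrow> bool" where
  "complete_set_of_simples A \<longleftrightarrow> (\<forall>S\<in>A. simple_object S) \<and>
     (\<forall>S\<in>A. \<forall>T\<in>A. isomorphic S T \<longrightarrow> S = T) \<and>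
     (\<forall>X. simple_object X \<longrightarrow> (\<exists>S\<in>A. isomorphic X S))"

end

locale abelian_category = linear_category +
  assumes ex_zero_object: "\<exists>Z. zero_object C Z"
    and ex_direct_sum: "\<exists>P. direct_sum C n S P"
    and ex_kernel: "f \<in> Hom C X Y \<Longrightarrow> \<exists>A i. kernel_of C X Y f A i"
    and ex_cokernel: "f \<in> Hom C X Y \<Longrightarrow> \<exists>A p. cokernel_of C X Y f A p"
    and mono_is_kernel: "monic C X Y f \<Longrightarrow> \<exists>Z g. g \<in> Hom C Y Z \<and> kernel_of C Y Z g X f"
    and epi_is_cokernel: "epic C X Y f \<Longrightarrow> \<exists>Z g. g \<in> Hom C Z X \<and> cokernel_of C Z X g Y f"

locale semisimple_category = abelian_category +
  assumes semisimple: "\<exists>n S. (\<forall>j<n. simple_object C (S j)) \<and> direct_sum C n S X"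

section \<open>Monoidal categories\<close>

record ('o, 'm, 'k) mon_cat = "('o, 'm, 'k) lin_cat" +
  Unit :: "'o"  ("\<one>\<index>")
  TensO :: "'o \<Rightarrow> 'o \<Rightarrow> 'o"  (infixl "\<odot>\<index>" 72)
  TensM :: "'m \<Rightarrow> 'm \<Rightarrow> 'm"  (infixl "\<otimes>\<index>" 72)
  Assoc :: "'o \<Rightarrow> 'o \<Rightarrow> 'o \<Rightarrow> 'm"  ("\<a>\<index>")
  LUnit :: "'o \<Rightarrow> 'm"  ("\<l>\<index>")
  RUnit :: "'o \<Rightarrow> 'm"  ("\<r>\<index>")

locale monoidal_category = linear_category C
  for C :: "('o, 'm::ab_group_add, 'k::field, 'z) mon_cat_scheme" (structure) +
  assumes tensor_in_Hom: "\<lbrakk>f \<in> Hom C X Y; g \<in> Hom C X' Y'\<rbrakk>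
      \<Longrightarrow> f \<otimes> g \<in> Hom C (X \<odot> X') (Y \<odot> Y')"
    and tensor_id: "\<iota> X \<otimes> \<iota> Y = \<iota> (X \<odot> Y)"
    and tensor_comp: "\<lbrakk>f \<in> Hom C X Y; g \<in> Hom C Y Z; f' \<in> Hom C X' Y'; g' \<in> Hom C Y' Z'\<rbrakk>
      \<Longrightarrow> (g \<cdot> f) \<otimes> (g' \<cdot> f') = (g \<otimes> g') \<cdot> (f \<otimes> f')"
    and tensor_add_left: "\<lbrakk>f \<in> Hom C X Y; f' \<in> Hom C X Y; g \<in> Hom C X' Y'\<rbrakk>
      \<Longrightarrow> (f + f') \<otimes> g = f \<otimes> g + f' \<otimes> g"
    and tensor_add_right: "\<lbrakk>f \<in> Hom C X Y; g \<in> Hom C X' Y'; g' \<in> Hom C X' Y'\<rbrakk>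
      \<Longrightarrow> f \<otimes> (g + g') = f \<otimes> g + f \<otimes> g'"
    and tensor_scale_left: "\<lbrakk>f \<in> Hom C X Y; g \<in> Hom C X' Y'\<rbrakk>
      \<Longrightarrow> (k \<star> f) \<otimes> g = k \<star> (f \<otimes> g)"
    and tensor_scale_right: "\<lbrakk>f \<in> Hom C X Y; g \<in> Hom C X' Y'\<rbrakk>
      \<Longrightarrow> f \<otimes> (k \<star> g) = k \<star> (f \<otimes> g)"
    and assoc_iso: "is_iso C ((X \<odot> Y) \<odot> Z) (X \<odot> (Y \<odot> Z)) (\<a> X Y Z)"
    and assoc_natural: "\<lbrakk>f \<in> Hom C X X'; g \<in> Hom C Y Y'; h \<in> Hom C Z Z'\<rbrakk>
      \<Longrightarrow> \<a> X' Y' Z' \<cdot> ((f \<otimes> g) \<otimes> h) = (f \<otimes> (g \<otimes> h)) \<cdot> \<a> X Y Z"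
    and lunit_iso: "is_iso C (\<one> \<odot> X) X (\<l> X)"
    and lunit_natural: "f \<in> Hom C X Y \<Longrightarrow> \<l> Y \<cdot> (\<iota> \<one> \<otimes> f) = f \<cdot> \<l> X"
    and runit_iso: "is_iso C (X \<odot> \<one>) X (\<r> X)"
    and runit_natural: "f \<in> Hom C X Y \<Longrightarrow> \<r> Y \<cdot> (f \<otimes> \<iota> \<one>) = f \<cdot> \<r> X"
    and pentagon: "\<a> W X (Y \<odot> Z) \<cdot> \<a> (W \<odot> X) Y Z
      = (\<iota> W \<otimes> \<a> X Y Z) \<cdot> \<a> W (X \<odot> Y) Z \<cdot> (\<a> W X Y \<otimes> \<iota> Z)"
    and triangle: "(\<iota> X \<otimes> \<l> Y) \<cdot> \<a> X \<one> Y = \<r> X \<otimes> \<iota> Y"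

context
  fixes C :: "('o, 'm::ab_group_add, 'k::field, 'z) mon_cat_scheme" (structure)
begin

definition assoc_inv :: "'o \<Rightarrow> 'o \<Rightarrow> 'o \<Rightarrow> 'm" where
  "assoc_inv X Y Z = inv_mor C ((X \<odot> Y) \<odot> Z) (X \<odot> (Y \<odot> Z)) (\<a> X Y Z)"

definition lunit_inv :: "'o \<Rightarrow> 'm" where
  "lunit_inv X = inv_mor C (\<one> \<odot> X) X (\<l> X)"

definition runit_inv :: "'o \<Rightarrow> 'm" where
  "runit_inv X = inv_mor C (X \<odot> \<one>) X (\<r> X)"

end

section \<open>Pivotal categories\<close>

text \<open>
  \<open>ev\<^sub>X : X\<^sup>\<or> X \<rightarrow> 1\<close>, \<open>coev\<^sub>X : 1 \<rightarrow> X X\<^sup>\<or>\<close>, and the pivotal structure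
  \<open>\<pi>\<^sub>X : X \<rightarrow> X\<^sup>\<or>\<^sup>\<or>\<close>.
\<close>

record ('o, 'm, 'k) piv_cat = "('o, 'm, 'k) mon_cat" +
  Dual :: "'o \<Rightarrow> 'o"  ("dual\<index>")
  Ev :: "'o \<Rightarrow> 'm"  ("ev\<index>")
  Coev :: "'o \<Rightarrow> 'm"  ("coev\<index>")
  Piv :: "'o \<Rightarrow> 'm"  ("\<pi>\<index>")

context
  fixes C :: "('o, 'm::ab_group_add, 'k::field, 'z) piv_cat_scheme" (structure)
begin

text \<open>
  The morphism \<open>A \<rightarrow> X\<^sup>\<or>\<close> corresponding to \<open>e : A X \<rightarrow> 1\<close> under duality, i.e. the
  unique \<open>u\<close> with \<open>ev\<^sub>X \<circ> (u \<otimes> id) = e\<close>.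
\<close>

definition dual_transpose :: "'o \<Rightarrow> 'o \<Rightarrow> 'm \<Rightarrow> 'm" where
  "dual_transpose A X e =
     \<l> (dual X) \<cdot> (e \<otimes> \<iota> (dual X)) \<cdot> assoc_inv C A X (dual X)
       \<cdot> (\<iota> A \<otimes> coev X) \<cdot> runit_inv C A"

text \<open>\<open>f\<^sup>\<or> : Y\<^sup>\<or> \<rightarrow> X\<^sup>\<or>\<close> for \<open>f : X \<rightarrow> Y\<close>.\<close>

definition dual_mor :: "'o \<Rightarrow> 'o \<Rightarrow> 'm \<Rightarrow> 'm" where
  "dual_mor X Y f = dual_transpose (dual Y) X (ev Y \<cdot> (\<iota> (dual Y) \<otimes> f))"

text \<open>The canonical isomorphism \<open>Y\<^sup>\<or> X\<^sup>\<or> \<rightarrow> (X Y)\<^sup>\<or>\<close>.\<close>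

definition dual_tensor :: "'o \<Rightarrow> 'o \<Rightarrow> 'm" where
  "dual_tensor X Y = dual_transpose (dual Y \<odot> dual X) (X \<odot> Y)
     (ev Y \<cdot> (\<iota> (dual Y) \<otimes> (\<l> Y \<cdot> (ev X \<otimes> \<iota> Y) \<cdot> assoc_inv C (dual X) X Y))
       \<cdot> \<a> (dual Y) (dual X) (X \<odot> Y))"

end

locale pivotal_category = monoidal_category C
  for C :: "('o, 'm::ab_group_add, 'k::field, 'z) piv_cat_scheme" (structure) +
  assumes ev_in_Hom: "ev X \<in> Hom C (dual X \<odot> X) \<one>"
    and coev_in_Hom: "coev X \<in> Hom C \<one> (X \<odot> dual X)"
    and zigzag: "\<r> X \<cdot> (\<iota> X \<otimes> ev X) \<cdot> \<a> X (dual X) X \<cdot> (coev X \<otimes> \<iota> X) = \<l> X"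
    and zigzag_dual: "\<l> (dual X) \<cdot> (ev X \<otimes> \<iota> (dual X)) \<cdot> assoc_inv C (dual X) X (dual X)
      \<cdot> (\<iota> (dual X) \<otimes> coev X) = \<r> (dual X)"
    and piv_iso: "is_iso C X (dual (dual X)) (\<pi> X)"
    and piv_natural: "f \<in> Hom C X Y
      \<Longrightarrow> dual_mor C (dual Y) (dual X) (dual_mor C X Y f) \<cdot> \<pi> X = \<pi> Y \<cdot> f"
    and piv_monoidal:
      "dual_mor C (dual Y \<odot> dual X) (dual (X \<odot> Y)) (dual_tensor C X Y) \<cdot> \<pi> (X \<odot> Y)
        = dual_tensor C (dual Y) (dual X) \<cdot> (\<pi> X \<otimes> \<pi> Y)"

context
  fixes C :: "('o, 'm::ab_group_add, 'k::field, 'z) piv_cat_scheme" (structure)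
begin

text \<open>\<open>1 \<rightarrow> X\<^sup>\<or> X\<close> and \<open>X X\<^sup>\<or> \<rightarrow> 1\<close>.\<close>

definition piv_coev :: "'o \<Rightarrow> 'm" where
  "piv_coev X =
     (\<iota> (dual X) \<otimes> inv_mor C X (dual (dual X)) (\<pi> X)) \<cdot> coev (dual X)"

definition piv_ev :: "'o \<Rightarrow> 'm" where
  "piv_ev X = ev (dual X) \<cdot> (\<pi> X \<otimes> \<iota> (dual X))"

definition left_trace :: "'o \<Rightarrow> 'm \<Rightarrow> 'm" where
  "left_trace X f = ev X \<cdot> (\<iota> (dual X) \<otimes> f) \<cdot> piv_coev X"

definition right_trace :: "'o \<Rightarrow> 'm \<Rightarrow> 'm" where
  "right_trace X f = piv_ev X \<cdot> (f \<otimes> \<iota> (dual X)) \<cdot> coev X"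

text \<open>The right partial trace \<open>X \<rightarrow> Z\<close> of \<open>f : X Y \<rightarrow> Z Y\<close>.\<close>

definition right_partial_trace :: "'o \<Rightarrow> 'o \<Rightarrow> 'o \<Rightarrow> 'm \<Rightarrow> 'm" where
  "right_partial_trace X Y Z f =
     \<r> Z \<cdot> (\<iota> Z \<otimes> piv_ev Y) \<cdot> \<a> Z Y (dual Y) \<cdot> (f \<otimes> \<iota> (dual Y))
       \<cdot> assoc_inv C X Y (dual Y) \<cdot> (\<iota> X \<otimes> coev Y) \<cdot> runit_inv C X"

definition qdim :: "'o \<Rightarrow> 'k" where
  "qdim X = (THE k. right_trace X (\<iota> X) = k \<star> \<iota> \<one>)"

definition global_dim :: "'o set \<Rightarrow> 'k" where
  "global_dim A = (\<Sum>S\<in>A. (qdim S)\<^sup>2)"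

end

locale spherical_fusion_category = pivotal_category C + semisimple_category C
  for C :: "('o, 'm::ab_group_add, 'k::alg_closed_field, 'z) piv_cat_scheme" (structure) +
  assumes finitely_many_simples:
      "\<exists>A. finite A \<and> (\<forall>X. simple_object C X \<longrightarrow> (\<exists>S\<in>A. isomorphic C X S))"
    and unit_simple: "simple_object C \<one>"
    and spherical: "f \<in> Hom C X X \<Longrightarrow> left_trace C X f = right_trace C X f"

section \<open>Pre-modular tensor categories\<close>

record ('o, 'm, 'k) braided_cat = "('o, 'm, 'k) piv_cat" +
  Braid :: "'o \<Rightarrow> 'o \<Rightarrow> 'm"  ("\<c>\<index>")

context
  fixes C :: "('o, 'm::ab_group_add, 'k::field, 'z) braided_cat_scheme" (structure)
begin

definition twist :: "'o \<Rightarrow> 'm" where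
  "twist X = right_partial_trace C X X X (\<c> X X)"

definition twist_scalar :: "'o \<Rightarrow> 'k" where
  "twist_scalar X = (THE k. twist X = k \<star> \<iota> X)"

definition T_matrix :: "'o \<Rightarrow> 'o \<Rightarrow> 'k" where
  "T_matrix X Y = (if X = Y then twist_scalar X else 0)"

end

locale pre_modular_category = spherical_fusion_category C
  for C :: "('o, 'm::ab_group_add, 'k::alg_closed_field, 'z) braided_cat_scheme" (structure) +
  assumes braid_iso: "is_iso C (X \<odot> Y) (Y \<odot> X) (\<c> X Y)"
    and braid_natural: "\<lbrakk>f \<in> Hom C X X'; g \<in> Hom C Y Y'\<rbrakk>
      \<Longrightarrow> \<c> X' Y' \<cdot> (f \<otimes> g) = (g \<otimes> f) \<cdot> \<c> X Y"
    and hexagon: "\<a> Y Z X \<cdot> \<c> X (Y \<odot> Z) \<cdot> \<a> X Y Z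
      = (\<iota> Y \<otimes> \<c> X Z) \<cdot> \<a> Y X Z \<cdot> (\<c> X Y \<otimes> \<iota> Z)"
    and hexagon_inv: "assoc_inv C Z X Y \<cdot> \<c> (X \<odot> Y) Z \<cdot> assoc_inv C X Y Z
      = (\<c> X Z \<otimes> \<iota> Y) \<cdot> assoc_inv C X Z Y \<cdot> (\<iota> X \<otimes> \<c> Y Z)"
    and balanced: "twist C (X \<odot> Y) = \<c> Y X \<cdot> \<c> X Y \<cdot> (twist C X \<otimes> twist C Y)"

section \<open>Pivotal monoidal functors\<close>

text \<open>\<open>FTens X Y : M(X) M(Y) \<rightarrow> M(X Y)\<close> and \<open>FUnit : 1 \<rightarrow> M(1)\<close>.\<close>

record ('o, 'm, 'p, 'n) mon_fun =
  FO :: "'o \<Rightarrow> 'p"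
  FM :: "'m \<Rightarrow> 'n"
  FTens :: "'o \<Rightarrow> 'o \<Rightarrow> 'n"
  FUnit :: "'n"

locale linear_functor = src: linear_category C + tgt: linear_category D
  for C :: "('o, 'm::ab_group_add, 'k::field, 'z) lin_cat_scheme"
    and D :: "('p, 'n::ab_group_add, 'k, 'y) lin_cat_scheme"
    and M :: "('o, 'm, 'p, 'n) mon_fun" +
  assumes FM_in_Hom: "f \<in> Hom C X Y \<Longrightarrow> FM M f \<in> Hom D (FO M X) (FO M Y)"
    and FM_id: "FM M (\<iota>\<^bsub>C\<^esub> X) = \<iota>\<^bsub>D\<^esub> (FO M X)"
    and FM_comp: "\<lbrakk>f \<in> Hom C X Y; g \<in> Hom C Y Z\<rbrakk>
      \<Longrightarrow> FM M (g \<cdot>\<^bsub>C\<^esub> f) = FM M g \<cdot>\<^bsub>D\<^esub> FM M f"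
    and FM_add: "\<lbrakk>f \<in> Hom C X Y; g \<in> Hom C X Y\<rbrakk> \<Longrightarrow> FM M (f + g) = FM M f + FM M g"
    and FM_scale: "f \<in> Hom C X Y \<Longrightarrow> FM M (k \<star>\<^bsub>C\<^esub> f) = k \<star>\<^bsub>D\<^esub> FM M f"

locale monoidal_functor =
  src: monoidal_category C + tgt: monoidal_category D + linear_functor C D M
  for C :: "('o, 'm::ab_group_add, 'k::field, 'z) mon_cat_scheme"
    and D :: "('p, 'n::ab_group_add, 'k, 'y) mon_cat_scheme"
    and M :: "('o, 'm, 'p, 'n) mon_fun" +
  assumes FTens_iso: "is_iso D (FO M X \<odot>\<^bsub>D\<^esub> FO M Y) (FO M (X \<odot>\<^bsub>C\<^esub> Y)) (FTens M X Y)"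
    and FTens_natural: "\<lbrakk>f \<in> Hom C X X'; g \<in> Hom C Y Y'\<rbrakk>
      \<Longrightarrow> FTens M X' Y' \<cdot>\<^bsub>D\<^esub> (FM M f \<otimes>\<^bsub>D\<^esub> FM M g) = FM M (f \<otimes>\<^bsub>C\<^esub> g) \<cdot>\<^bsub>D\<^esub> FTens M X Y"
    and FUnit_iso: "is_iso D \<one>\<^bsub>D\<^esub> (FO M \<one>\<^bsub>C\<^esub>) (FUnit M)"
    and FTens_assoc:
      "FM M (\<a>\<^bsub>C\<^esub> X Y Z) \<cdot>\<^bsub>D\<^esub> FTens M (X \<odot>\<^bsub>C\<^esub> Y) Z \<cdot>\<^bsub>D\<^esub> (FTens M X Y \<otimes>\<^bsub>D\<^esub> \<iota>\<^bsub>D\<^esub> (FO M Z))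
        = FTens M X (Y \<odot>\<^bsub>C\<^esub> Z) \<cdot>\<^bsub>D\<^esub> (\<iota>\<^bsub>D\<^esub> (FO M X) \<otimes>\<^bsub>D\<^esub> FTens M Y Z)
            \<cdot>\<^bsub>D\<^esub> \<a>\<^bsub>D\<^esub> (FO M X) (FO M Y) (FO M Z)"
    and FTens_lunit:
      "FM M (\<l>\<^bsub>C\<^esub> X) \<cdot>\<^bsub>D\<^esub> FTens M \<one>\<^bsub>C\<^esub> X \<cdot>\<^bsub>D\<^esub> (FUnit M \<otimes>\<^bsub>D\<^esub> \<iota>\<^bsub>D\<^esub> (FO M X)) = \<l>\<^bsub>D\<^esub> (FO M X)"
    and FTens_runit:
      "FM M (\<r>\<^bsub>C\<^esub> X) \<cdot>\<^bsub>D\<^esub> FTens M X \<one>\<^bsub>C\<^esub> \<cdot>\<^bsub>D\<^esub> (\<iota>\<^bsub>D\<^esub> (FO M X) \<otimes>\<^bsub>D\<^esub> FUnit M) = \<r>\<^bsub>D\<^esub> (FO M X)"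

definition FTens_inv ::
  "('o, 'm, 'k::field, 'z) mon_cat_scheme \<Rightarrow> ('p, 'n::ab_group_add, 'k, 'y) mon_cat_scheme \<Rightarrow>
     ('o, 'm, 'p, 'n) mon_fun \<Rightarrow> 'o \<Rightarrow> 'o \<Rightarrow> 'n" where
  "FTens_inv C D M X Y =
     inv_mor D (FO M X \<odot>\<^bsub>D\<^esub> FO M Y) (FO M (X \<odot>\<^bsub>C\<^esub> Y)) (FTens M X Y)"

definition FUnit_inv ::
  "('o, 'm, 'k::field, 'z) mon_cat_scheme \<Rightarrow> ('p, 'n::ab_group_add, 'k, 'y) mon_cat_scheme \<Rightarrow>
     ('o, 'm, 'p, 'n) mon_fun \<Rightarrow> 'n" where
  "FUnit_inv C D M = inv_mor D \<one>\<^bsub>D\<^esub> (FO M \<one>\<^bsub>C\<^esub>) (FUnit M)"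

text \<open>The canonical isomorphism \<open>M(X\<^sup>\<or>) \<rightarrow> M(X)\<^sup>\<or>\<close>.\<close>

definition dual_comparison ::
  "('o, 'm, 'k::field, 'z) piv_cat_scheme \<Rightarrow> ('p, 'n::ab_group_add, 'k, 'y) piv_cat_scheme \<Rightarrow>
     ('o, 'm, 'p, 'n) mon_fun \<Rightarrow> 'o \<Rightarrow> 'n" where
  "dual_comparison C D M X = dual_transpose D (FO M (dual\<^bsub>C\<^esub> X)) (FO M X)
     (FUnit_inv C D M \<cdot>\<^bsub>D\<^esub> FM M (ev\<^bsub>C\<^esub> X) \<cdot>\<^bsub>D\<^esub> FTens M (dual\<^bsub>C\<^esub> X) X)"

locale pivotal_functor =
  src: pivotal_category C + tgt: pivotal_category D + monoidal_functor C D M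
  for C :: "('o, 'm::ab_group_add, 'k::field, 'z) piv_cat_scheme"
    and D :: "('p, 'n::ab_group_add, 'k, 'y) piv_cat_scheme"
    and M :: "('o, 'm, 'p, 'n) mon_fun" +
  assumes preserves_piv:
    "dual_mor D (FO M (dual\<^bsub>C\<^esub> X)) (dual\<^bsub>D\<^esub> (FO M X)) (dual_comparison C D M X)
        \<cdot>\<^bsub>D\<^esub> \<pi>\<^bsub>D\<^esub> (FO M X)
      = dual_comparison C D M (dual\<^bsub>C\<^esub> X) \<cdot>\<^bsub>D\<^esub> FM M (\<pi>\<^bsub>C\<^esub> X)"

section \<open>The tube category\<close>

context
  fixes C :: "('o, 'm::ab_group_add, 'k::field, 'z) mon_cat_scheme" (structure)
    and A :: "'o set"
begin

text \<open>
  An element of \<open>\<Oplus>\<^bsub>S\<in>A\<^esub> Hom(S X, Y S)\<close> is the family of its components, extended by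
  \<open>0\<close> outside \<open>A\<close> (a complete, hence finite, set of simple objects).
\<close>

definition tube_hom :: "'o \<Rightarrow> 'o \<Rightarrow> ('o \<Rightarrow> 'm) set" where
  "tube_hom X Y =
     {\<alpha>. (\<forall>S\<in>A. \<alpha> S \<in> Hom C (S \<odot> X) (Y \<odot> S)) \<and> (\<forall>S. S \<notin> A \<longrightarrow> \<alpha> S = 0)}"

definition dual_bases :: "'o \<Rightarrow> 'o \<Rightarrow> 'm set \<times> ('m \<Rightarrow> 'm) \<Rightarrow> bool" where
  "dual_bases S G = (\<lambda>(B, d).
     \<not> module.dependent (Scale C) B \<and> module.span (Scale C) B = Hom C S G \<and>
     (\<forall>b\<in>B. d b \<in> Hom C G S) \<and>
     (\<forall>b\<in>B. \<forall>b'\<in>B. d b \<cdot> b' = (if b = b' then \<iota> S else 0)))"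

text \<open>
  \<open>\<alpha>\<^sub>G \<in> tube_hom X Y\<close> for \<open>\<alpha> : G X \<rightarrow> Y G\<close>; it does not depend on the chosen bases.
\<close>

definition tube_mor :: "'o \<Rightarrow> 'o \<Rightarrow> 'o \<Rightarrow> 'm \<Rightarrow> 'o \<Rightarrow> 'm" where
  "tube_mor X Y G \<alpha> = (\<lambda>S. if S \<in> A then
     (case SOME Bd. dual_bases S G Bd of (B, d) \<Rightarrow>
        \<Sum>b\<in>B. (\<iota> Y \<otimes> d b) \<cdot> \<alpha> \<cdot> (b \<otimes> \<iota> X))
     else 0)"

definition tube_id :: "'o \<Rightarrow> 'o \<Rightarrow> 'm" where
  "tube_id X = tube_mor X X \<one> (runit_inv C X \<cdot> \<l> X)"

text \<open>
  \<open>\<beta> \<circ> \<alpha>\<close> for \<open>\<alpha> : X \<rightarrow> Y\<close> and \<open>\<beta> : Y \<rightarrow> Z\<close>: the formula for \<open>\<beta>\<^sub>H \<circ> \<alpha>\<^sub>G\<close> extended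
  bilinearly along \<open>\<alpha> = \<Sum>\<^sub>T (\<alpha> T)\<^sub>T\<close> and \<open>\<beta> = \<Sum>\<^sub>S (\<beta> S)\<^sub>S\<close>.
\<close>

definition tube_comp :: "'o \<Rightarrow> 'o \<Rightarrow> 'o \<Rightarrow> ('o \<Rightarrow> 'm) \<Rightarrow> ('o \<Rightarrow> 'm) \<Rightarrow> 'o \<Rightarrow> 'm" where
  "tube_comp X Y Z \<beta> \<alpha> = (\<lambda>U. \<Sum>S\<in>A. \<Sum>T\<in>A. tube_mor X Z (S \<odot> T)
     (\<a> Z S T \<cdot> (\<beta> S \<otimes> \<iota> T) \<cdot> assoc_inv C S Y T \<cdot> (\<iota> S \<otimes> \<alpha> T) \<cdot> \<a> S T X) U)"

end

text \<open>
  The data of a contravariant functor from the tube category to finite-dimensional vector spaces.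
  Its values are subspaces of one ambient vector space; \<open>VMor F X Y \<alpha>\<close> is the linear map
  \<open>F(Y) \<rightarrow> F(X)\<close> assigned to \<open>\<alpha> : X \<rightarrow> Y\<close>.
\<close>

record ('o, 'm, 'v, 'k) tube_functor =
  VScale :: "'k \<Rightarrow> 'v \<Rightarrow> 'v"
  VObj :: "'o \<Rightarrow> 'v set"
  VMor :: "'o \<Rightarrow> 'o \<Rightarrow> ('o \<Rightarrow> 'm) \<Rightarrow> 'v \<Rightarrow> 'v"

locale contravariant_tube_functor =
  fixes C :: "('o, 'm::ab_group_add, 'k::field, 'z) mon_cat_scheme"
    and A :: "'o set"
    and F :: "('o, 'm, 'v::ab_group_add, 'k) tube_functor"
  assumes V_vector_space: "vector_space (VScale F)"
    and V_subspace: "module.subspace (VScale F) (VObj F X)"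
    and V_finite_dim: "\<exists>B. finite B \<and> module.span (VScale F) B = VObj F X"
    and V_map: "\<lbrakk>\<alpha> \<in> tube_hom C A X Y; v \<in> VObj F Y\<rbrakk> \<Longrightarrow> VMor F X Y \<alpha> v \<in> VObj F X"
    and V_map_add: "\<lbrakk>\<alpha> \<in> tube_hom C A X Y; v \<in> VObj F Y; w \<in> VObj F Y\<rbrakk>
      \<Longrightarrow> VMor F X Y \<alpha> (v + w) = VMor F X Y \<alpha> v + VMor F X Y \<alpha> w"
    and V_map_scale: "\<lbrakk>\<alpha> \<in> tube_hom C A X Y; v \<in> VObj F Y\<rbrakk>
      \<Longrightarrow> VMor F X Y \<alpha> (VScale F k v) = VScale F k (VMor F X Y \<alpha> v)"
    and V_linear_add: "\<lbrakk>\<alpha> \<in> tube_hom C A X Y; \<beta> \<in> tube_hom C A X Y; v \<in> VObj F Y\<rbrakk>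
      \<Longrightarrow> VMor F X Y (\<lambda>S. \<alpha> S + \<beta> S) v = VMor F X Y \<alpha> v + VMor F X Y \<beta> v"
    and V_linear_scale: "\<lbrakk>\<alpha> \<in> tube_hom C A X Y; v \<in> VObj F Y\<rbrakk>
      \<Longrightarrow> VMor F X Y (\<lambda>S. k \<star>\<^bsub>C\<^esub> \<alpha> S) v = VScale F k (VMor F X Y \<alpha> v)"
    and V_id: "v \<in> VObj F X \<Longrightarrow> VMor F X X (tube_id C A X) v = v"
    and V_comp: "\<lbrakk>\<alpha> \<in> tube_hom C A X Y; \<beta> \<in> tube_hom C A Y Z; v \<in> VObj F Z\<rbrakk>
      \<Longrightarrow> VMor F X Z (tube_comp C A X Y Z \<beta> \<alpha>) v = VMor F X Y \<alpha> (VMor F Y Z \<beta> v)"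

section \<open>The functor associated with a pivotal monoidal functor\<close>

text \<open>
  The image of \<open>\<beta> : M(Y) \<rightarrow> 1\<close> under \<open>\<alpha>\<^sub>G\<close>, where \<open>\<alpha> : G X \<rightarrow> Y G\<close>.
\<close>

definition TM_action ::
  "('o, 'm::ab_group_add, 'k::field, 'z) piv_cat_scheme \<Rightarrow>
     ('p, 'n::ab_group_add, 'k, 'y) piv_cat_scheme \<Rightarrow> ('o, 'm, 'p, 'n) mon_fun \<Rightarrow>
     'o \<Rightarrow> 'o \<Rightarrow> 'o \<Rightarrow> 'm \<Rightarrow> 'n \<Rightarrow> 'n" where
  "TM_action C D M X Y G \<alpha> \<beta> =
     FUnit_inv C D M
       \<cdot>\<^bsub>D\<^esub> FM M (ev\<^bsub>C\<^esub> G)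
       \<cdot>\<^bsub>D\<^esub> FTens M (dual\<^bsub>C\<^esub> G) G
       \<cdot>\<^bsub>D\<^esub> (\<iota>\<^bsub>D\<^esub> (FO M (dual\<^bsub>C\<^esub> G)) \<otimes>\<^bsub>D\<^esub>
            (\<l>\<^bsub>D\<^esub> (FO M G) \<cdot>\<^bsub>D\<^esub> (\<beta> \<otimes>\<^bsub>D\<^esub> \<iota>\<^bsub>D\<^esub> (FO M G)) \<cdot>\<^bsub>D\<^esub> FTens_inv C D M Y G))
       \<cdot>\<^bsub>D\<^esub> FTens_inv C D M (dual\<^bsub>C\<^esub> G) (Y \<odot>\<^bsub>C\<^esub> G)
       \<cdot>\<^bsub>D\<^esub> FM M (\<iota>\<^bsub>C\<^esub> (dual\<^bsub>C\<^esub> G) \<otimes>\<^bsub>C\<^esub> \<alpha>)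
       \<cdot>\<^bsub>D\<^esub> FM M (\<a>\<^bsub>C\<^esub> (dual\<^bsub>C\<^esub> G) G X)
       \<cdot>\<^bsub>D\<^esub> FM M (piv_coev C G \<otimes>\<^bsub>C\<^esub> \<iota>\<^bsub>C\<^esub> X)
       \<cdot>\<^bsub>D\<^esub> FM M (lunit_inv C X)"

text \<open>
  A general morphism of the tube category is \<open>\<alpha> = \<Sum>\<^bsub>S\<in>A\<^esub> (\<alpha> S)\<^sub>S\<close>, so linearity forces
  the sum in the action on morphisms.
\<close>

definition TM ::
  "('o, 'm::ab_group_add, 'k::field, 'z) piv_cat_scheme \<Rightarrow> 'o set \<Rightarrow>
     ('p, 'n::ab_group_add, 'k, 'y) piv_cat_scheme \<Rightarrow> ('o, 'm, 'p, 'n) mon_fun \<Rightarrow>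
     ('o, 'm, 'n, 'k) tube_functor" where
  "TM C A D M = \<lparr>
     VScale = Scale D,
     VObj = (\<lambda>X. Hom D (FO M X) \<one>\<^bsub>D\<^esub>),
     VMor = (\<lambda>X Y \<alpha> \<beta>. \<Sum>S\<in>A. TM_action C D M X Y S (\<alpha> S) \<beta>)\<rparr>"

section \<open>T-invariance\<close>

context
  fixes C :: "('o, 'm::ab_group_add, 'k::field, 'z) braided_cat_scheme" (structure)
    and A :: "'o set"
begin

definition tube_eps :: "'o \<Rightarrow> 'o \<Rightarrow> 'o \<Rightarrow> 'm" where
  "tube_eps X Y = (\<lambda>S. if S \<in> A then
     (qdim C S / global_dim C A) \<star>
       (assoc_inv C X Y S
         \<cdot> (\<iota> X \<otimes> inv_mor C (Y \<odot> S) (S \<odot> Y) (\<c> Y S))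
         \<cdot> \<a> X S Y
         \<cdot> (\<c> S X \<otimes> \<iota> Y)
         \<cdot> assoc_inv C S X Y)
     else 0)"

definition eps_space :: "('o, 'm, 'v::ab_group_add, 'k) tube_functor \<Rightarrow> 'o \<Rightarrow> 'o \<Rightarrow> 'v set" where
  "eps_space F X Y =
     {v \<in> VObj F (X \<odot> Y). VMor F (X \<odot> Y) (X \<odot> Y) (tube_eps X Y) v = v}"

definition Z_matrix :: "('o, 'm, 'v::ab_group_add, 'k) tube_functor \<Rightarrow> 'o \<Rightarrow> 'o \<Rightarrow> nat" where
  "Z_matrix F X Y = vector_space.dim (VScale F) (eps_space F X Y)"

text \<open>
  Commutation of \<open>Z(F)\<close> with the diagonal matrix \<open>\<T>\<close>, where the entries of \<open>Z(F)\<close>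
  are compared with \<open>0\<close> as integers, not in \<open>K\<close> (which may have positive characteristic).
\<close>

definition T_invariant :: "('o, 'm, 'v::ab_group_add, 'k) tube_functor \<Rightarrow> bool" where
  "T_invariant F \<longleftrightarrow> contravariant_tube_functor C A F \<and>
     (\<forall>I\<in>A. \<forall>J\<in>A. Z_matrix F I J \<noteq> 0 \<longrightarrow> T_matrix C I I = T_matrix C J J)"

end

end

theory Submission
  imports Defs
begin

text \<open>
  A vector \<open>v : M(I J) \<rightarrow> 1\<close> fixed by the idempotent is an average of its encirclements by
  loops of all colours \<open>T\<close>, weighted by \<open>d(T)\<close>, where the loop passes over \<open>I\<close> and under
  \<open>J\<close>. A strand \<open>S\<close> passing over \<open>I\<close> and under \<open>J\<close> can be fused into such a loop, and refolding
  the result shows that the strand may as well pass on the other side of \<open>v\<close> (handle slide).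
  For \<open>S = I\<close>, closing up the strand on the left turns this into
  \<open>\<theta>\<^sub>I\<^sup>-\<^sup>1 v = w c\<^sub>J\<^sub>I\<^sup>-\<^sup>1\<close>, where \<open>w : M(J I) \<rightarrow> 1\<close> is the left rotation of \<open>v\<close>; for
  \<open>S = J\<close>, closing up on the right gives \<open>\<theta>\<^sub>J\<^sup>-\<^sup>1 v = w' c\<^sub>J\<^sub>I\<^sup>-\<^sup>1\<close> with the right rotation
  \<open>w'\<close>. Both rotations agree because \<open>D\<close> is pivotal and \<open>M\<close> preserves the pivotal structure, so
  \<open>\<theta>\<^sub>I = \<theta>\<^sub>J\<close> if \<open>v \<noteq> 0\<close>.
\<close>

section \<open>Linear categories\<close>

text \<open>The weights d(T) are what makes the handle slide work. Fusing a strand S into a loop T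
  sums over a simple U and a basis of Hom(U, T S); refolding the picture around U reads this basis
  as one of Hom(T^v, S U^v). Bending preserves the duality of bases only up to the factor d(U) /
  d(T), so the weight d(T) of the old loop is exchanged for the weight d(U) of the new one.

  The kink on the left is inverse to the twist by an isotopy. For the kink on the right only the
  trace is computed: sphericality equates it with that of the left kink, and the nonzero dimension
  of J is cancelled.

  The rotations use duals from C, while the vector lives in D. They are compared through the
  canonical maps M(X^v) -> M(X)^v. In D, the equality of rotations rests on the compatibility of the
  pivotal structure with duals, a consequence of its being monoidal.

  As neither category is strict, pictures are words of letters M(X) in D, where associators and the
  structure isomorphisms of M merely regroup. The identity functor gives the same calculus inside
  C.\<close>

context linear_category
begin

sublocale vs: vector_space "Scale C" by (rule vector_space)

lemma zero_in_Hom [simp]: "0 \<in> Hom C X Y"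
  by (rule vs.subspace_0[OF Hom_subspace])

lemma scale_in_Hom: "f \<in> Hom C X Y \<Longrightarrow> k \<star> f \<in> Hom C X Y"
  by (rule vs.subspace_scale[OF Hom_subspace])

lemma sum_in_Hom: "(\<And>i. i \<in> I \<Longrightarrow> f i \<in> Hom C X Y) \<Longrightarrow> sum f I \<in> Hom C X Y"
  by (rule vs.subspace_sum[OF Hom_subspace])

lemma diff_in_Hom: "f \<in> Hom C X Y \<Longrightarrow> g \<in> Hom C X Y \<Longrightarrow> f - g \<in> Hom C X Y"
  by (rule vs.subspace_diff[OF Hom_subspace])

lemma comp_zero_left: "f \<in> Hom C X Y \<Longrightarrow> 0 \<cdot> f = 0"
  using comp_scale_left[of f X Y 0 X 0] by simp

lemma comp_zero_right: "f \<in> Hom C X Y \<Longrightarrow> f \<cdot> 0 = 0"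
  using comp_scale_right[of 0 X X f Y 0] by simp

lemma comp_sum_left:
  assumes f: "f \<in> Hom C X Y" and "\<And>i. i \<in> I \<Longrightarrow> g i \<in> Hom C Y Z"
  shows "(\<Sum>i\<in>I. g i) \<cdot> f = (\<Sum>i\<in>I. g i \<cdot> f)"
  using assms(2)
  by (induction I rule: infinite_finite_induct)
     (auto simp: comp_zero_left[OF f] comp_add_left[OF f, of _ Z] sum_in_Hom)

lemma comp_sum_right:
  assumes f: "f \<in> Hom C Y Z" and "\<And>i. i \<in> I \<Longrightarrow> g i \<in> Hom C X Y"
  shows "f \<cdot> (\<Sum>i\<in>I. g i) = (\<Sum>i\<in>I. f \<cdot> g i)"
  using assms(2)
  by (induction I rule: infinite_finite_induct)
     (auto simp: comp_zero_right[OF f] comp_add_right[of _ X Y _ f Z] f sum_in_Hom)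

lemma inverse_pair_unique:
  assumes "inverse_pair C X Y f g" "inverse_pair C X Y f h"
  shows "g = h"
proof -
  have *: "f \<in> Hom C X Y" "g \<in> Hom C Y X" "h \<in> Hom C Y X" "h \<cdot> f = \<iota> X" "f \<cdot> g = \<iota> Y"
    using assms by (auto simp: inverse_pair_def)
  have "g = (h \<cdot> f) \<cdot> g"
    using * by (simp add: id_comp)
  also have "\<dots> = h \<cdot> (f \<cdot> g)"
    by (rule comp_assoc[OF *(2,1,3)])
  also have "\<dots> = h"
    using * by (simp add: comp_id)
  finally show ?thesis .
qed

lemma inv_mor_eqI: "inverse_pair C X Y f g \<Longrightarrow> inv_mor C X Y f = g"
  unfolding inv_mor_def by (blast intro: inverse_pair_unique the_equality)

lemma inv_mor_pair: "is_iso C X Y f \<Longrightarrow> inverse_pair C X Y f (inv_mor C X Y f)"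
  unfolding is_iso_def using inv_mor_eqI by metis

lemma
  assumes "is_iso C X Y f"
  shows iso_in_Hom: "f \<in> Hom C X Y"
    and inv_mor_in_Hom: "inv_mor C X Y f \<in> Hom C Y X"
    and inv_mor_left: "inv_mor C X Y f \<cdot> f = \<iota> X"
    and inv_mor_right: "f \<cdot> inv_mor C X Y f = \<iota> Y"
  using inv_mor_pair[OF assms] by (auto simp: inverse_pair_def)

lemma comp_inverse_pair:
  assumes "inverse_pair C X Y f f'" "inverse_pair C Y Z g g'"
  shows "inverse_pair C X Z (g \<cdot> f) (f' \<cdot> g')"
proof -
  have f: "f \<in> Hom C X Y" "f' \<in> Hom C Y X" "f' \<cdot> f = \<iota> X" "f \<cdot> f' = \<iota> Y"
    and g: "g \<in> Hom C Y Z" "g' \<in> Hom C Z Y" "g' \<cdot> g = \<iota> Y" "g \<cdot> g' = \<iota> Z"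
    using assms by (auto simp: inverse_pair_def)
  have "(f' \<cdot> g') \<cdot> (g \<cdot> f) = f' \<cdot> (g' \<cdot> (g \<cdot> f))"
    by (rule comp_assoc[OF comp_in_Hom[OF f(1) g(1)] g(2) f(2)])
  also have "g' \<cdot> (g \<cdot> f) = f"
    using comp_assoc[OF f(1) g(1) g(2)] g f by (simp add: id_comp)
  finally have 1: "(f' \<cdot> g') \<cdot> (g \<cdot> f) = \<iota> X"
    using f by simp
  have "(g \<cdot> f) \<cdot> (f' \<cdot> g') = g \<cdot> (f \<cdot> (f' \<cdot> g'))"
    by (rule comp_assoc[OF comp_in_Hom[OF g(2) f(2)] f(1) g(1)])
  also have "f \<cdot> (f' \<cdot> g') = g'"
    using comp_assoc[OF g(2) f(2) f(1)] g f by (simp add: id_comp)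
  finally show ?thesis
    using f g 1 unfolding inverse_pair_def by (auto intro: comp_in_Hom)
qed

lemma comp_is_iso: "is_iso C X Y f \<Longrightarrow> is_iso C Y Z g \<Longrightarrow> is_iso C X Z (g \<cdot> f)"
  unfolding is_iso_def using comp_inverse_pair by blast

lemma isomorphic_sym: "isomorphic C X Y \<Longrightarrow> isomorphic C Y X"
  unfolding isomorphic_def is_iso_def inverse_pair_def by blast

lemma isomorphic_trans: "isomorphic C X Y \<Longrightarrow> isomorphic C Y Z \<Longrightarrow> isomorphic C X Z"
  unfolding isomorphic_def using comp_is_iso by blast

end

section \<open>Strict calculus of a monoidal category\<close>

text \<open>
  A word of objects stands for its right-bracketed product, ending in the unit. Arrows between
  words carry their source and target, and a flag that is false once a composition has been
  ill-typed; the associativity of composition then needs no typing hypotheses. A morphism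
  acts on the first letters of a word, so that the middle four interchange law is naturality
  in the rest of the word.
\<close>

datatype ('o, 'm) arr = Arr (adom: "'o list") (amor: 'm) (acod: "'o list") (aok: bool)

context monoidal_category
begin

primrec ob :: "'o list \<Rightarrow> 'o" where
  "ob [] = \<one>"
| "ob (x # xs) = x \<odot> ob xs"

definition ok :: "('o, 'm) arr \<Rightarrow> bool" where
  "ok f \<longleftrightarrow> aok f \<and> amor f \<in> Hom C (ob (adom f)) (ob (acod f))"

definition mk :: "bool \<Rightarrow> 'o list \<Rightarrow> 'm \<Rightarrow> 'o list \<Rightarrow> ('o, 'm) arr" where
  "mk b xs f ys = Arr xs (if b then f else 0) ys b"

definition cmp :: "('o, 'm) arr \<Rightarrow> ('o, 'm) arr \<Rightarrow> ('o, 'm) arr" (infixr "\<bullet>" 60) where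
  "g \<bullet> f = mk (ok g \<and> ok f \<and> adom g = acod f) (adom f) (amor g \<cdot> amor f) (acod g)"

definition idn :: "'o list \<Rightarrow> ('o, 'm) arr" where
  "idn xs = mk True xs (\<iota> (ob xs)) xs"

definition wl :: "'o \<Rightarrow> ('o, 'm) arr \<Rightarrow> ('o, 'm) arr" where
  "wl x f = mk (ok f) (x # adom f) (\<iota> x \<otimes> amor f) (x # acod f)"

definition opr :: "'o \<Rightarrow> 'm \<Rightarrow> 'o \<Rightarrow> 'o list \<Rightarrow> ('o, 'm) arr" where
  "opr X f Y w = mk (f \<in> Hom C X Y) (X # w) (f \<otimes> \<iota> (ob w)) (Y # w)"

definition asc :: "'o \<Rightarrow> 'o \<Rightarrow> 'o list \<Rightarrow> ('o, 'm) arr" where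
  "asc X Y w = mk True ((X \<odot> Y) # w) (\<a> X Y (ob w)) (X # Y # w)"

definition asci :: "'o \<Rightarrow> 'o \<Rightarrow> 'o list \<Rightarrow> ('o, 'm) arr" where
  "asci X Y w = mk True (X # Y # w) (assoc_inv C X Y (ob w)) ((X \<odot> Y) # w)"

definition lun :: "'o list \<Rightarrow> ('o, 'm) arr" where
  "lun w = mk True (\<one> # w) (\<l> (ob w)) w"

definition luni :: "'o list \<Rightarrow> ('o, 'm) arr" where
  "luni w = mk True w (lunit_inv C (ob w)) (\<one> # w)"

lemma mk_simps [simp]: "adom (mk b xs f ys) = xs" "acod (mk b xs f ys) = ys"
  by (auto simp: mk_def)

lemma dom_cod [simp]:
  "adom (g \<bullet> f) = adom f" "acod (g \<bullet> f) = acod g"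
  "adom (idn xs) = xs" "acod (idn xs) = xs"
  "adom (wl x f) = x # adom f" "acod (wl x f) = x # acod f"
  "adom (opr X h Y w) = X # w" "acod (opr X h Y w) = Y # w"
  "adom (asc X Y w) = (X \<odot> Y) # w" "acod (asc X Y w) = X # Y # w"
  "adom (asci X Y w) = X # Y # w" "acod (asci X Y w) = (X \<odot> Y) # w"
  "adom (lun w) = \<one> # w" "acod (lun w) = w"
  "adom (luni w) = w" "acod (luni w) = \<one> # w"
  by (simp_all add: cmp_def idn_def wl_def opr_def asc_def asci_def lun_def luni_def)

lemma ok_mk: "ok (mk b xs f ys) \<longleftrightarrow> b \<and> f \<in> Hom C (ob xs) (ob ys)"
  by (auto simp: mk_def ok_def)

lemmas assoc_in_Hom = iso_in_Hom[OF assoc_iso]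
lemmas assoc_inv_in_Hom = inv_mor_in_Hom[OF assoc_iso, folded assoc_inv_def]
lemmas lunit_in_Hom = iso_in_Hom[OF lunit_iso]
lemmas lunit_inv_in_Hom = inv_mor_in_Hom[OF lunit_iso, folded lunit_inv_def]
lemmas runit_in_Hom = iso_in_Hom[OF runit_iso]
lemmas runit_inv_in_Hom = inv_mor_in_Hom[OF runit_iso, folded runit_inv_def]

lemmas mor_in_Hom = assoc_in_Hom assoc_inv_in_Hom lunit_in_Hom lunit_inv_in_Hom
  runit_in_Hom runit_inv_in_Hom id_in_Hom tensor_in_Hom

lemma ok_in_Hom: "ok f \<Longrightarrow> amor f \<in> Hom C (ob (adom f)) (ob (acod f))"
  by (simp add: ok_def)

lemma ok_cmp [simp]: "ok (g \<bullet> f) \<longleftrightarrow> ok g \<and> ok f \<and> adom g = acod f"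
  unfolding cmp_def ok_mk by (auto simp: ok_def intro: comp_in_Hom)

lemma ok_wl [simp]: "ok (wl x f) \<longleftrightarrow> ok f"
  unfolding wl_def ok_mk by (auto simp: ok_def intro: tensor_in_Hom id_in_Hom)

lemma ok_opr [simp]: "ok (opr X f Y w) \<longleftrightarrow> f \<in> Hom C X Y"
  unfolding opr_def ok_mk by (auto intro: tensor_in_Hom id_in_Hom)

lemma ok_gen [simp]: "ok (idn w)" "ok (asc X Y w)" "ok (asci X Y w)" "ok (lun w)" "ok (luni w)"
  unfolding idn_def asc_def asci_def lun_def luni_def ok_mk by (auto intro: mor_in_Hom)

lemma amor_simps:
  "ok g \<Longrightarrow> ok f \<Longrightarrow> adom g = acod f \<Longrightarrow> amor (g \<bullet> f) = amor g \<cdot> amor f"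
  "ok f \<Longrightarrow> amor (wl x f) = \<iota> x \<otimes> amor f"
  "h \<in> Hom C X Y \<Longrightarrow> amor (opr X h Y w) = h \<otimes> \<iota> (ob w)"
  "amor (idn w) = \<iota> (ob w)"
  "amor (asc X Y w) = \<a> X Y (ob w)"
  "amor (asci X Y w) = assoc_inv C X Y (ob w)"
  "amor (lun w) = \<l> (ob w)"
  "amor (luni w) = lunit_inv C (ob w)"
  by (simp_all add: cmp_def idn_def wl_def opr_def asc_def asci_def lun_def luni_def mk_def)

text \<open>Ill-typed composites with equal ends are equal, because their morphism is reset to zero.\<close>

definition nice :: "('o, 'm) arr \<Rightarrow> bool" where
  "nice f \<longleftrightarrow> ok f \<or> (\<not> aok f \<and> amor f = 0)"

lemma nice_mk: "(b \<Longrightarrow> f \<in> Hom C (ob xs) (ob ys)) \<Longrightarrow> nice (mk b xs f ys)"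
  unfolding nice_def ok_mk by (auto simp: mk_def)

lemma nice [simp]:
  "nice (g \<bullet> f)" "nice (wl x f)" "nice (opr X h Y w)" "ok f \<Longrightarrow> nice f"
  unfolding cmp_def wl_def opr_def
  by (auto intro!: nice_mk comp_in_Hom tensor_in_Hom id_in_Hom simp: ok_def)
     (auto simp: nice_def ok_def)

lemma arr_eqI:
  assumes "nice f" "nice g" "adom f = adom g" "acod f = acod g" "ok f = ok g"
    and "ok f \<Longrightarrow> ok g \<Longrightarrow> amor f = amor g"
  shows "f = g"
  using assms unfolding nice_def ok_def by (cases f; cases g) auto

lemma arr_ok_eqI:
  "\<lbrakk>ok f; ok g; adom f = adom g; acod f = acod g; amor f = amor g\<rbrakk> \<Longrightarrow> f = g"
  by (rule arr_eqI) auto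

lemma cmp_assoc [simp]: "(h \<bullet> g) \<bullet> f = h \<bullet> (g \<bullet> f)"
proof (rule arr_eqI)
  assume "ok ((h \<bullet> g) \<bullet> f)" "ok (h \<bullet> g \<bullet> f)"
  then have *: "ok h" "ok g" "ok f" "adom h = acod g" "adom g = acod f"
    by auto
  then show "amor ((h \<bullet> g) \<bullet> f) = amor (h \<bullet> g \<bullet> f)"
    using comp_assoc[of "amor f" "ob (adom f)" "ob (acod f)" "amor g" "ob (acod g)" "amor h"]
    by (simp add: amor_simps ok_in_Hom)
       (metis ok_in_Hom)
qed auto

lemma cmp_id [simp]: "ok f \<Longrightarrow> adom f = w \<Longrightarrow> f \<bullet> idn w = f"
  by (rule arr_ok_eqI) (auto simp: amor_simps dest!: ok_in_Hom intro: comp_id)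

lemma id_cmp [simp]: "ok f \<Longrightarrow> acod f = w \<Longrightarrow> idn w \<bullet> f = f"
  by (rule arr_ok_eqI) (auto simp: amor_simps dest!: ok_in_Hom intro: id_comp)

lemma wl_cmp [simp]: "wl x (g \<bullet> f) = wl x g \<bullet> wl x f"
proof (rule arr_eqI)
  assume "ok (wl x (g \<bullet> f))"
  then have *: "amor f \<in> Hom C (ob (adom f)) (ob (acod f))" "amor g \<in> Hom C (ob (acod f)) (ob (acod g))"
    "ok f" "ok g" "adom g = acod f"
    using ok_in_Hom[of f] ok_in_Hom[of g] by auto
  then show "amor (wl x (g \<bullet> f)) = amor (wl x g \<bullet> wl x f)"
    using tensor_comp[OF id_in_Hom id_in_Hom *(1,2)] by (simp add: amor_simps comp_id[OF id_in_Hom])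
qed auto

lemma wl_id [simp]: "wl x (idn w) = idn (x # w)"
  by (rule arr_ok_eqI) (auto simp: amor_simps tensor_id)

lemma opr_id [simp]: "opr X (\<iota> X) X w = idn (X # w)"
  by (rule arr_ok_eqI) (auto simp: amor_simps tensor_id id_in_Hom)

lemma opr_comp:
  assumes "f \<in> Hom C X Y" "g \<in> Hom C Y Z"
  shows "opr X (g \<cdot> f) Z w = opr Y g Z w \<bullet> opr X f Y w"
proof (rule arr_ok_eqI)
  show "amor (opr X (g \<cdot> f) Z w) = amor (opr Y g Z w \<bullet> opr X f Y w)"
    using assms comp_in_Hom[OF assms] tensor_comp[OF assms id_in_Hom id_in_Hom, of "ob w"]
    by (simp add: amor_simps comp_id[OF id_in_Hom])
qed (use assms in \<open>auto intro: comp_in_Hom\<close>)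

lemma opr_natural:
  assumes "acod h = w"
  shows "opr X f Y w \<bullet> wl X h = wl Y h \<bullet> opr X f Y (adom h)"
proof (rule arr_eqI)
  assume "ok (opr X f Y w \<bullet> wl X h)"
  then have h: "f \<in> Hom C X Y" "ok h" "amor h \<in> Hom C (ob (adom h)) (ob w)"
    using assms ok_in_Hom[of h] by auto
  have "(f \<otimes> \<iota> (ob w)) \<cdot> (\<iota> X \<otimes> amor h) = (f \<cdot> \<iota> X) \<otimes> (\<iota> (ob w) \<cdot> amor h)"
    using tensor_comp[OF id_in_Hom h(1) h(3) id_in_Hom] by simp
  also have "\<dots> = (\<iota> Y \<cdot> f) \<otimes> (amor h \<cdot> \<iota> (ob (adom h)))"
    using h by (simp add: comp_id id_comp)
  also have "\<dots> = (\<iota> Y \<otimes> amor h) \<cdot> (f \<otimes> \<iota> (ob (adom h)))"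
    by (rule tensor_comp[OF h(1) id_in_Hom id_in_Hom h(3)])
  finally show "amor (opr X f Y w \<bullet> wl X h) = amor (wl Y h \<bullet> opr X f Y (adom h))"
    using h assms by (simp add: amor_simps)
qed (use assms in auto)

lemma asc_asci [simp]: "asc X Y w \<bullet> asci X Y w = idn (X # Y # w)"
  by (rule arr_ok_eqI) (auto simp: amor_simps inv_mor_right[OF assoc_iso, folded assoc_inv_def])

lemma asci_asc [simp]: "asci X Y w \<bullet> asc X Y w = idn ((X \<odot> Y) # w)"
  by (rule arr_ok_eqI) (auto simp: amor_simps inv_mor_left[OF assoc_iso, folded assoc_inv_def])

lemma lun_luni [simp]: "lun w \<bullet> luni w = idn w"
  by (rule arr_ok_eqI) (auto simp: amor_simps inv_mor_right[OF lunit_iso, folded lunit_inv_def])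

lemma luni_lun [simp]: "luni w \<bullet> lun w = idn (\<one> # w)"
  by (rule arr_ok_eqI) (auto simp: amor_simps inv_mor_left[OF lunit_iso, folded lunit_inv_def])

text \<open>Composites are normalised to the right by \<open>cmp_assoc\<close>, so a rewrite rule
  for a short composite is also needed with a tail attached. This rule and \<open>reassoc2\<close>
  turn an equation into that form.\<close>

lemma reassoc: "g \<bullet> f = h \<Longrightarrow> g \<bullet> (f \<bullet> k) = h \<bullet> k"
  by (metis cmp_assoc)

lemma reassoc2: "g \<bullet> f \<bullet> e = h \<Longrightarrow> g \<bullet> (f \<bullet> e \<bullet> k) = h \<bullet> k"
  by (metis cmp_assoc)

lemma wl_eq: "f = g \<Longrightarrow> wl x f = wl x g"
  by simp

section \<open>Naturality and coherence of the structure arrows on words\<close>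

lemma asc_natural: 
  assumes "acod h = w"
  shows "asc X Y w \<bullet> wl (X \<odot> Y) h = wl X (wl Y h) \<bullet> asc X Y (adom h)"
proof (rule arr_eqI)
  assume "ok (asc X Y w \<bullet> wl (X \<odot> Y) h)"
  then have h: "ok h" "amor h \<in> Hom C (ob (adom h)) (ob w)"
    using assms ok_in_Hom[of h] by auto
  then show "amor (asc X Y w \<bullet> wl (X \<odot> Y) h) = amor (wl X (wl Y h) \<bullet> asc X Y (adom h))"
    using assoc_natural[OF id_in_Hom id_in_Hom h(2)] assms by (simp add: amor_simps tensor_id)
qed (use assms in auto)

lemma asci_natural: 
  assumes "acod h = w"
  shows "asci X Y w \<bullet> wl X (wl Y h) = wl (X \<odot> Y) h \<bullet> asci X Y (adom h)"
proof (rule arr_eqI)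
  assume "ok (asci X Y w \<bullet> wl X (wl Y h))"
  then have h: "ok h"
    by simp
  have "asci X Y w \<bullet> (wl X (wl Y h) \<bullet> asc X Y (adom h)) \<bullet> asci X Y (adom h)
    = asci X Y w \<bullet> (asc X Y w \<bullet> wl (X \<odot> Y) h) \<bullet> asci X Y (adom h)"
    by (simp only: asc_natural[OF assms])
  then show "amor (asci X Y w \<bullet> wl X (wl Y h)) = amor (wl (X \<odot> Y) h \<bullet> asci X Y (adom h))"
    using h assms by (simp add: reassoc[OF asci_asc])
qed (use assms in auto)

lemma lun_natural:
  assumes "acod h = w"
  shows "lun w \<bullet> wl \<one> h = h \<bullet> lun (adom h)"
proof (rule arr_eqI)
  assume "ok (lun w \<bullet> wl \<one> h)"
  then have h: "ok h" "amor h \<in> Hom C (ob (adom h)) (ob w)"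
    using assms ok_in_Hom[of h] by auto
  then show "amor (lun w \<bullet> wl \<one> h) = amor (h \<bullet> lun (adom h))"
    using lunit_natural[OF h(2)] assms by (simp add: amor_simps)
qed (use assms in auto)

lemma luni_natural:
  assumes "acod h = w"
  shows "luni w \<bullet> h = wl \<one> h \<bullet> luni (adom h)"
proof (cases "ok h")
  case True
  have "luni w \<bullet> (lun w \<bullet> wl \<one> h) \<bullet> luni (adom h) = luni w \<bullet> (h \<bullet> lun (adom h)) \<bullet> luni (adom h)"
    by (simp only: lun_natural[OF assms])
  then show ?thesis
    using assms True by (simp add: reassoc[OF luni_lun])
qed (use assms in \<open>auto intro: arr_eqI\<close>)

text \<open>Expands a product of morphisms into actions on single letters; naturality of the
  associator and the interchange law give it after \<open>asc\<close> splits the product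
  letter.\<close>

lemma opr_tensor:
  assumes "f \<in> Hom C X X'" "g \<in> Hom C Y Y'"
  shows "opr (X \<odot> Y) (f \<otimes> g) (X' \<odot> Y') w
    = asci X' Y' w \<bullet> opr X f X' (Y' # w) \<bullet> wl X (opr Y g Y' w) \<bullet> asc X Y w"
proof -
  have "asc X' Y' w \<bullet> opr (X \<odot> Y) (f \<otimes> g) (X' \<odot> Y') w
    = (opr X f X' (Y' # w) \<bullet> wl X (opr Y g Y' w)) \<bullet> asc X Y w"
  proof (rule arr_ok_eqI)
    have "(f \<otimes> \<iota> (Y' \<odot> ob w)) \<cdot> (\<iota> X \<otimes> (g \<otimes> \<iota> (ob w)))
      = (f \<cdot> \<iota> X) \<otimes> (\<iota> (Y' \<odot> ob w) \<cdot> (g \<otimes> \<iota> (ob w)))"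
      by (rule tensor_comp[OF id_in_Hom assms(1) tensor_in_Hom[OF assms(2) id_in_Hom] id_in_Hom,
          symmetric])
    also have "\<dots> = f \<otimes> (g \<otimes> \<iota> (ob w))"
      by (simp add: comp_id[OF assms(1)] id_comp[OF tensor_in_Hom[OF assms(2) id_in_Hom]])
    finally show "amor (asc X' Y' w \<bullet> opr (X \<odot> Y) (f \<otimes> g) (X' \<odot> Y') w)
      = amor ((opr X f X' (Y' # w) \<bullet> wl X (opr Y g Y' w)) \<bullet> asc X Y w)"
      using assms assoc_natural[OF assms id_in_Hom]
      by (simp add: amor_simps tensor_in_Hom del: cmp_assoc)
  qed (use assms in \<open>auto intro: tensor_in_Hom\<close>)
  then have "asci X' Y' w \<bullet> asc X' Y' w \<bullet> opr (X \<odot> Y) (f \<otimes> g) (X' \<odot> Y') w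
    = asci X' Y' w \<bullet> opr X f X' (Y' # w) \<bullet> wl X (opr Y g Y' w) \<bullet> asc X Y w"
    by simp
  then show ?thesis
    using assms by (simp add: reassoc[OF asci_asc] tensor_in_Hom)
qed

text \<open>The rest of the word, \<open>ob w\<close>, is the fourth object of the pentagon.\<close>

lemma pentagon_arr:
  "wl X (asc Y Z w) \<bullet> asc X (Y \<odot> Z) w \<bullet> opr ((X \<odot> Y) \<odot> Z) (\<a> X Y Z) (X \<odot> (Y \<odot> Z)) w
    = asc X Y (Z # w) \<bullet> asc (X \<odot> Y) Z w"
proof (rule arr_ok_eqI)
  have "\<a> X Y (Z \<odot> ob w) \<cdot> \<a> (X \<odot> Y) Z (ob w)
      = (\<iota> X \<otimes> \<a> Y Z (ob w)) \<cdot> \<a> X (Y \<odot> Z) (ob w) \<cdot> (\<a> X Y Z \<otimes> \<iota> (ob w))"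
    by (rule pentagon)
  also have "\<dots> = (\<iota> X \<otimes> \<a> Y Z (ob w)) \<cdot> (\<a> X (Y \<odot> Z) (ob w) \<cdot> (\<a> X Y Z \<otimes> \<iota> (ob w)))"
    by (rule comp_assoc) (auto intro: mor_in_Hom)
  finally show "amor (wl X (asc Y Z w) \<bullet> asc X (Y \<odot> Z) w
      \<bullet> opr ((X \<odot> Y) \<odot> Z) (\<a> X Y Z) (X \<odot> (Y \<odot> Z)) w)
    = amor (asc X Y (Z # w) \<bullet> asc (X \<odot> Y) Z w)"
    by (simp add: amor_simps mor_in_Hom)
qed (auto intro: mor_in_Hom)

lemma opr_assoc:
  "opr ((X \<odot> Y) \<odot> Z) (\<a> X Y Z) (X \<odot> (Y \<odot> Z)) w
    = asci X (Y \<odot> Z) w \<bullet> wl X (asci Y Z w) \<bullet> asc X Y (Z # w) \<bullet> asc (X \<odot> Y) Z w"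
proof -
  have wr: "wl X (asci Y Z w) \<bullet> wl X (asc Y Z w) = idn (X # (Y \<odot> Z) # w)"
    by (simp flip: wl_cmp)
  have "asci X (Y \<odot> Z) w \<bullet> wl X (asci Y Z w) \<bullet> wl X (asc Y Z w) \<bullet> asc X (Y \<odot> Z) w
      \<bullet> opr ((X \<odot> Y) \<odot> Z) (\<a> X Y Z) (X \<odot> (Y \<odot> Z)) w = opr ((X \<odot> Y) \<odot> Z) (\<a> X Y Z) (X \<odot> (Y \<odot> Z)) w"
    by (simp add: reassoc[OF wr] reassoc[OF asci_asc] assoc_in_Hom)
  then show ?thesis
    by (simp add: pentagon_arr)
qed

lemma opr_inverse:
  assumes "inverse_pair C X Y f g"
  shows "opr X f Y w \<bullet> opr Y g X w = idn (Y # w)" "opr Y g X w \<bullet> opr X f Y w = idn (X # w)"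
  using assms unfolding inverse_pair_def by (simp_all flip: opr_comp)

lemma opr_runit: "opr (X \<odot> \<one>) (\<r> X) X w = wl X (lun w) \<bullet> asc X \<one> w"
  using triangle[of X "ob w"] by (intro arr_ok_eqI) (auto simp: amor_simps mor_in_Hom)

text \<open>On the empty rest of a word a morphism is tensored with the unit, and naturality of the
  right unit isomorphism recovers it. This is the way back from the calculus to equations between
  morphisms.\<close>

lemma opr_cong_faithful:
  assumes "f \<in> Hom C X Y" "g \<in> Hom C X Y" "opr X f Y [] = opr X g Y []"
  shows "f = g"
proof -
  have "f \<otimes> \<iota> \<one> = g \<otimes> \<iota> \<one>"
    using assms(3) amor_simps(3)[OF assms(1), of "[]"] amor_simps(3)[OF assms(2), of "[]"] by simp
  then have "f \<cdot> \<r> X = g \<cdot> \<r> X"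
    using runit_natural[OF assms(1)] runit_natural[OF assms(2)] by simp
  then have "(f \<cdot> \<r> X) \<cdot> runit_inv C X = (g \<cdot> \<r> X) \<cdot> runit_inv C X"
    by simp
  then show ?thesis
    using comp_assoc[OF runit_inv_in_Hom runit_in_Hom assms(1)]
      comp_assoc[OF runit_inv_in_Hom runit_in_Hom assms(2)] comp_id assms(1,2)
      inv_mor_right[OF runit_iso, folded runit_inv_def, of X] by simp
qed

text \<open>Kelly's unit coherence, from the pentagon with two units.\<close>

lemma opr_lunit: "opr (\<one> \<odot> X) (\<l> X) X w = lun (X # w) \<bullet> asc \<one> X w"
proof -
  let ?l = "opr (\<one> \<odot> X) (\<l> X) X w"
  have "opr ((\<one> \<odot> \<one>) \<odot> X) ((\<iota> \<one> \<otimes> \<l> X) \<cdot> \<a> \<one> \<one> X) (\<one> \<odot> X) w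
      = opr ((\<one> \<odot> \<one>) \<odot> X) (\<r> \<one> \<otimes> \<iota> X) (\<one> \<odot> X) w"
    by (simp add: triangle)
  then have "asci \<one> X w \<bullet> wl \<one> ?l \<bullet> asc \<one> (\<one> \<odot> X) w \<bullet> asci \<one> (\<one> \<odot> X) w \<bullet> wl \<one> (asci \<one> X w)
      \<bullet> asc \<one> \<one> (X # w) \<bullet> asc (\<one> \<odot> \<one>) X w
    = asci \<one> X w \<bullet> wl \<one> (lun (X # w)) \<bullet> asc \<one> \<one> (X # w) \<bullet> asc (\<one> \<odot> \<one>) X w"
    by (simp add: opr_comp[of _ _ "\<one> \<odot> (\<one> \<odot> X)"] mor_in_Hom opr_tensor opr_assoc opr_runit)
  then have "asc \<one> X w \<bullet> (asci \<one> X w \<bullet> wl \<one> ?l \<bullet> wl \<one> (asci \<one> X w)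
      \<bullet> asc \<one> \<one> (X # w) \<bullet> asc (\<one> \<odot> \<one>) X w) \<bullet> asci (\<one> \<odot> \<one>) X w \<bullet> asci \<one> \<one> (X # w)
    = asc \<one> X w \<bullet> (asci \<one> X w \<bullet> wl \<one> (lun (X # w)) \<bullet> asc \<one> \<one> (X # w)
      \<bullet> asc (\<one> \<odot> \<one>) X w) \<bullet> asci (\<one> \<odot> \<one>) X w \<bullet> asci \<one> \<one> (X # w)"
    by (simp add: reassoc[OF asc_asci])
  then have eq: "wl \<one> (?l \<bullet> asci \<one> X w) = wl \<one> (lun (X # w))"
    by (simp add: reassoc[OF asc_asci] lunit_in_Hom)
  \<comment> \<open>Conjugation by the left unit isomorphism undoes \<open>wl \<one>\<close>, so the
    leading unit letter in \<open>eq\<close> can be cancelled.\<close>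
  have conj: "lun (acod h) \<bullet> wl \<one> h \<bullet> luni (adom h) = h" if "ok h" for h
    using that by (simp add: reassoc[OF lun_natural])
  have "?l \<bullet> asci \<one> X w = lun (X # w)"
    using conj[of "?l \<bullet> asci \<one> X w"] conj[of "lun (X # w)"] reassoc[OF eq[unfolded wl_cmp]]
    by (simp add: lunit_in_Hom)
  then have "(?l \<bullet> asci \<one> X w) \<bullet> asc \<one> X w = lun (X # w) \<bullet> asc \<one> X w"
    by simp
  then show ?thesis
    by (simp add: lunit_in_Hom)
qed

end

section \<open>Calculus of a monoidal functor\<close>

context monoidal_functor
begin

notation tgt.cmp (infixr "\<bullet>" 60)

abbreviation lw :: "'o \<Rightarrow> ('p, 'n) arr \<Rightarrow> ('p, 'n) arr" where
  "lw X f \<equiv> tgt.wl (FO M X) f"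

definition mop :: "'o \<Rightarrow> 'm \<Rightarrow> 'o \<Rightarrow> 'p list \<Rightarrow> ('p, 'n) arr" where
  "mop X f Y w = tgt.opr (FO M X) (FM M f) (FO M Y) w"

text \<open>Splits the letter of a product into two letters. The structure isomorphism of
  \<open>M\<close> and the associator of \<open>D\<close> are both hidden here, so that later
  computations only split and merge letters; \<open>me\<close> and \<open>mei\<close> do the same
  for the unit.\<close>

definition mu :: "'o \<Rightarrow> 'o \<Rightarrow> 'p list \<Rightarrow> ('p, 'n) arr" where
  "mu X Y w = tgt.asc (FO M X) (FO M Y) w
     \<bullet> tgt.opr (FO M (X \<odot>\<^bsub>C\<^esub> Y)) (FTens_inv C D M X Y) (FO M X \<odot>\<^bsub>D\<^esub> FO M Y) w"

definition mui :: "'o \<Rightarrow> 'o \<Rightarrow> 'p list \<Rightarrow> ('p, 'n) arr" where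
  "mui X Y w = tgt.opr (FO M X \<odot>\<^bsub>D\<^esub> FO M Y) (FTens M X Y) (FO M (X \<odot>\<^bsub>C\<^esub> Y)) w
     \<bullet> tgt.asci (FO M X) (FO M Y) w"

definition me :: "'p list \<Rightarrow> ('p, 'n) arr" where
  "me w = tgt.lun w \<bullet> tgt.opr (FO M \<one>\<^bsub>C\<^esub>) (FUnit_inv C D M) \<one>\<^bsub>D\<^esub> w"

definition mei :: "'p list \<Rightarrow> ('p, 'n) arr" where
  "mei w = tgt.opr \<one>\<^bsub>D\<^esub> (FUnit M) (FO M \<one>\<^bsub>C\<^esub>) w \<bullet> tgt.luni w"

lemma dom_cod_m [simp]:
  "adom (mop X f Y w) = FO M X # w" "acod (mop X f Y w) = FO M Y # w"
  "adom (mu X Y w) = FO M (X \<odot>\<^bsub>C\<^esub> Y) # w" "acod (mu X Y w) = FO M X # FO M Y # w"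
  "adom (mui X Y w) = FO M X # FO M Y # w" "acod (mui X Y w) = FO M (X \<odot>\<^bsub>C\<^esub> Y) # w"
  "adom (me w) = FO M \<one>\<^bsub>C\<^esub> # w" "acod (me w) = w"
  "adom (mei w) = w" "acod (mei w) = FO M \<one>\<^bsub>C\<^esub> # w"
  by (simp_all add: mop_def mu_def mui_def me_def mei_def)

lemmas FTens_in_Hom = tgt.iso_in_Hom[OF FTens_iso]
lemmas FTens_inv_in_Hom = tgt.inv_mor_in_Hom[OF FTens_iso, folded FTens_inv_def[of C D M]]
lemmas FUnit_in_Hom = tgt.iso_in_Hom[OF FUnit_iso]
lemmas FUnit_inv_in_Hom = tgt.inv_mor_in_Hom[OF FUnit_iso, folded FUnit_inv_def[of C D M]]

lemma FTens_pair: "inverse_pair D (FO M X \<odot>\<^bsub>D\<^esub> FO M Y) (FO M (X \<odot>\<^bsub>C\<^esub> Y)) (FTens M X Y) (FTens_inv C D M X Y)"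
  unfolding FTens_inv_def by (rule tgt.inv_mor_pair[OF FTens_iso])

lemma FUnit_pair: "inverse_pair D \<one>\<^bsub>D\<^esub> (FO M \<one>\<^bsub>C\<^esub>) (FUnit M) (FUnit_inv C D M)"
  unfolding FUnit_inv_def by (rule tgt.inv_mor_pair[OF FUnit_iso])

lemma ok_m [simp]:
  "f \<in> Hom C X Y \<Longrightarrow> tgt.ok (mop X f Y w)"
  "tgt.ok (mu X Y w)" "tgt.ok (mui X Y w)" "tgt.ok (me w)" "tgt.ok (mei w)"
  by (simp_all add: mop_def mu_def mui_def me_def mei_def FM_in_Hom
      FTens_in_Hom FTens_inv_in_Hom FUnit_in_Hom FUnit_inv_in_Hom)

lemma mop_id [simp]: "mop X (\<iota>\<^bsub>C\<^esub> X) X w = tgt.idn (FO M X # w)"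
  by (simp add: mop_def FM_id)

lemma mop_comp:
  "f \<in> Hom C X Y \<Longrightarrow> g \<in> Hom C Y Z \<Longrightarrow> mop X (g \<cdot>\<^bsub>C\<^esub> f) Z w = mop Y g Z w \<bullet> mop X f Y w"
  by (simp add: mop_def FM_comp tgt.opr_comp[OF FM_in_Hom FM_in_Hom])

lemma mop_inverse:
  assumes "inverse_pair C X Y f g"
  shows "mop X f Y w \<bullet> mop Y g X w = tgt.idn (FO M Y # w)"
    "mop Y g X w \<bullet> mop X f Y w = tgt.idn (FO M X # w)"
  using assms unfolding inverse_pair_def by (simp_all flip: mop_comp)

lemma mop_natural:
  "acod h = w \<Longrightarrow> mop X f Y w \<bullet> lw X h = lw Y h \<bullet> mop X f Y (adom h)"
  unfolding mop_def by (rule tgt.opr_natural)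

lemma opr_FTens [simp]:
  "tgt.opr (FO M X \<odot>\<^bsub>D\<^esub> FO M Y) (FTens M X Y) (FO M (X \<odot>\<^bsub>C\<^esub> Y)) w
    \<bullet> tgt.opr (FO M (X \<odot>\<^bsub>C\<^esub> Y)) (FTens_inv C D M X Y) (FO M X \<odot>\<^bsub>D\<^esub> FO M Y) w = tgt.idn (FO M (X \<odot>\<^bsub>C\<^esub> Y) # w)"
  "tgt.opr (FO M (X \<odot>\<^bsub>C\<^esub> Y)) (FTens_inv C D M X Y) (FO M X \<odot>\<^bsub>D\<^esub> FO M Y) w
    \<bullet> tgt.opr (FO M X \<odot>\<^bsub>D\<^esub> FO M Y) (FTens M X Y) (FO M (X \<odot>\<^bsub>C\<^esub> Y)) w = tgt.idn ((FO M X \<odot>\<^bsub>D\<^esub> FO M Y) # w)"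
  by (rule tgt.opr_inverse[OF FTens_pair])+

lemma opr_FUnit [simp]:
  "tgt.opr \<one>\<^bsub>D\<^esub> (FUnit M) (FO M \<one>\<^bsub>C\<^esub>) w \<bullet> tgt.opr (FO M \<one>\<^bsub>C\<^esub>) (FUnit_inv C D M) \<one>\<^bsub>D\<^esub> w = tgt.idn (FO M \<one>\<^bsub>C\<^esub> # w)"
  "tgt.opr (FO M \<one>\<^bsub>C\<^esub>) (FUnit_inv C D M) \<one>\<^bsub>D\<^esub> w \<bullet> tgt.opr \<one>\<^bsub>D\<^esub> (FUnit M) (FO M \<one>\<^bsub>C\<^esub>) w = tgt.idn (\<one>\<^bsub>D\<^esub> # w)"
  by (rule tgt.opr_inverse[OF FUnit_pair])+

lemma mu_inv [simp]:
  "mu X Y w \<bullet> mui X Y w = tgt.idn (FO M X # FO M Y # w)"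
  "mui X Y w \<bullet> mu X Y w = tgt.idn (FO M (X \<odot>\<^bsub>C\<^esub> Y) # w)"
  by (simp_all add: mu_def mui_def tgt.reassoc[OF tgt.asci_asc] tgt.reassoc[OF opr_FTens(2)]
      FTens_inv_in_Hom)

lemma me_inv [simp]:
  "me w \<bullet> mei w = tgt.idn w"
  "mei w \<bullet> me w = tgt.idn (FO M \<one>\<^bsub>C\<^esub> # w)"
  by (simp_all add: me_def mei_def tgt.reassoc[OF tgt.luni_lun] tgt.reassoc[OF opr_FUnit(2)]
      FUnit_inv_in_Hom)

lemmas mu_inv' [simp] = mu_inv[THEN tgt.reassoc]
lemmas me_inv' [simp] = me_inv[THEN tgt.reassoc]

lemma wl_mu_inv [simp]:
  "tgt.wl x (mu X Y w) \<bullet> tgt.wl x (mui X Y w) = tgt.idn (x # FO M X # FO M Y # w)"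
  "tgt.wl x (mui X Y w) \<bullet> tgt.wl x (mu X Y w) = tgt.idn (x # FO M (X \<odot>\<^bsub>C\<^esub> Y) # w)"
  "tgt.wl x (me w) \<bullet> tgt.wl x (mei w) = tgt.idn (x # w)"
  "tgt.wl x (mei w) \<bullet> tgt.wl x (me w) = tgt.idn (x # FO M \<one>\<^bsub>C\<^esub> # w)"
  "tgt.wl y (tgt.wl x (mu X Y w)) \<bullet> tgt.wl y (tgt.wl x (mui X Y w)) = tgt.idn (y # x # FO M X # FO M Y # w)"
  "tgt.wl y (tgt.wl x (mui X Y w)) \<bullet> tgt.wl y (tgt.wl x (mu X Y w)) = tgt.idn (y # x # FO M (X \<odot>\<^bsub>C\<^esub> Y) # w)"
  "tgt.wl y (tgt.wl x (me w)) \<bullet> tgt.wl y (tgt.wl x (mei w)) = tgt.idn (y # x # w)"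
  "tgt.wl y (tgt.wl x (mei w)) \<bullet> tgt.wl y (tgt.wl x (me w)) = tgt.idn (y # x # FO M \<one>\<^bsub>C\<^esub> # w)"
  by (simp_all flip: tgt.wl_cmp)

lemmas wl_mu_inv' [simp] = wl_mu_inv[THEN tgt.reassoc]

lemma mu_natural:
  "acod h = w \<Longrightarrow> mu X Y w \<bullet> lw (X \<odot>\<^bsub>C\<^esub> Y) h = lw X (lw Y h) \<bullet> mu X Y (adom h)"
  by (simp add: mu_def tgt.opr_natural tgt.asc_natural[THEN tgt.reassoc])

lemma mui_natural:
  "acod h = w \<Longrightarrow> mui X Y w \<bullet> lw X (lw Y h) = lw (X \<odot>\<^bsub>C\<^esub> Y) h \<bullet> mui X Y (adom h)"
  by (simp add: mui_def tgt.asci_natural tgt.opr_natural[THEN tgt.reassoc])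

lemma me_natural: "acod h = w \<Longrightarrow> me w \<bullet> lw \<one>\<^bsub>C\<^esub> h = h \<bullet> me (adom h)"
  by (simp add: me_def tgt.opr_natural tgt.lun_natural[THEN tgt.reassoc])

lemma mei_natural: "acod h = w \<Longrightarrow> mei w \<bullet> h = lw \<one>\<^bsub>C\<^esub> h \<bullet> mei (adom h)"
  by (simp add: mei_def tgt.luni_natural tgt.opr_natural[THEN tgt.reassoc])

lemma opr_FTens_eq:
  "tgt.opr (FO M X \<odot>\<^bsub>D\<^esub> FO M Y) (FTens M X Y) (FO M (X \<odot>\<^bsub>C\<^esub> Y)) w = mui X Y w \<bullet> tgt.asc (FO M X) (FO M Y) w"
  by (simp add: mui_def FTens_in_Hom)

lemma mop_tensor:
  assumes "f \<in> Hom C X X'" "g \<in> Hom C Y Y'"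
  shows "mop (X \<odot>\<^bsub>C\<^esub> Y) (f \<otimes>\<^bsub>C\<^esub> g) (X' \<odot>\<^bsub>C\<^esub> Y') w
    = mui X' Y' w \<bullet> mop X f X' (FO M Y' # w) \<bullet> lw X (mop Y g Y' w) \<bullet> mu X Y w"
proof -
  have h: "FM M f \<in> Hom D (FO M X) (FO M X')" "FM M g \<in> Hom D (FO M Y) (FO M Y')"
    "FM M (f \<otimes>\<^bsub>C\<^esub> g) \<in> Hom D (FO M (X \<odot>\<^bsub>C\<^esub> Y)) (FO M (X' \<odot>\<^bsub>C\<^esub> Y'))"
    using assms by (auto intro: FM_in_Hom src.tensor_in_Hom)
  have "tgt.opr (FO M X \<odot>\<^bsub>D\<^esub> FO M Y) (FTens M X' Y' \<cdot>\<^bsub>D\<^esub> (FM M f \<otimes>\<^bsub>D\<^esub> FM M g)) (FO M (X' \<odot>\<^bsub>C\<^esub> Y')) w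
    = tgt.opr (FO M X \<odot>\<^bsub>D\<^esub> FO M Y) (FM M (f \<otimes>\<^bsub>C\<^esub> g) \<cdot>\<^bsub>D\<^esub> FTens M X Y) (FO M (X' \<odot>\<^bsub>C\<^esub> Y')) w"
    by (simp add: FTens_natural[OF assms])
  then have "mop (X \<odot>\<^bsub>C\<^esub> Y) (f \<otimes>\<^bsub>C\<^esub> g) (X' \<odot>\<^bsub>C\<^esub> Y') w \<bullet> mui X Y w \<bullet> tgt.asc (FO M X) (FO M Y) w
    = mui X' Y' w \<bullet> mop X f X' (FO M Y' # w) \<bullet> lw X (mop Y g Y' w) \<bullet> tgt.asc (FO M X) (FO M Y) w"
    by (simp add: tgt.opr_comp[OF tgt.tensor_in_Hom[OF h(1,2)] FTens_in_Hom] mop_def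
        tgt.opr_comp[OF FTens_in_Hom h(3)] tgt.opr_tensor[OF h(1,2)] opr_FTens_eq
        tgt.reassoc[OF tgt.asc_asci] h del: opr_FTens)
  then have "(mop (X \<odot>\<^bsub>C\<^esub> Y) (f \<otimes>\<^bsub>C\<^esub> g) (X' \<odot>\<^bsub>C\<^esub> Y') w \<bullet> mui X Y w \<bullet> tgt.asc (FO M X) (FO M Y) w)
      \<bullet> tgt.asci (FO M X) (FO M Y) w \<bullet> mu X Y w
    = (mui X' Y' w \<bullet> mop X f X' (FO M Y' # w) \<bullet> lw X (mop Y g Y' w) \<bullet> tgt.asc (FO M X) (FO M Y) w)
      \<bullet> tgt.asci (FO M X) (FO M Y) w \<bullet> mu X Y w"
    by simp
  then show ?thesis
    using assms by (simp add: tgt.reassoc[OF tgt.asc_asci] src.tensor_in_Hom)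
qed

text \<open>An associator only regroups: its image splits a letter according to one bracketing and
  merges it according to the other. The compatibility of \<open>M\<close> with associators is
  exactly this, once the associators of \<open>D\<close> are absorbed into words.\<close>

lemma mop_assoc:
  "mop ((X \<odot>\<^bsub>C\<^esub> Y) \<odot>\<^bsub>C\<^esub> Z) (\<a>\<^bsub>C\<^esub> X Y Z) (X \<odot>\<^bsub>C\<^esub> (Y \<odot>\<^bsub>C\<^esub> Z)) w
    = mui X (Y \<odot>\<^bsub>C\<^esub> Z) w \<bullet> lw X (mui Y Z w) \<bullet> mu X Y (FO M Z # w) \<bullet> mu (X \<odot>\<^bsub>C\<^esub> Y) Z w"
proof -
  let ?X = "FO M X" and ?Y = "FO M Y" and ?Z = "FO M Z"
  let ?asc = "tgt.asc ?X ?Y (?Z # w) \<bullet> tgt.asc (?X \<odot>\<^bsub>D\<^esub> ?Y) ?Z w"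
  let ?asci = "tgt.asci (?X \<odot>\<^bsub>D\<^esub> ?Y) ?Z w \<bullet> tgt.asci ?X ?Y (?Z # w)"
  note T = FM_in_Hom[OF src.assoc_in_Hom] FTens_in_Hom tgt.id_in_Hom tgt.assoc_in_Hom
    tgt.tensor_in_Hom[OF FTens_in_Hom tgt.id_in_Hom] tgt.tensor_in_Hom[OF tgt.id_in_Hom FTens_in_Hom]
  have "tgt.opr ((?X \<odot>\<^bsub>D\<^esub> ?Y) \<odot>\<^bsub>D\<^esub> ?Z) (FM M (\<a>\<^bsub>C\<^esub> X Y Z) \<cdot>\<^bsub>D\<^esub> FTens M (X \<odot>\<^bsub>C\<^esub> Y) Z \<cdot>\<^bsub>D\<^esub> (FTens M X Y \<otimes>\<^bsub>D\<^esub> \<iota>\<^bsub>D\<^esub> ?Z))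
      (FO M (X \<odot>\<^bsub>C\<^esub> (Y \<odot>\<^bsub>C\<^esub> Z))) w
    = mop ((X \<odot>\<^bsub>C\<^esub> Y) \<odot>\<^bsub>C\<^esub> Z) (\<a>\<^bsub>C\<^esub> X Y Z) (X \<odot>\<^bsub>C\<^esub> (Y \<odot>\<^bsub>C\<^esub> Z)) w \<bullet> mui (X \<odot>\<^bsub>C\<^esub> Y) Z w \<bullet> mui X Y (?Z # w) \<bullet> ?asc"
    by (simp add: tgt.opr_comp[OF T(5) tgt.comp_in_Hom[OF T(2,1)]] tgt.opr_comp[OF T(2,1)]
        tgt.opr_tensor[OF T(2,3)] opr_FTens_eq mop_def tgt.reassoc[OF tgt.asc_asci] del: opr_FTens)
  moreover have "tgt.opr ((?X \<odot>\<^bsub>D\<^esub> ?Y) \<odot>\<^bsub>D\<^esub> ?Z) (FTens M X (Y \<odot>\<^bsub>C\<^esub> Z) \<cdot>\<^bsub>D\<^esub> (\<iota>\<^bsub>D\<^esub> ?X \<otimes>\<^bsub>D\<^esub> FTens M Y Z) \<cdot>\<^bsub>D\<^esub> \<a>\<^bsub>D\<^esub> ?X ?Y ?Z)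
      (FO M (X \<odot>\<^bsub>C\<^esub> (Y \<odot>\<^bsub>C\<^esub> Z))) w
    = mui X (Y \<odot>\<^bsub>C\<^esub> Z) w \<bullet> lw X (mui Y Z w) \<bullet> ?asc"
    by (simp add: tgt.opr_comp[OF T(4) tgt.comp_in_Hom[OF T(6,2)]] tgt.opr_comp[OF T(6,2)]
        tgt.opr_tensor[OF T(3,2)] opr_FTens_eq tgt.opr_assoc tgt.reassoc[OF tgt.asc_asci]
        tgt.reassoc[OF tgt.asc_asci[THEN tgt.wl_eq[of _ _ ?X], unfolded tgt.wl_cmp tgt.wl_id]] del: opr_FTens)
  ultimately have "mop ((X \<odot>\<^bsub>C\<^esub> Y) \<odot>\<^bsub>C\<^esub> Z) (\<a>\<^bsub>C\<^esub> X Y Z) (X \<odot>\<^bsub>C\<^esub> (Y \<odot>\<^bsub>C\<^esub> Z)) w \<bullet> mui (X \<odot>\<^bsub>C\<^esub> Y) Z w \<bullet> mui X Y (?Z # w) \<bullet> ?asc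
    = mui X (Y \<odot>\<^bsub>C\<^esub> Z) w \<bullet> lw X (mui Y Z w) \<bullet> ?asc"
    by (simp only: FTens_assoc)
  then have "(mop ((X \<odot>\<^bsub>C\<^esub> Y) \<odot>\<^bsub>C\<^esub> Z) (\<a>\<^bsub>C\<^esub> X Y Z) (X \<odot>\<^bsub>C\<^esub> (Y \<odot>\<^bsub>C\<^esub> Z)) w \<bullet> mui (X \<odot>\<^bsub>C\<^esub> Y) Z w \<bullet> mui X Y (?Z # w) \<bullet> ?asc)
      \<bullet> ?asci \<bullet> mu X Y (?Z # w) \<bullet> mu (X \<odot>\<^bsub>C\<^esub> Y) Z w
    = (mui X (Y \<odot>\<^bsub>C\<^esub> Z) w \<bullet> lw X (mui Y Z w) \<bullet> ?asc) \<bullet> ?asci \<bullet> mu X Y (?Z # w) \<bullet> mu (X \<odot>\<^bsub>C\<^esub> Y) Z w"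
    by (simp only:)
  then show ?thesis
    by (simp add: tgt.reassoc[OF tgt.asc_asci] src.assoc_in_Hom)
qed

lemma mop_assoc_inv:
  "mop (X \<odot>\<^bsub>C\<^esub> (Y \<odot>\<^bsub>C\<^esub> Z)) (assoc_inv C X Y Z) ((X \<odot>\<^bsub>C\<^esub> Y) \<odot>\<^bsub>C\<^esub> Z) w
    = mui (X \<odot>\<^bsub>C\<^esub> Y) Z w \<bullet> mui X Y (FO M Z # w) \<bullet> lw X (mu Y Z w) \<bullet> mu X (Y \<odot>\<^bsub>C\<^esub> Z) w" (is "?a' = ?r")
proof -
  let ?a = "mop ((X \<odot>\<^bsub>C\<^esub> Y) \<odot>\<^bsub>C\<^esub> Z) (\<a>\<^bsub>C\<^esub> X Y Z) (X \<odot>\<^bsub>C\<^esub> (Y \<odot>\<^bsub>C\<^esub> Z)) w"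
  have "?r \<bullet> ?a = tgt.idn (FO M ((X \<odot>\<^bsub>C\<^esub> Y) \<odot>\<^bsub>C\<^esub> Z) # w)"
    by (simp add: mop_assoc)
  then have "(?r \<bullet> ?a) \<bullet> ?a' = ?a'"
    by (simp add: src.assoc_inv_in_Hom del: tgt.cmp_assoc)
  moreover have "?a \<bullet> ?a' = tgt.idn (FO M (X \<odot>\<^bsub>C\<^esub> (Y \<odot>\<^bsub>C\<^esub> Z)) # w)"
    using mop_inverse(1)[OF src.inv_mor_pair[OF src.assoc_iso]] by (simp add: assoc_inv_def)
  ultimately show ?thesis
    by simp
qed

lemma mop_lunit: "mop (\<one>\<^bsub>C\<^esub> \<odot>\<^bsub>C\<^esub> X) (\<l>\<^bsub>C\<^esub> X) X w = me (FO M X # w) \<bullet> mu \<one>\<^bsub>C\<^esub> X w"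
proof -
  let ?X = "FO M X"
  note T = FM_in_Hom[OF src.lunit_in_Hom] FTens_in_Hom tgt.id_in_Hom FUnit_in_Hom
    tgt.tensor_in_Hom[OF FUnit_in_Hom tgt.id_in_Hom]
  let ?f = "tgt.opr (FO M \<one>\<^bsub>C\<^esub>) (FUnit_inv C D M) \<one>\<^bsub>D\<^esub> (?X # w)"
  have "tgt.opr (\<one>\<^bsub>D\<^esub> \<odot>\<^bsub>D\<^esub> ?X) (FM M (\<l>\<^bsub>C\<^esub> X) \<cdot>\<^bsub>D\<^esub> FTens M \<one>\<^bsub>C\<^esub> X \<cdot>\<^bsub>D\<^esub> (FUnit M \<otimes>\<^bsub>D\<^esub> \<iota>\<^bsub>D\<^esub> ?X)) ?X w
    = mop (\<one>\<^bsub>C\<^esub> \<odot>\<^bsub>C\<^esub> X) (\<l>\<^bsub>C\<^esub> X) X w \<bullet> mui \<one>\<^bsub>C\<^esub> X w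
      \<bullet> tgt.opr \<one>\<^bsub>D\<^esub> (FUnit M) (FO M \<one>\<^bsub>C\<^esub>) (?X # w) \<bullet> tgt.asc \<one>\<^bsub>D\<^esub> ?X w"
    by (simp add: tgt.opr_comp[OF T(5) tgt.comp_in_Hom[OF T(2,1)]] tgt.opr_comp[OF T(2,1)]
        tgt.opr_tensor[OF T(4,3)] opr_FTens_eq mop_def tgt.reassoc[OF tgt.asc_asci] T(4) del: opr_FTens)
  then have "mop (\<one>\<^bsub>C\<^esub> \<odot>\<^bsub>C\<^esub> X) (\<l>\<^bsub>C\<^esub> X) X w \<bullet> mui \<one>\<^bsub>C\<^esub> X w
      \<bullet> tgt.opr \<one>\<^bsub>D\<^esub> (FUnit M) (FO M \<one>\<^bsub>C\<^esub>) (?X # w) \<bullet> tgt.asc \<one>\<^bsub>D\<^esub> ?X w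
    = tgt.lun (?X # w) \<bullet> tgt.asc \<one>\<^bsub>D\<^esub> ?X w"
    by (simp add: FTens_lunit tgt.opr_lunit)
  then have "(mop (\<one>\<^bsub>C\<^esub> \<odot>\<^bsub>C\<^esub> X) (\<l>\<^bsub>C\<^esub> X) X w \<bullet> mui \<one>\<^bsub>C\<^esub> X w
      \<bullet> tgt.opr \<one>\<^bsub>D\<^esub> (FUnit M) (FO M \<one>\<^bsub>C\<^esub>) (?X # w) \<bullet> tgt.asc \<one>\<^bsub>D\<^esub> ?X w)
      \<bullet> tgt.asci \<one>\<^bsub>D\<^esub> ?X w \<bullet> ?f \<bullet> mu \<one>\<^bsub>C\<^esub> X w
    = (tgt.lun (?X # w) \<bullet> tgt.asc \<one>\<^bsub>D\<^esub> ?X w) \<bullet> tgt.asci \<one>\<^bsub>D\<^esub> ?X w \<bullet> ?f \<bullet> mu \<one>\<^bsub>C\<^esub> X w"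
    by (simp only:)
  then show ?thesis
    by (simp add: tgt.reassoc[OF tgt.asc_asci] tgt.reassoc[OF opr_FUnit(1)] src.lunit_in_Hom me_def
        FUnit_inv_in_Hom)
qed

lemma mop_runit: "mop (X \<odot>\<^bsub>C\<^esub> \<one>\<^bsub>C\<^esub>) (\<r>\<^bsub>C\<^esub> X) X w = lw X (me w) \<bullet> mu X \<one>\<^bsub>C\<^esub> w"
proof -
  let ?X = "FO M X"
  note T = FM_in_Hom[OF src.runit_in_Hom] FTens_in_Hom tgt.id_in_Hom FUnit_in_Hom
    tgt.tensor_in_Hom[OF tgt.id_in_Hom FUnit_in_Hom]
  let ?f = "lw X (tgt.opr (FO M \<one>\<^bsub>C\<^esub>) (FUnit_inv C D M) \<one>\<^bsub>D\<^esub> w)"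
  have ff: "lw X (tgt.opr \<one>\<^bsub>D\<^esub> (FUnit M) (FO M \<one>\<^bsub>C\<^esub>) w) \<bullet> ?f = tgt.idn (?X # FO M \<one>\<^bsub>C\<^esub> # w)"
    by (simp flip: tgt.wl_cmp)
  have "tgt.opr (?X \<odot>\<^bsub>D\<^esub> \<one>\<^bsub>D\<^esub>) (FM M (\<r>\<^bsub>C\<^esub> X) \<cdot>\<^bsub>D\<^esub> FTens M X \<one>\<^bsub>C\<^esub> \<cdot>\<^bsub>D\<^esub> (\<iota>\<^bsub>D\<^esub> ?X \<otimes>\<^bsub>D\<^esub> FUnit M)) ?X w
    = mop (X \<odot>\<^bsub>C\<^esub> \<one>\<^bsub>C\<^esub>) (\<r>\<^bsub>C\<^esub> X) X w \<bullet> mui X \<one>\<^bsub>C\<^esub> w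
      \<bullet> lw X (tgt.opr \<one>\<^bsub>D\<^esub> (FUnit M) (FO M \<one>\<^bsub>C\<^esub>) w) \<bullet> tgt.asc ?X \<one>\<^bsub>D\<^esub> w"
    by (simp add: tgt.opr_comp[OF T(5) tgt.comp_in_Hom[OF T(2,1)]] tgt.opr_comp[OF T(2,1)]
        tgt.opr_tensor[OF T(3,4)] opr_FTens_eq mop_def tgt.reassoc[OF tgt.asc_asci] T(4) del: opr_FTens)
  then have "mop (X \<odot>\<^bsub>C\<^esub> \<one>\<^bsub>C\<^esub>) (\<r>\<^bsub>C\<^esub> X) X w \<bullet> mui X \<one>\<^bsub>C\<^esub> w
      \<bullet> lw X (tgt.opr \<one>\<^bsub>D\<^esub> (FUnit M) (FO M \<one>\<^bsub>C\<^esub>) w) \<bullet> tgt.asc ?X \<one>\<^bsub>D\<^esub> w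
    = lw X (tgt.lun w) \<bullet> tgt.asc ?X \<one>\<^bsub>D\<^esub> w"
    by (simp add: FTens_runit tgt.opr_runit)
  then have "(mop (X \<odot>\<^bsub>C\<^esub> \<one>\<^bsub>C\<^esub>) (\<r>\<^bsub>C\<^esub> X) X w \<bullet> mui X \<one>\<^bsub>C\<^esub> w
      \<bullet> lw X (tgt.opr \<one>\<^bsub>D\<^esub> (FUnit M) (FO M \<one>\<^bsub>C\<^esub>) w) \<bullet> tgt.asc ?X \<one>\<^bsub>D\<^esub> w)
      \<bullet> tgt.asci ?X \<one>\<^bsub>D\<^esub> w \<bullet> ?f \<bullet> mu X \<one>\<^bsub>C\<^esub> w
    = (lw X (tgt.lun w) \<bullet> tgt.asc ?X \<one>\<^bsub>D\<^esub> w) \<bullet> tgt.asci ?X \<one>\<^bsub>D\<^esub> w \<bullet> ?f \<bullet> mu X \<one>\<^bsub>C\<^esub> w"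
    by (simp only:)
  then show ?thesis
    by (simp add: tgt.reassoc[OF tgt.asc_asci] tgt.reassoc[OF ff] src.runit_in_Hom me_def
        FUnit_inv_in_Hom)
qed

lemma mop_lunit_inv: "mop X (lunit_inv C X) (\<one>\<^bsub>C\<^esub> \<odot>\<^bsub>C\<^esub> X) w = mui \<one>\<^bsub>C\<^esub> X w \<bullet> mei (FO M X # w)"
proof -
  have "mop (\<one>\<^bsub>C\<^esub> \<odot>\<^bsub>C\<^esub> X) (\<l>\<^bsub>C\<^esub> X) X w \<bullet> mop X (lunit_inv C X) (\<one>\<^bsub>C\<^esub> \<odot>\<^bsub>C\<^esub> X) w = tgt.idn (FO M X # w)"
    using mop_inverse(1)[OF src.inv_mor_pair[OF src.lunit_iso]] by (simp add: lunit_inv_def)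
  then have "mui \<one>\<^bsub>C\<^esub> X w \<bullet> mei (FO M X # w) \<bullet> me (FO M X # w) \<bullet> mu \<one>\<^bsub>C\<^esub> X w
      \<bullet> mop X (lunit_inv C X) (\<one>\<^bsub>C\<^esub> \<odot>\<^bsub>C\<^esub> X) w = mui \<one>\<^bsub>C\<^esub> X w \<bullet> mei (FO M X # w)"
    by (simp add: mop_lunit)
  then show ?thesis
    by (simp add: src.lunit_inv_in_Hom)
qed

lemma mop_runit_inv: "mop X (runit_inv C X) (X \<odot>\<^bsub>C\<^esub> \<one>\<^bsub>C\<^esub>) w = mui X \<one>\<^bsub>C\<^esub> w \<bullet> lw X (mei w)"
proof -
  have "mop (X \<odot>\<^bsub>C\<^esub> \<one>\<^bsub>C\<^esub>) (\<r>\<^bsub>C\<^esub> X) X w \<bullet> mop X (runit_inv C X) (X \<odot>\<^bsub>C\<^esub> \<one>\<^bsub>C\<^esub>) w = tgt.idn (FO M X # w)"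
    using mop_inverse(1)[OF src.inv_mor_pair[OF src.runit_iso]] by (simp add: runit_inv_def)
  then have "mui X \<one>\<^bsub>C\<^esub> w \<bullet> lw X (mei w) \<bullet> lw X (me w) \<bullet> mu X \<one>\<^bsub>C\<^esub> w
      \<bullet> mop X (runit_inv C X) (X \<odot>\<^bsub>C\<^esub> \<one>\<^bsub>C\<^esub>) w = mui X \<one>\<^bsub>C\<^esub> w \<bullet> lw X (mei w)"
    by (simp add: mop_runit)
  then show ?thesis
    by (simp add: src.runit_inv_in_Hom)
qed

lemmas mop_coherence = mop_assoc mop_assoc_inv mop_lunit mop_lunit_inv mop_runit mop_runit_inv

end

context monoidal_category
begin

text \<open>With \<open>wl2_id\<close>, a transformer of rewrite rules: it carries an equation of
  two-step composites under one more letter on the left, already in the distributed form that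
  \<open>wl_cmp\<close> produces.\<close>

lemma wl2: "f \<bullet> g = h \<bullet> k \<Longrightarrow> wl y f \<bullet> wl y g = wl y h \<bullet> wl y k"
  by (metis wl_cmp)

lemma wl2_id: "f \<bullet> g = idn w \<Longrightarrow> wl y f \<bullet> wl y g = idn (y # w)"
  by (metis wl_cmp wl_id)

end

section \<open>Cups and caps\<close>

context monoidal_functor
begin

text \<open>Merging the two letters first and discarding the unit letter last makes the cap erase
  two adjacent letters, as in a string diagram.\<close>

definition capm :: "'m \<Rightarrow> 'o \<Rightarrow> 'o \<Rightarrow> 'p list \<Rightarrow> ('p, 'n) arr" where
  "capm e P Q w = me w \<bullet> mop (P \<odot>\<^bsub>C\<^esub> Q) e \<one>\<^bsub>C\<^esub> w \<bullet> mui P Q w"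

definition cupm :: "'m \<Rightarrow> 'o \<Rightarrow> 'o \<Rightarrow> 'p list \<Rightarrow> ('p, 'n) arr" where
  "cupm k P Q w = mu P Q w \<bullet> mop \<one>\<^bsub>C\<^esub> k (P \<odot>\<^bsub>C\<^esub> Q) w \<bullet> mei w"

lemma dom_cod_cap [simp]:
  "adom (capm e P Q w) = FO M P # FO M Q # w" "acod (capm e P Q w) = w"
  "adom (cupm k P Q w) = w" "acod (cupm k P Q w) = FO M P # FO M Q # w"
  by (simp_all add: capm_def cupm_def)

lemma ok_cap [simp]:
  "e \<in> Hom C (P \<odot>\<^bsub>C\<^esub> Q) \<one>\<^bsub>C\<^esub> \<Longrightarrow> tgt.ok (capm e P Q w)"
  "k \<in> Hom C \<one>\<^bsub>C\<^esub> (P \<odot>\<^bsub>C\<^esub> Q) \<Longrightarrow> tgt.ok (cupm k P Q w)"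
  by (simp_all add: capm_def cupm_def)

lemma capm_natural: "acod h = w \<Longrightarrow> capm e P Q w \<bullet> lw P (lw Q h) = h \<bullet> capm e P Q (adom h)"
  by (simp add: capm_def mui_natural mop_natural[THEN tgt.reassoc] me_natural[THEN tgt.reassoc])

lemma cupm_natural: "acod h = w \<Longrightarrow> cupm k P Q w \<bullet> h = lw P (lw Q h) \<bullet> cupm k P Q (adom h)"
  by (simp add: cupm_def mei_natural mop_natural[THEN tgt.reassoc] mu_natural[THEN tgt.reassoc])

lemma capm_comp:
  assumes "f \<in> Hom C P P'" "g \<in> Hom C Q Q'" "e \<in> Hom C (P' \<odot>\<^bsub>C\<^esub> Q') \<one>\<^bsub>C\<^esub>"
  shows "capm (e \<cdot>\<^bsub>C\<^esub> (f \<otimes>\<^bsub>C\<^esub> g)) P Q w = capm e P' Q' w \<bullet> mop P f P' (FO M Q' # w) \<bullet> lw P (mop Q g Q' w)"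
  using assms by (simp add: capm_def mop_comp[OF src.tensor_in_Hom[OF assms(1,2)] assms(3)] mop_tensor)

lemma cupm_comp:
  assumes "f \<in> Hom C P P'" "g \<in> Hom C Q Q'" "k \<in> Hom C \<one>\<^bsub>C\<^esub> (P \<odot>\<^bsub>C\<^esub> Q)"
  shows "cupm ((f \<otimes>\<^bsub>C\<^esub> g) \<cdot>\<^bsub>C\<^esub> k) P' Q' w = mop P f P' (FO M Q' # w) \<bullet> lw P (mop Q g Q' w) \<bullet> cupm k P Q w"
  using assms by (simp add: cupm_def mop_comp[OF assms(3) src.tensor_in_Hom[OF assms(1,2)]] mop_tensor)

end

section \<open>Pivotal calculus\<close>

text \<open>Here all cups and caps are images under \<open>M\<close> of those of \<open>C\<close>.
  The same development is later instantiated with the identity functor, which gives the calculus of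
  a single pivotal category.\<close>

locale pivotal_action =
  src: pivotal_category C + monoidal_functor C D M
  for C :: "('o, 'm::ab_group_add, 'k::field, 'z) piv_cat_scheme"
    and D :: "('p, 'n::ab_group_add, 'k, 'y) mon_cat_scheme"
    and M :: "('o, 'm, 'p, 'n) mon_fun"
begin

abbreviation du where "du X \<equiv> dual\<^bsub>C\<^esub> X"

lemma piv_in_Hom: "\<pi>\<^bsub>C\<^esub> X \<in> Hom C X (du (du X))"
  by (rule src.iso_in_Hom[OF src.piv_iso])

lemma piv_inv_in_Hom: "inv_mor C X (du (du X)) (\<pi>\<^bsub>C\<^esub> X) \<in> Hom C (du (du X)) X"
  by (rule src.inv_mor_in_Hom[OF src.piv_iso])

lemma piv_ev_in_Hom: "piv_ev C X \<in> Hom C (X \<odot>\<^bsub>C\<^esub> (du X)) \<one>\<^bsub>C\<^esub>"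
  unfolding piv_ev_def
  by (rule src.comp_in_Hom[OF src.tensor_in_Hom[OF piv_in_Hom src.id_in_Hom] src.ev_in_Hom])

lemma piv_coev_in_Hom: "piv_coev C X \<in> Hom C \<one>\<^bsub>C\<^esub> ((du X) \<odot>\<^bsub>C\<^esub> X)"
  unfolding piv_coev_def
  by (rule src.comp_in_Hom[OF src.coev_in_Hom src.tensor_in_Hom[OF src.id_in_Hom piv_inv_in_Hom]])

lemmas typing = src.comp_in_Hom src.mor_in_Hom src.ev_in_Hom src.coev_in_Hom
  piv_in_Hom piv_inv_in_Hom piv_ev_in_Hom piv_coev_in_Hom

definition evm where "evm X w = capm (ev\<^bsub>C\<^esub> X) (du X) X w"
definition coevm where "coevm X w = cupm (coev\<^bsub>C\<^esub> X) X (du X) w"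
definition pevm where "pevm X w = capm (piv_ev C X) X (du X) w"
definition pcoevm where "pcoevm X w = cupm (piv_coev C X) (du X) X w"

lemma dom_cod_ev [simp]:
  "adom (evm X w) = FO M (du X) # FO M X # w" "acod (evm X w) = w"
  "adom (coevm X w) = w" "acod (coevm X w) = FO M X # FO M (du X) # w"
  "adom (pevm X w) = FO M X # FO M (du X) # w" "acod (pevm X w) = w"
  "adom (pcoevm X w) = w" "acod (pcoevm X w) = FO M (du X) # FO M X # w"
  by (simp_all add: evm_def coevm_def pevm_def pcoevm_def)

lemma ok_ev [simp]:
  "tgt.ok (evm X w)" "tgt.ok (coevm X w)" "tgt.ok (pevm X w)" "tgt.ok (pcoevm X w)"
  by (simp_all add: evm_def coevm_def pevm_def pcoevm_def src.ev_in_Hom src.coev_in_Hom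
      piv_ev_in_Hom piv_coev_in_Hom)

lemma evm_natural: "acod h = w \<Longrightarrow> evm X w \<bullet> lw (du X) (lw X h) = h \<bullet> evm X (adom h)"
  unfolding evm_def by (rule capm_natural)

lemma pevm_natural: "acod h = w \<Longrightarrow> pevm X w \<bullet> lw X (lw (du X) h) = h \<bullet> pevm X (adom h)"
  unfolding pevm_def by (rule capm_natural)

lemma coevm_natural: "acod h = w \<Longrightarrow> coevm X w \<bullet> h = lw X (lw (du X) h) \<bullet> coevm X (adom h)"
  unfolding coevm_def by (rule cupm_natural)

lemma pcoevm_natural: "acod h = w \<Longrightarrow> pcoevm X w \<bullet> h = lw (du X) (lw X h) \<bullet> pcoevm X (adom h)"
  unfolding pcoevm_def by (rule cupm_natural)

text \<open>Naturality rules at increasing depth: the numbered copies hold under one, two and three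
  letters on the left.\<close>

lemmas nat0 = evm_natural pevm_natural coevm_natural pcoevm_natural mop_natural
lemmas nat1 = nat0[THEN tgt.wl2]
lemmas nat2 = nat1[THEN tgt.wl2]
lemmas nat3 = nat2[THEN tgt.wl2]
lemmas nats = nat0 nat1 nat2 nat3
lemmas nats' = nats nats[THEN tgt.reassoc]
text \<open>These rules move arrows past caps and coupons only. Cups stay where they are, ready for
  a zigzag identity.\<close>

lemmas cap0 = evm_natural pevm_natural mop_natural capm_natural
lemmas cap1 = cap0[THEN tgt.wl2]
lemmas cap2 = cap1[THEN tgt.wl2]
lemmas cap3 = cap2[THEN tgt.wl2]
lemmas caps = cap0 cap1 cap2 cap3
lemmas caps' = caps caps[THEN tgt.reassoc]

section \<open>Zigzag identities\<close>

lemma zig_ev: "lw X (evm X w) \<bullet> coevm X (FO M X # w) = tgt.idn (FO M X # w)"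
proof -
  have "mop (\<one>\<^bsub>C\<^esub> \<odot>\<^bsub>C\<^esub> X) (\<r>\<^bsub>C\<^esub> X \<cdot>\<^bsub>C\<^esub> (\<iota>\<^bsub>C\<^esub> X \<otimes>\<^bsub>C\<^esub> ev\<^bsub>C\<^esub> X) \<cdot>\<^bsub>C\<^esub> \<a>\<^bsub>C\<^esub> X (du X) X \<cdot>\<^bsub>C\<^esub> (coev\<^bsub>C\<^esub> X \<otimes>\<^bsub>C\<^esub> \<iota>\<^bsub>C\<^esub> X)) X w
    = lw X (evm X w) \<bullet> coevm X (FO M X # w) \<bullet> me (FO M X # w) \<bullet> mu \<one>\<^bsub>C\<^esub> X w"
    by ((subst mop_comp, (rule typing)+)+)
       (simp add: mop_tensor mop_coherence typing evm_def coevm_def capm_def cupm_def)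
  then have "(lw X (evm X w) \<bullet> coevm X (FO M X # w) \<bullet> me (FO M X # w) \<bullet> mu \<one>\<^bsub>C\<^esub> X w)
      \<bullet> mui \<one>\<^bsub>C\<^esub> X w \<bullet> mei (FO M X # w)
    = (me (FO M X # w) \<bullet> mu \<one>\<^bsub>C\<^esub> X w) \<bullet> mui \<one>\<^bsub>C\<^esub> X w \<bullet> mei (FO M X # w)"
    by (simp only: src.zigzag mop_lunit)
  then show ?thesis
    by simp
qed

lemma zig_ev': "evm X (FO M (du X) # w) \<bullet> lw (du X) (coevm X w) = tgt.idn (FO M (du X) # w)"
proof -
  have "mop ((du X) \<odot>\<^bsub>C\<^esub> \<one>\<^bsub>C\<^esub>) (\<l>\<^bsub>C\<^esub> (du X) \<cdot>\<^bsub>C\<^esub> (ev\<^bsub>C\<^esub> X \<otimes>\<^bsub>C\<^esub> \<iota>\<^bsub>C\<^esub> (du X)) \<cdot>\<^bsub>C\<^esub> assoc_inv C (du X) X (du X)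
      \<cdot>\<^bsub>C\<^esub> (\<iota>\<^bsub>C\<^esub> (du X) \<otimes>\<^bsub>C\<^esub> coev\<^bsub>C\<^esub> X)) (du X) w
    = evm X (FO M (du X) # w) \<bullet> lw (du X) (coevm X w) \<bullet> lw (du X) (me w) \<bullet> mu (du X) \<one>\<^bsub>C\<^esub> w"
    by ((subst mop_comp, (rule typing)+)+)
       (simp add: mop_tensor mop_coherence typing evm_def coevm_def capm_def cupm_def)
  then have "(evm X (FO M (du X) # w) \<bullet> lw (du X) (coevm X w) \<bullet> lw (du X) (me w) \<bullet> mu (du X) \<one>\<^bsub>C\<^esub> w)
      \<bullet> mui (du X) \<one>\<^bsub>C\<^esub> w \<bullet> lw (du X) (mei w)
    = (lw (du X) (me w) \<bullet> mu (du X) \<one>\<^bsub>C\<^esub> w) \<bullet> mui (du X) \<one>\<^bsub>C\<^esub> w \<bullet> lw (du X) (mei w)"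
    by (simp only: src.zigzag_dual mop_runit)
  then show ?thesis
    by simp
qed

abbreviation pim where "pim X w \<equiv> mop X (\<pi>\<^bsub>C\<^esub> X) (du (du X)) w"
abbreviation pimi where "pimi X w \<equiv> mop (du (du X)) (inv_mor C X (du (du X)) (\<pi>\<^bsub>C\<^esub> X)) X w"

lemma pim_inv:
  "pim X w \<bullet> pimi X w = tgt.idn (FO M (du (du X)) # w)" "pimi X w \<bullet> pim X w = tgt.idn (FO M X # w)"
  by (rule mop_inverse[OF src.inv_mor_pair[OF src.piv_iso]])+

lemma pevm_eq: "pevm X w = evm (du X) w \<bullet> pim X (FO M (du X) # w)"
  by (simp add: pevm_def piv_ev_def capm_comp[OF piv_in_Hom src.id_in_Hom src.ev_in_Hom] evm_def
      piv_in_Hom)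

lemma pcoevm_eq: "pcoevm X w = lw (du X) (pimi X w) \<bullet> coevm (du X) w"
  by (simp add: pcoevm_def piv_coev_def cupm_comp[OF src.id_in_Hom piv_inv_in_Hom src.coev_in_Hom]
      coevm_def piv_inv_in_Hom src.coev_in_Hom)

lemma zig_pev: "lw (du X) (pevm X w) \<bullet> pcoevm X (FO M (du X) # w) = tgt.idn (FO M (du X) # w)"
  by (simp add: pevm_eq pcoevm_eq pim_inv[THEN tgt.wl2_id, THEN tgt.reassoc] zig_ev)

text \<open>The zigzag identity of \<open>du X\<close>, conjugated by the pivotal structure of
  \<open>X\<close>.\<close>

lemma zig_pev': "pevm X (FO M X # w) \<bullet> lw X (pcoevm X w) = tgt.idn (FO M X # w)"
proof -
  have "pevm X (FO M X # w) \<bullet> lw X (pcoevm X w)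
    = pimi X w \<bullet> (evm (du X) (FO M (du (du X)) # w) \<bullet> lw (du (du X)) (coevm (du X) w)) \<bullet> pim X w"
    by (simp add: pevm_eq pcoevm_eq caps')
  then show ?thesis
    by (simp add: zig_ev' pim_inv piv_in_Hom)
qed

lemmas zig0 = zig_ev zig_ev' zig_pev zig_pev'
lemmas zig1 = zig0[THEN tgt.wl2_id]
lemmas zig2 = zig1[THEN tgt.wl2_id]
lemmas zigs = zig0 zig1 zig2
lemmas zigs' = zigs zigs[THEN tgt.reassoc]

text \<open>Bending the strand back with \<open>pcoevm\<close> recovers an arrow from its composite
  with the cap, by \<open>zig_pev\<close>. Equations between arrows ending in a dual letter are
  proved by capping them off.\<close>

lemma pevm_inj:
  assumes "tgt.ok f" "tgt.ok g" "acod f = FO M (du X) # w" "acod g = FO M (du X) # w" "adom f = adom g"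
    and "pevm X w \<bullet> lw X f = pevm X w \<bullet> lw X g"
  shows "f = g"
proof -
  have "h = lw (du X) (pevm X w \<bullet> lw X h) \<bullet> pcoevm X (adom h)" if "tgt.ok h" "acod h = FO M (du X) # w" for h
  proof -
    have "h = (lw (du X) (pevm X w) \<bullet> pcoevm X (FO M (du X) # w)) \<bullet> h"
      using that by (simp add: zig_pev)
    then show ?thesis
      using that by (simp add: pcoevm_natural)
  qed
  from this[OF assms(1,3)] this[OF assms(2,4)] assms(5,6) show ?thesis
    by metis
qed

section \<open>Transposes, and sliding morphisms around cups and caps\<close>

lemma dual_transpose_in_Hom:
  assumes "e \<in> Hom C (P \<odot>\<^bsub>C\<^esub> X) \<one>\<^bsub>C\<^esub>"
  shows "dual_transpose C P X e \<in> Hom C P (du X)"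
  unfolding dual_transpose_def by (rule typing assms)+

lemma mop_dual_transpose:
  assumes "e \<in> Hom C (P \<odot>\<^bsub>C\<^esub> X) \<one>\<^bsub>C\<^esub>"
  shows "mop P (dual_transpose C P X e) (du X) w = capm e P X (FO M (du X) # w) \<bullet> lw P (coevm X w)"
  unfolding dual_transpose_def
  by ((subst mop_comp, (rule typing assms)+)+)
     (simp add: mop_tensor mop_coherence typing coevm_def capm_def cupm_def assms)

lemma evm_dual_transpose:
  assumes "e \<in> Hom C (P \<odot>\<^bsub>C\<^esub> X) \<one>\<^bsub>C\<^esub>"
  shows "evm X w \<bullet> mop P (dual_transpose C P X e) (du X) (FO M X # w) = capm e P X w"
proof -
  have "evm X w \<bullet> mop P (dual_transpose C P X e) (du X) (FO M X # w)
    = capm e P X w \<bullet> lw P (lw X (evm X w) \<bullet> coevm X (FO M X # w))"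
    by (simp add: mop_dual_transpose[OF assms] caps')
  then show ?thesis
    using assms by (simp only: zig_ev) simp
qed

lemma dual_mor_cap_in_Hom:
  "f \<in> Hom C X Y \<Longrightarrow> ev\<^bsub>C\<^esub> Y \<cdot>\<^bsub>C\<^esub> (\<iota>\<^bsub>C\<^esub> (du Y) \<otimes>\<^bsub>C\<^esub> f) \<in> Hom C ((du Y) \<odot>\<^bsub>C\<^esub> X) \<one>\<^bsub>C\<^esub>"
  by (rule src.comp_in_Hom[OF src.tensor_in_Hom[OF src.id_in_Hom] src.ev_in_Hom])

lemma dual_mor_in_Hom: "f \<in> Hom C X Y \<Longrightarrow> dual_mor C X Y f \<in> Hom C (du Y) (du X)"
  unfolding dual_mor_def by (rule dual_transpose_in_Hom[OF dual_mor_cap_in_Hom])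

lemma evm_slide:
  assumes "f \<in> Hom C X Y"
  shows "evm Y w \<bullet> lw (du Y) (mop X f Y w) = evm X w \<bullet> mop (du Y) (dual_mor C X Y f) (du X) (FO M X # w)"
  unfolding dual_mor_def evm_dual_transpose[OF dual_mor_cap_in_Hom[OF assms]]
  using assms by (simp add: capm_comp[OF src.id_in_Hom assms src.ev_in_Hom] evm_def)

lemma pim_natural:
  assumes "f \<in> Hom C X Y"
  shows "mop (du (du X)) (dual_mor C (du Y) (du X) (dual_mor C X Y f)) ((du (du Y))) w \<bullet> pim X w = pim Y w \<bullet> mop X f Y w"
  using src.piv_natural[OF assms] dual_mor_in_Hom[OF dual_mor_in_Hom[OF assms]] assms
  by (metis mop_comp piv_in_Hom)

text \<open>Reduces to \<open>evm_slide\<close> for the dual of \<open>f\<close>; naturality of the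
  pivotal structure turns the double dual back into \<open>f\<close>.\<close>

lemma pevm_slide:
  assumes "f \<in> Hom C X Y"
  shows "pevm Y w \<bullet> mop X f Y (FO M (du Y) # w) = pevm X w \<bullet> lw X (mop (du Y) (dual_mor C X Y f) (du X) w)"
proof -
  have "pevm X w \<bullet> lw X (mop (du Y) (dual_mor C X Y f) (du X) w)
    = (evm (du X) w \<bullet> lw (du (du X)) (mop (du Y) (dual_mor C X Y f) (du X) w)) \<bullet> pim X (FO M (du Y) # w)"
    by (simp add: pevm_eq mop_natural)
  then show ?thesis
    using assms by (simp add: evm_slide dual_mor_in_Hom pim_natural pevm_eq)
qed

text \<open>Capped off with \<open>pevm X\<close>, both sides straighten to the action of
  \<open>f\<close>; then \<open>pevm_inj\<close> applies.\<close>

lemma pcoevm_slide: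
  assumes "f \<in> Hom C X Y"
  shows "lw (du X) (mop X f Y w) \<bullet> pcoevm X w = mop (du Y) (dual_mor C X Y f) (du X) (FO M Y # w) \<bullet> pcoevm Y w"
proof (rule pevm_inj[of _ _ X "FO M Y # w"])
  have "pevm X (FO M Y # w) \<bullet> lw X (mop (du Y) (dual_mor C X Y f) (du X) (FO M Y # w) \<bullet> pcoevm Y w)
    = (pevm Y (FO M Y # w) \<bullet> lw Y (pcoevm Y w)) \<bullet> mop X f Y w"
    by (simp add: pevm_slide[OF assms, symmetric, THEN tgt.reassoc] mop_natural)
  moreover have "pevm X (FO M Y # w) \<bullet> lw X (lw (du X) (mop X f Y w) \<bullet> pcoevm X w)
    = mop X f Y w \<bullet> (pevm X (FO M X # w) \<bullet> lw X (pcoevm X w))"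
    by (simp add: caps')
  ultimately show "pevm X (FO M Y # w) \<bullet> lw X (lw (du X) (mop X f Y w) \<bullet> pcoevm X w)
    = pevm X (FO M Y # w) \<bullet> lw X (mop (du Y) (dual_mor C X Y f) (du X) (FO M Y # w) \<bullet> pcoevm Y w)"
    using assms by (simp only: zig_pev') simp
qed (use assms in \<open>simp_all add: dual_mor_in_Hom\<close>)

subsection \<open>Duals of tensor products\<close>

abbreviation dten where "dten X Y \<equiv> dual_tensor C X Y"

text \<open>The canonical isomorphism for the dual of a product is the transpose of two nested caps,
  the inner one for \<open>X\<close> and the outer one for \<open>Y\<close>.\<close>

lemma dual_tensor_cap:
  fixes X Y
  defines "e \<equiv> ev\<^bsub>C\<^esub> Y \<cdot>\<^bsub>C\<^esub> (\<iota>\<^bsub>C\<^esub> (du Y) \<otimes>\<^bsub>C\<^esub> (\<l>\<^bsub>C\<^esub> Y \<cdot>\<^bsub>C\<^esub> (ev\<^bsub>C\<^esub> X \<otimes>\<^bsub>C\<^esub> \<iota>\<^bsub>C\<^esub> Y) \<cdot>\<^bsub>C\<^esub> assoc_inv C (du X) X Y))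
       \<cdot>\<^bsub>C\<^esub> \<a>\<^bsub>C\<^esub> (du Y) (du X) (X \<odot>\<^bsub>C\<^esub> Y)"
  shows "e \<in> Hom C (((du Y) \<odot>\<^bsub>C\<^esub> (du X)) \<odot>\<^bsub>C\<^esub> (X \<odot>\<^bsub>C\<^esub> Y)) \<one>\<^bsub>C\<^esub>"
    and "capm e ((du Y) \<odot>\<^bsub>C\<^esub> (du X)) (X \<odot>\<^bsub>C\<^esub> Y) w
      = evm Y w \<bullet> lw (du Y) (evm X (FO M Y # w)) \<bullet> lw (du Y) (lw (du X) (mu X Y w)) \<bullet> mu (du Y) (du X) (FO M (X \<odot>\<^bsub>C\<^esub> Y) # w)"
proof -
  show "e \<in> Hom C (((du Y) \<odot>\<^bsub>C\<^esub> (du X)) \<odot>\<^bsub>C\<^esub> (X \<odot>\<^bsub>C\<^esub> Y)) \<one>\<^bsub>C\<^esub>"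
    unfolding e_def by (rule typing)+
  have 1: "\<l>\<^bsub>C\<^esub> Y \<cdot>\<^bsub>C\<^esub> (ev\<^bsub>C\<^esub> X \<otimes>\<^bsub>C\<^esub> \<iota>\<^bsub>C\<^esub> Y) \<cdot>\<^bsub>C\<^esub> assoc_inv C (du X) X Y \<in> Hom C ((du X) \<odot>\<^bsub>C\<^esub> (X \<odot>\<^bsub>C\<^esub> Y)) Y"
    by (rule typing)+
  show "capm e ((du Y) \<odot>\<^bsub>C\<^esub> (du X)) (X \<odot>\<^bsub>C\<^esub> Y) w
      = evm Y w \<bullet> lw (du Y) (evm X (FO M Y # w)) \<bullet> lw (du Y) (lw (du X) (mu X Y w)) \<bullet> mu (du Y) (du X) (FO M (X \<odot>\<^bsub>C\<^esub> Y) # w)"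
    unfolding e_def capm_def
    apply ((subst mop_comp, (rule typing)+)+)
    apply (subst mop_tensor[OF src.id_in_Hom 1])
    apply ((subst mop_comp, (rule typing)+)+)
    apply (simp add: mop_tensor mop_coherence typing evm_def capm_def)
    done
qed

lemma dual_tensor_in_Hom: "dten X Y \<in> Hom C ((du Y) \<odot>\<^bsub>C\<^esub> (du X)) ((du (X \<odot>\<^bsub>C\<^esub> Y)))"
  unfolding dual_tensor_def by (rule dual_transpose_in_Hom[OF dual_tensor_cap(1)])

abbreviation dtm where "dtm X Y w \<equiv> mop ((du Y) \<odot>\<^bsub>C\<^esub> (du X)) (dten X Y) ((du (X \<odot>\<^bsub>C\<^esub> Y))) w"

lemma evm_tensor:
  "evm (X \<odot>\<^bsub>C\<^esub> Y) w \<bullet> dtm X Y (FO M (X \<odot>\<^bsub>C\<^esub> Y) # w)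
    = evm Y w \<bullet> lw (du Y) (evm X (FO M Y # w)) \<bullet> lw (du Y) (lw (du X) (mu X Y w)) \<bullet> mu (du Y) (du X) (FO M (X \<odot>\<^bsub>C\<^esub> Y) # w)"
  unfolding dual_tensor_def evm_dual_transpose[OF dual_tensor_cap(1)] by (rule dual_tensor_cap(2))

lemma piv_tensor:
  "mop ((du (du (X \<odot>\<^bsub>C\<^esub> Y)))) (dual_mor C ((du Y) \<odot>\<^bsub>C\<^esub> (du X)) ((du (X \<odot>\<^bsub>C\<^esub> Y))) (dten X Y)) ((du ((du Y) \<odot>\<^bsub>C\<^esub> (du X)))) w \<bullet> pim (X \<odot>\<^bsub>C\<^esub> Y) w
    = dtm (du Y) (du X) w \<bullet> mui (du (du X)) ((du (du Y))) w \<bullet> pim X (FO M ((du (du Y))) # w) \<bullet> lw X (pim Y w) \<bullet> mu X Y w"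
  using arg_cong[OF src.piv_monoidal[of Y X], of "\<lambda>f. mop (X \<odot>\<^bsub>C\<^esub> Y) f ((du ((du Y) \<odot>\<^bsub>C\<^esub> (du X)))) w"]
  by (simp add: mop_comp[OF piv_in_Hom dual_mor_in_Hom[OF dual_tensor_in_Hom]]
      mop_comp[OF src.tensor_in_Hom[OF piv_in_Hom piv_in_Hom] dual_tensor_in_Hom]
      mop_tensor piv_in_Hom)

text \<open>Written through \<open>evm\<close> of the dual, this becomes \<open>evm_tensor\<close>
  for \<open>du Y\<close> and \<open>du X\<close>. Monoidality of the pivotal structure is what
  splits \<open>pim\<close> of the product into the \<open>pim\<close> of its factors.\<close>

lemma pevm_tensor:
  "pevm (X \<odot>\<^bsub>C\<^esub> Y) w \<bullet> lw (X \<odot>\<^bsub>C\<^esub> Y) (dtm X Y w)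
    = pevm X w \<bullet> lw X (pevm Y (FO M (du X) # w)) \<bullet> lw X (lw Y (mu (du Y) (du X) w)) \<bullet> mu X Y (FO M ((du Y) \<odot>\<^bsub>C\<^esub> (du X)) # w)"
proof -
  have "pevm (X \<odot>\<^bsub>C\<^esub> Y) w \<bullet> lw (X \<odot>\<^bsub>C\<^esub> Y) (dtm X Y w)
    = (evm ((du (X \<odot>\<^bsub>C\<^esub> Y))) w \<bullet> lw ((du (du (X \<odot>\<^bsub>C\<^esub> Y)))) (dtm X Y w)) \<bullet> pim (X \<odot>\<^bsub>C\<^esub> Y) (FO M ((du Y) \<odot>\<^bsub>C\<^esub> (du X)) # w)"
    by (simp add: pevm_eq mop_natural)
  also have "\<dots> = (evm ((du Y) \<odot>\<^bsub>C\<^esub> (du X)) w \<bullet> dtm (du Y) (du X) (FO M ((du Y) \<odot>\<^bsub>C\<^esub> (du X)) # w)) \<bullet> mui (du (du X)) ((du (du Y))) (FO M ((du Y) \<odot>\<^bsub>C\<^esub> (du X)) # w)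
      \<bullet> pim X (FO M ((du (du Y))) # FO M ((du Y) \<odot>\<^bsub>C\<^esub> (du X)) # w) \<bullet> lw X (pim Y (FO M ((du Y) \<odot>\<^bsub>C\<^esub> (du X)) # w)) \<bullet> mu X Y (FO M ((du Y) \<odot>\<^bsub>C\<^esub> (du X)) # w)"
    by (simp add: evm_slide[OF dual_tensor_in_Hom] piv_tensor)
  also have "\<dots> = evm (du X) w \<bullet> (lw (du (du X)) (evm (du Y) (FO M (du X) # w)) \<bullet> lw (du (du X)) (lw ((du (du Y))) (mu (du Y) (du X) w))
      \<bullet> pim X (FO M ((du (du Y))) # FO M ((du Y) \<odot>\<^bsub>C\<^esub> (du X)) # w) \<bullet> lw X (pim Y (FO M ((du Y) \<odot>\<^bsub>C\<^esub> (du X)) # w))) \<bullet> mu X Y (FO M ((du Y) \<odot>\<^bsub>C\<^esub> (du X)) # w)"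
    by (simp add: evm_tensor piv_in_Hom)
  also have "\<dots> = evm (du X) w \<bullet> (pim X (FO M (du X) # w) \<bullet> lw X (evm (du Y) (FO M (du X) # w)
      \<bullet> (pim Y (FO M (du Y) # FO M (du X) # w) \<bullet> lw Y (mu (du Y) (du X) w)))) \<bullet> mu X Y (FO M ((du Y) \<odot>\<^bsub>C\<^esub> (du X)) # w)"
    by (simp add: nats')
  finally show ?thesis
    by (simp add: pevm_eq)
qed

text \<open>Capped off with \<open>pevm\<close> of the product, the right-hand side becomes two
  nested zigzags, which straighten one after the other.\<close>

lemma pcoevm_tensor:
  "pcoevm (X \<odot>\<^bsub>C\<^esub> Y) w = dtm X Y (FO M (X \<odot>\<^bsub>C\<^esub> Y) # w) \<bullet> mui (du Y) (du X) (FO M (X \<odot>\<^bsub>C\<^esub> Y) # w)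
    \<bullet> lw (du Y) (lw (du X) (mui X Y w)) \<bullet> lw (du Y) (pcoevm X (FO M Y # w)) \<bullet> pcoevm Y w"
proof (rule pevm_inj[of _ _ "X \<odot>\<^bsub>C\<^esub> Y" "FO M (X \<odot>\<^bsub>C\<^esub> Y) # w"])
  let ?P = "X \<odot>\<^bsub>C\<^esub> Y" and ?w = "FO M (X \<odot>\<^bsub>C\<^esub> Y) # w"
  have "pevm ?P ?w \<bullet> lw ?P (dtm X Y ?w \<bullet> mui (du Y) (du X) ?w
      \<bullet> lw (du Y) (lw (du X) (mui X Y w)) \<bullet> lw (du Y) (pcoevm X (FO M Y # w)) \<bullet> pcoevm Y w)
    = pevm X ?w \<bullet> lw X (pevm Y (FO M (du X) # ?w)) \<bullet> lw X (lw Y (lw (du Y) (lw (du X) (mui X Y w))))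
      \<bullet> lw X (lw Y (lw (du Y) (pcoevm X (FO M Y # w)))) \<bullet> lw X (lw Y (pcoevm Y w)) \<bullet> mu X Y w"
    by (simp add: pevm_tensor[THEN tgt.reassoc] mu_natural mu_natural[THEN tgt.reassoc])
  also have "\<dots> = mui X Y w \<bullet> pevm X (FO M X # FO M Y # w) \<bullet> lw X (pcoevm X (FO M Y # w))
      \<bullet> lw X (pevm Y (FO M Y # w) \<bullet> lw Y (pcoevm Y w)) \<bullet> mu X Y w"
    by (simp add: nats')
  also have "\<dots> = tgt.idn ?w"
    by (simp only: zig_pev') (simp add: zigs')
  finally show "pevm ?P ?w \<bullet> lw ?P (pcoevm ?P w) = pevm ?P ?w \<bullet> lw ?P (dtm X Y ?w \<bullet> mui (du Y) (du X) ?w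
      \<bullet> lw (du Y) (lw (du X) (mui X Y w)) \<bullet> lw (du Y) (pcoevm X (FO M Y # w)) \<bullet> pcoevm Y w)"
    by (simp add: zig_pev')
qed (simp_all add: dual_tensor_in_Hom)

end

context pivotal_action
begin

subsection \<open>Loops\<close>

definition loop where "loop X w = evm X w \<bullet> pcoevm X w"

lemma loop_simps [simp]: "adom (loop X w) = w" "acod (loop X w) = w" "tgt.ok (loop X w)"
  by (simp_all add: loop_def)

lemma loop_natural: "acod h = w \<Longrightarrow> loop X w \<bullet> h = h \<bullet> loop X (adom h)"
  by (simp add: loop_def nats')

text \<open>Insert \<open>f\<close> after \<open>g\<close> on the strand of \<open>Y\<close> and
  slide \<open>f\<close> all the way around the loop; it meets \<open>g\<close> from the other side
  and cancels.\<close>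

lemma loop_iso:
  assumes "inverse_pair C X Y f g"
  shows "loop X w = loop Y w"
proof -
  have f: "f \<in> Hom C X Y" and g: "g \<in> Hom C Y X"
    using assms by (auto simp: inverse_pair_def)
  have "loop Y w = (evm Y w \<bullet> lw (du Y) (mop X f Y w)) \<bullet> lw (du Y) (mop Y g X w) \<bullet> pcoevm Y w"
    by (simp add: loop_def mop_inverse(1)[OF assms, THEN tgt.wl2_id, THEN tgt.reassoc])
  also have "\<dots> = evm X w \<bullet> lw (du X) (mop Y g X w) \<bullet> (mop (du Y) (dual_mor C X Y f) (du X) (FO M Y # w) \<bullet> pcoevm Y w)"
    by (simp add: evm_slide[OF f] mop_natural[THEN tgt.reassoc])
  also have "\<dots> = loop X w"
    by (simp add: pcoevm_slide[OF f, symmetric] loop_def mop_inverse(2)[OF assms, THEN tgt.wl2_id, THEN tgt.reassoc])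
  finally show ?thesis ..
qed

lemma loop_tensor: "loop (X \<odot>\<^bsub>C\<^esub> Y) w = evm Y w \<bullet> lw (du Y) (loop X (FO M Y # w)) \<bullet> pcoevm Y w"
  by (simp add: loop_def pcoevm_tensor evm_tensor[THEN tgt.reassoc])

section \<open>The loop of the unit, and the pivotal structure of dual objects\<close>

context
begin

text \<open>Cups and caps of the unit object with its own letter erased, so that they add or remove
  the single letter of the dual unit. The arrows \<open>pe\<close> and \<open>pk\<close> turn out to
  be mutually inverse, and \<open>k\<close> to be a left inverse of \<open>e\<close>.\<close>

private definition "e = (\<lambda>w. evm \<one>\<^bsub>C\<^esub> w \<bullet> lw (du \<one>\<^bsub>C\<^esub>) (mei w))"
private definition "k = (\<lambda>w. me (FO M (du \<one>\<^bsub>C\<^esub>) # w) \<bullet> coevm \<one>\<^bsub>C\<^esub> w)"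
private definition "pe = (\<lambda>w. pevm \<one>\<^bsub>C\<^esub> w \<bullet> mei (FO M (du \<one>\<^bsub>C\<^esub>) # w))"
private definition "pk = (\<lambda>w. lw (du \<one>\<^bsub>C\<^esub>) (me w) \<bullet> pcoevm \<one>\<^bsub>C\<^esub> w)"

private lemma unit_simps [simp]:
  "adom (e w) = FO M (du \<one>\<^bsub>C\<^esub>) # w" "acod (e w) = w" "tgt.ok (e w)"
  "adom (k w) = w" "acod (k w) = FO M (du \<one>\<^bsub>C\<^esub>) # w" "tgt.ok (k w)"
  "adom (pe w) = FO M (du \<one>\<^bsub>C\<^esub>) # w" "acod (pe w) = w" "tgt.ok (pe w)"
  "adom (pk w) = w" "acod (pk w) = FO M (du \<one>\<^bsub>C\<^esub>) # w" "tgt.ok (pk w)"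
  by (simp_all add: e_def k_def pe_def pk_def)

private lemma e_natural: "acod h = w \<Longrightarrow> e w \<bullet> lw (du \<one>\<^bsub>C\<^esub>) h = h \<bullet> e (adom h)"
  by (simp add: e_def mei_natural[THEN tgt.wl2] nats')

private lemma pk_natural: "acod h = w \<Longrightarrow> pk w \<bullet> h = lw (du \<one>\<^bsub>C\<^esub>) h \<bullet> pk (adom h)"
  by (simp add: pk_def me_natural[THEN tgt.wl2, THEN tgt.reassoc] nats')

private lemma k_e: "k w \<bullet> e w = tgt.idn (FO M (du \<one>\<^bsub>C\<^esub>) # w)"
proof -
  have "k w \<bullet> e w = e (FO M (du \<one>\<^bsub>C\<^esub>) # w) \<bullet> lw (du \<one>\<^bsub>C\<^esub>) (k w)"
    by (simp add: e_natural)
  then show ?thesis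
    by (simp add: e_def k_def zigs')
qed

private lemma pe_pk: "pe w \<bullet> pk w = tgt.idn w"
proof -
  have "pe w \<bullet> pk w = me w \<bullet> (pevm \<one>\<^bsub>C\<^esub> (FO M \<one>\<^bsub>C\<^esub> # w) \<bullet> lw \<one>\<^bsub>C\<^esub> (pcoevm \<one>\<^bsub>C\<^esub> w)) \<bullet> mei w"
    by (simp add: pe_def pk_def mei_natural mei_natural[THEN tgt.reassoc] caps')
  then show ?thesis
    by (simp add: zig_pev')
qed

private lemma pk_pe: "pk w \<bullet> pe w = tgt.idn (FO M (du \<one>\<^bsub>C\<^esub>) # w)"
proof -
  have "pk w \<bullet> pe w = lw (du \<one>\<^bsub>C\<^esub>) (pe w) \<bullet> pk (FO M (du \<one>\<^bsub>C\<^esub>) # w)"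
    by (simp add: pk_natural)
  then show ?thesis
    by (simp add: pe_def pk_def zigs')
qed

text \<open>The loop of the unit is idempotent, as the unit is its own square, and invertible.\<close>

lemma loop_unit: "loop \<one>\<^bsub>C\<^esub> w = tgt.idn w"
proof -
  have "mei w \<bullet> (loop \<one>\<^bsub>C\<^esub> w \<bullet> me w) = mei w \<bullet> (me w \<bullet> loop \<one>\<^bsub>C\<^esub> (FO M \<one>\<^bsub>C\<^esub> # w))"
    by (simp add: loop_natural)
  then have "loop \<one>\<^bsub>C\<^esub> (FO M \<one>\<^bsub>C\<^esub> # w) = lw \<one>\<^bsub>C\<^esub> (loop \<one>\<^bsub>C\<^esub> w)"
    by (simp add: mei_natural[THEN tgt.reassoc])
  then have "loop (\<one>\<^bsub>C\<^esub> \<odot>\<^bsub>C\<^esub> \<one>\<^bsub>C\<^esub>) w = loop \<one>\<^bsub>C\<^esub> w \<bullet> loop \<one>\<^bsub>C\<^esub> w"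
    by (simp add: loop_tensor evm_natural[THEN tgt.reassoc]) (simp add: loop_def)
  then have "loop \<one>\<^bsub>C\<^esub> w = loop \<one>\<^bsub>C\<^esub> w \<bullet> loop \<one>\<^bsub>C\<^esub> w"
    using loop_iso[OF src.inv_mor_pair[OF src.lunit_iso[of "\<one>\<^bsub>C\<^esub>"]]] by simp
  moreover have "pe w \<bullet> k w \<bullet> loop \<one>\<^bsub>C\<^esub> w = tgt.idn w"
  proof -
    have "loop \<one>\<^bsub>C\<^esub> w = e w \<bullet> pk w"
      by (simp add: e_def pk_def loop_def)
    then show ?thesis
      by (simp add: tgt.reassoc[OF k_e] pe_pk)
  qed
  ultimately show ?thesis
    by (metis tgt.cmp_assoc tgt.id_cmp loop_simps(2,3))
qed

text \<open>Triviality of the unit loop says that \<open>e\<close> is a left inverse of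
  \<open>pk\<close>, whose two-sided inverse is \<open>pe\<close>. Hence the left and right
  evaluations of the unit agree.\<close>

private lemma e_eq_pe: "e w = pe w"
proof -
  have "e w \<bullet> pk w = tgt.idn w"
    using loop_unit by (simp add: e_def pk_def loop_def)
  then have "(e w \<bullet> pk w) \<bullet> pe w = pe w"
    by simp
  then show ?thesis
    by (simp add: pk_pe)
qed

text \<open>The dual of an evaluation is a coevaluation, up to the identification of the dual of a
  product and the removal of the dual unit. Both sides have the same composite with the cap
  \<open>evm ?P\<close>, which determines them.\<close>

private lemma mop_dual_ev:
  "mop (du \<one>\<^bsub>C\<^esub>) (dual_mor C (du X \<odot>\<^bsub>C\<^esub> X) \<one>\<^bsub>C\<^esub> (ev\<^bsub>C\<^esub> X)) (du (du X \<odot>\<^bsub>C\<^esub> X)) u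
    = dtm (du X) X u \<bullet> mui (du X) (du (du X)) u \<bullet> coevm (du X) u \<bullet> e u"
proof -
  let ?P = "du X \<odot>\<^bsub>C\<^esub> X"
  let ?F = "\<lambda>u. mop (du \<one>\<^bsub>C\<^esub>) (dual_mor C ?P \<one>\<^bsub>C\<^esub> (ev\<^bsub>C\<^esub> X)) (du ?P) u"
  let ?G = "\<lambda>u. dtm (du X) X u \<bullet> mui (du X) (du (du X)) u \<bullet> coevm (du X) u \<bullet> e u"
  \<comment> \<open>An arrow that commutes with creating the cup of \<open>?P\<close> to its right
    is recovered from its composite with the cap by a zigzag.\<close>
  have ex: "F u = evm ?P (FO M (du ?P) # u) \<bullet> F (FO M ?P # FO M (du ?P) # u) \<bullet> lw (du \<one>\<^bsub>C\<^esub>) (coevm ?P u)"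
    if "tgt.ok (F u)" "acod (F u) = FO M (du ?P) # u"
      "lw (du ?P) (coevm ?P u) \<bullet> F u = F (FO M ?P # FO M (du ?P) # u) \<bullet> lw (du \<one>\<^bsub>C\<^esub>) (coevm ?P u)"
    for F
  proof -
    have "F u = (evm ?P (FO M (du ?P) # u) \<bullet> lw (du ?P) (coevm ?P u)) \<bullet> F u"
      using that by (simp add: zig_ev')
    then show ?thesis
      using that by simp
  qed
  have F: "evm ?P v \<bullet> ?F (FO M ?P # v) = evm X v \<bullet> mu (du X) X v \<bullet> e (FO M ?P # v)" for v
  proof -
    have "evm X v \<bullet> mu (du X) X v \<bullet> e (FO M ?P # v)
      = e v \<bullet> lw (du \<one>\<^bsub>C\<^esub>) (evm X v \<bullet> mu (du X) X v)"
      by (simp add: e_natural e_natural[THEN tgt.reassoc])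
    then show ?thesis
      by (simp add: evm_slide[OF src.ev_in_Hom, symmetric] e_def)
         (simp add: evm_def capm_def src.ev_in_Hom)
  qed
  have G: "evm ?P v \<bullet> ?G (FO M ?P # v) = evm X v \<bullet> mu (du X) X v \<bullet> e (FO M ?P # v)" for v
  proof -
    have "evm ?P v \<bullet> ?G (FO M ?P # v) = evm X v \<bullet> (lw (du X) (evm (du X) (FO M X # v)) \<bullet> coevm (du X) (FO M (du X) # FO M X # v))
      \<bullet> mu (du X) X v \<bullet> e (FO M ?P # v)"
      by (simp add: evm_tensor[THEN tgt.reassoc] coevm_natural[THEN tgt.reassoc])
    then show ?thesis
      by (simp add: zig_ev)
  qed
  have "?F u = evm ?P (FO M (du ?P) # u) \<bullet> ?F (FO M ?P # FO M (du ?P) # u) \<bullet> lw (du \<one>\<^bsub>C\<^esub>) (coevm ?P u)"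
    by (rule ex) (simp_all add: dual_mor_in_Hom src.ev_in_Hom mop_natural)
  moreover have "?G u = evm ?P (FO M (du ?P) # u) \<bullet> ?G (FO M ?P # FO M (du ?P) # u) \<bullet> lw (du \<one>\<^bsub>C\<^esub>) (coevm ?P u)"
    by (rule ex)
       (simp_all add: dual_tensor_in_Hom e_natural coevm_natural[of "coevm ?P u" _ "du X", OF refl, simplified, THEN tgt.reassoc]
         mop_natural[THEN tgt.reassoc] mui_natural[THEN tgt.reassoc])
  ultimately show ?thesis
    by (metis F G tgt.cmp_assoc)
qed

text \<open>In other words, the pivotal structure of the dual of X is inverse to the dual of the
  pivotal structure of X. Sliding \<open>ev X\<close> around the cap of
  \<open>du X \<odot> X\<close> reduces this to the unit object, where \<open>e_eq_pe\<close>
  settles it.\<close>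

lemma pevm_pim: "pevm (du X) w \<bullet> lw (du X) (pim X w) = evm X w"
proof -
  let ?P = "du X \<odot>\<^bsub>C\<^esub> X" and ?u = "FO M (du \<one>\<^bsub>C\<^esub>) # w"
  \<comment> \<open>A zigzag of \<open>du X\<close> is inserted so that the caps become the nested
    caps of \<open>?P\<close>, to which \<open>pevm_tensor\<close> applies.\<close>
  have "pevm (du X) w \<bullet> lw (du X) (pim X w) \<bullet> lw (du X) (lw X (e w)) \<bullet> mu (du X) X ?u
    = pevm (du X) w \<bullet> lw (du X) ((evm (du X) (FO M (du (du X)) # w) \<bullet> lw (du (du X)) (coevm (du X) w)) \<bullet> pim X w)
       \<bullet> lw (du X) (lw X (e w)) \<bullet> mu (du X) X ?u"
    by (simp only: zig_ev') (simp add: piv_in_Hom)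
  also have "\<dots> = pevm (du X) w \<bullet> lw (du X) (pevm X (FO M (du (du X)) # w)) \<bullet> lw (du X) (lw X (coevm (du X) w \<bullet> e w)) \<bullet> mu (du X) X ?u"
    by (simp add: pevm_eq mop_natural[THEN tgt.wl2, THEN tgt.reassoc])
  also have "\<dots> = (pevm ?P w \<bullet> lw ?P (dtm (du X) X w)) \<bullet> lw ?P (mui (du X) (du (du X)) w \<bullet> coevm (du X) w \<bullet> e w)"
    by (simp add: pevm_tensor mu_natural mu_natural[THEN tgt.reassoc])
  also have "\<dots> = pevm ?P w \<bullet> lw ?P (mop (du \<one>\<^bsub>C\<^esub>) (dual_mor C ?P \<one>\<^bsub>C\<^esub> (ev\<^bsub>C\<^esub> X)) (du ?P) w)"
    by (simp add: mop_dual_ev)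
  also have "\<dots> = pevm \<one>\<^bsub>C\<^esub> w \<bullet> mop ?P (ev\<^bsub>C\<^esub> X) \<one>\<^bsub>C\<^esub> ?u"
    by (simp add: pevm_slide src.ev_in_Hom)
  also have "\<dots> = pe w \<bullet> evm X ?u \<bullet> mu (du X) X ?u"
    by (simp add: pe_def evm_def capm_def src.ev_in_Hom)
  also have "\<dots> = evm X w \<bullet> lw (du X) (lw X (e w)) \<bullet> mu (du X) X ?u"
    by (simp add: evm_natural[THEN tgt.reassoc] e_eq_pe)
  finally have "(pevm (du X) w \<bullet> lw (du X) (pim X w) \<bullet> lw (du X) (lw X (e w)) \<bullet> mu (du X) X ?u)
      \<bullet> mui (du X) X ?u \<bullet> lw (du X) (lw X (pk w))
    = (evm X w \<bullet> lw (du X) (lw X (e w)) \<bullet> mu (du X) X ?u) \<bullet> mui (du X) X ?u \<bullet> lw (du X) (lw X (pk w))"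
    by simp
  moreover have "lw (du X) (lw X (e w)) \<bullet> lw (du X) (lw X (pk w)) = tgt.idn (FO M (du X) # FO M X # w)"
    by (simp add: e_eq_pe pe_pk flip: tgt.wl_cmp)
  ultimately show ?thesis
    by (simp add: piv_in_Hom)
qed

end

text \<open>Write \<open>v\<close> as the evaluation of \<open>Y\<close> after the transpose
  \<open>t\<close>. Sliding \<open>t\<close> once around the picture leaves a pivotal structure map
  of \<open>Y\<close>, and \<open>pevm_pim\<close> is what makes the two ways of closing up differ
  by exactly that map.\<close>

lemma rotation:
  assumes "v \<in> Hom C (X \<odot>\<^bsub>C\<^esub> Y) \<one>\<^bsub>C\<^esub>"
  shows "evm X w \<bullet> lw (du X) (capm v X Y (FO M X # w)) \<bullet> pcoevm X (FO M Y # FO M X # w)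
    = pevm Y w \<bullet> lw Y (capm v X Y (FO M (du Y) # w)) \<bullet> lw Y (lw X (coevm Y w))"
proof -
  define t where "t = dual_transpose C X Y v"
  have t: "t \<in> Hom C X (du Y)"
    unfolding t_def by (rule dual_transpose_in_Hom[OF assms])
  have cap: "capm v X Y u = evm Y u \<bullet> mop X t (du Y) (FO M Y # u)" for u
    unfolding t_def by (rule evm_dual_transpose[OF assms, symmetric])
  have "evm X w \<bullet> lw (du X) (capm v X Y (FO M X # w)) \<bullet> pcoevm X (FO M Y # FO M X # w)
    = evm X w \<bullet> lw (du X) (evm Y (FO M X # w)) \<bullet> mop (du (du Y)) (dual_mor C X (du Y) t) (du X) (FO M (du Y) # FO M Y # FO M X # w)
        \<bullet> pcoevm (du Y) (FO M Y # FO M X # w)"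
    by (simp add: cap pcoevm_slide[OF t])
  also have "\<dots> = (evm X w \<bullet> mop (du (du Y)) (dual_mor C X (du Y) t) (du X) (FO M X # w)) \<bullet> lw (du (du Y)) (evm Y (FO M X # w))
        \<bullet> pcoevm (du Y) (FO M Y # FO M X # w)"
    by (simp add: mop_natural[THEN tgt.reassoc])
  also have "\<dots> = evm (du Y) w \<bullet> lw (du (du Y)) (mop X t (du Y) w)
        \<bullet> lw (du (du Y)) (pevm (du Y) (FO M X # w)) \<bullet> (lw (du (du Y)) (lw (du Y) (pim Y (FO M X # w))) \<bullet> pcoevm (du Y) (FO M Y # FO M X # w))"
    by (simp add: evm_slide[OF t, symmetric] pevm_pim[of Y "FO M X # w", symmetric])
  also have "\<dots> = evm (du Y) w \<bullet> (lw (du (du Y)) (mop X t (du Y) w) \<bullet> pim Y (FO M X # w))"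
    by (simp add: pcoevm_natural[of "pim Y (FO M X # w)" _ "du Y", OF refl, symmetric, simplified] zigs' piv_in_Hom)
  also have "\<dots> = pevm Y w \<bullet> lw Y (mop X t (du Y) w)"
    by (simp add: mop_natural pevm_eq)
  finally show ?thesis
    by (simp add: t_def mop_dual_transpose[OF assms])
qed

end

section \<open>The identity functor and preservation of the pivotal structure\<close>

text \<open>Specialises the calculus of a functor to that of one category: to \<open>D\<close> for
  rotating the vector, and to \<open>C\<close> for dimensions, bent bases and twist scalars.\<close>

definition idf :: "('o, 'm::ab_group_add, 'k::field, 'z) mon_cat_scheme \<Rightarrow> ('o, 'm, 'o, 'm) mon_fun" where
  "idf C = \<lparr>FO = (\<lambda>X. X), FM = (\<lambda>f. f), FTens = (\<lambda>X Y. \<iota>\<^bsub>C\<^esub> (X \<odot>\<^bsub>C\<^esub> Y)), FUnit = \<iota>\<^bsub>C\<^esub> \<one>\<^bsub>C\<^esub>\<rparr>"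

lemma idf_simps:
  "FO (idf C) X = X" "FM (idf C) f = f" "FTens (idf C) X Y = \<iota>\<^bsub>C\<^esub> (X \<odot>\<^bsub>C\<^esub> Y)" "FUnit (idf C) = \<iota>\<^bsub>C\<^esub> \<one>\<^bsub>C\<^esub>"
  by (simp_all add: idf_def)

context monoidal_category
begin

lemma id_pair: "inverse_pair C X X (\<iota> X) (\<iota> X)"
  by (simp add: inverse_pair_def id_in_Hom comp_id[OF id_in_Hom])

lemma idf_monoidal_functor: "monoidal_functor C C (idf C)"
proof unfold_locales
  fix X Y Z X' Y' f g
  show "is_iso C (FO (idf C) X \<odot> FO (idf C) Y) (FO (idf C) (X \<odot> Y)) (FTens (idf C) X Y)"
    "is_iso C \<one> (FO (idf C) \<one>) (FUnit (idf C))"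
    using id_pair by (auto simp: idf_simps is_iso_def)
  show "FTens (idf C) X' Y' \<cdot> (FM (idf C) f \<otimes> FM (idf C) g) = FM (idf C) (f \<otimes> g) \<cdot> FTens (idf C) X Y"
    if "f \<in> Hom C X X'" "g \<in> Hom C Y Y'"
    using tensor_in_Hom[OF that] by (simp add: idf_simps comp_id id_comp)
  show "FM (idf C) (\<a> X Y Z) \<cdot> FTens (idf C) (X \<odot> Y) Z \<cdot> (FTens (idf C) X Y \<otimes> \<iota> (FO (idf C) Z))
    = FTens (idf C) X (Y \<odot> Z) \<cdot> (\<iota> (FO (idf C) X) \<otimes> FTens (idf C) Y Z) \<cdot> \<a> (FO (idf C) X) (FO (idf C) Y) (FO (idf C) Z)"
    by (simp add: idf_simps tensor_id comp_id[OF id_in_Hom] comp_id[OF assoc_in_Hom] id_comp[OF assoc_in_Hom])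
  show "FM (idf C) (\<l> X) \<cdot> FTens (idf C) \<one> X \<cdot> (FUnit (idf C) \<otimes> \<iota> (FO (idf C) X)) = \<l> (FO (idf C) X)"
    by (simp add: idf_simps tensor_id comp_id[OF lunit_in_Hom])
  show "FM (idf C) (\<r> X) \<cdot> FTens (idf C) X \<one> \<cdot> (\<iota> (FO (idf C) X) \<otimes> FUnit (idf C)) = \<r> (FO (idf C) X)"
    by (simp add: idf_simps tensor_id comp_id[OF runit_in_Hom])
qed (auto simp: idf_simps)

end

lemma (in pivotal_category) idf_pivotal_action: "pivotal_action C C (idf C)"
  using idf_monoidal_functor pivotal_category_axioms
  by (simp add: pivotal_action_def)

lemma (in monoidal_category) idf_coherence:
  "monoidal_functor.mu C C (idf C) X Y w = asc X Y w"
  "monoidal_functor.mui C C (idf C) X Y w = asci X Y w"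
  "monoidal_functor.me C C (idf C) w = lun w"
  "monoidal_functor.mei C C (idf C) w = luni w"
  "monoidal_functor.mop C (idf C) X f Y w = opr X f Y w"
proof -
  interpret self: monoidal_functor C C "idf C"
    by (rule idf_monoidal_functor)
  have "FTens_inv C C (idf C) X Y = \<iota> (X \<odot> Y)" "FUnit_inv C C (idf C) = \<iota> \<one>"
    by (auto simp: FTens_inv_def FUnit_inv_def idf_simps intro: inv_mor_eqI id_pair)
  then show "self.mu X Y w = asc X Y w" "self.mui X Y w = asci X Y w" "self.me w = lun w"
    "self.mei w = luni w" "self.mop X f Y w = opr X f Y w"
    by (simp_all add: self.mu_def self.mui_def self.me_def self.mei_def self.mop_def idf_simps)
qed

sublocale pivotal_functor \<subseteq> pivotal_action C D M
  by unfold_locales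

context pivotal_functor
begin

text \<open>Here \<open>v\<close> is an arbitrary morphism of \<open>D\<close>, so
  \<open>rotation\<close> can only be applied with the duals of \<open>D\<close>. The comparison
  maps \<open>phi\<close> carry the cups and caps of \<open>C\<close> to those of \<open>D\<close>
  and cancel in each rotated picture.\<close>

lemma functor_rotation:
  assumes v: "v \<in> Hom D (FO M X \<odot>\<^bsub>D\<^esub> FO M Y) \<one>\<^bsub>D\<^esub>"
    and V: "\<And>w. V w = tgt.lun w \<bullet> tgt.opr (FO M X \<odot>\<^bsub>D\<^esub> FO M Y) v \<one>\<^bsub>D\<^esub> w \<bullet> tgt.asci (FO M X) (FO M Y) w"
  shows "evm X w \<bullet> lw (du X) (V (FO M X # w)) \<bullet> pcoevm X (FO M Y # FO M X # w)
    = pevm Y w \<bullet> lw Y (V (FO M (du Y) # w)) \<bullet> lw Y (lw X (coevm Y w))"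
proof -
  interpret T: pivotal_action D D "idf D"
    by (rule tgt.idf_pivotal_action)
  note coh = tgt.idf_coherence
  let ?d = "\<lambda>X. dual\<^bsub>D\<^esub> (FO M X)"
  define phi where "phi = (\<lambda>X w. tgt.opr (FO M (du X)) (dual_comparison C D M X) (?d X) w)"
  let ?c = "\<lambda>X. FUnit_inv C D M \<cdot>\<^bsub>D\<^esub> FM M (ev\<^bsub>C\<^esub> X) \<cdot>\<^bsub>D\<^esub> FTens M (du X) X"
  have c: "?c X \<in> Hom D (FO M (du X) \<odot>\<^bsub>D\<^esub> FO M X) \<one>\<^bsub>D\<^esub>" for X
    by (rule tgt.comp_in_Hom FTens_in_Hom FM_in_Hom src.ev_in_Hom FUnit_inv_in_Hom)+
  have dc: "dual_comparison C D M X \<in> Hom D (FO M (du X)) (?d X)" for X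
    unfolding dual_comparison_def by (rule T.dual_transpose_in_Hom[OF c])
  have phi [simp]: "adom (phi X w) = FO M (du X) # w" "acod (phi X w) = ?d X # w" "tgt.ok (phi X w)" for X w
    by (simp_all add: phi_def dc)
  have phi_nat: "phi X w \<bullet> lw (du X) h = tgt.wl (?d X) h \<bullet> phi X (adom h)" if "acod h = w" for X w h
    unfolding phi_def by (rule tgt.opr_natural[OF that])
  have capc: "T.capm (?c X) (FO M (du X)) (FO M X) w = evm X w" for X w
    by (simp add: T.capm_def coh evm_def capm_def me_def mui_def mop_def idf_simps
        tgt.opr_comp[OF FTens_in_Hom tgt.comp_in_Hom[OF FM_in_Hom[OF src.ev_in_Hom] FUnit_inv_in_Hom]]
        tgt.comp_assoc[OF FTens_in_Hom FM_in_Hom[OF src.ev_in_Hom] FUnit_inv_in_Hom]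
        tgt.opr_comp[OF tgt.comp_in_Hom[OF FTens_in_Hom FM_in_Hom[OF src.ev_in_Hom]] FUnit_inv_in_Hom]
        tgt.opr_comp[OF FTens_in_Hom FM_in_Hom[OF src.ev_in_Hom]])
  have ev: "evm X w = T.evm (FO M X) w \<bullet> phi X (FO M X # w)" for X w
    using T.evm_dual_transpose[OF c, of X w] unfolding capc
    by (simp add: dual_comparison_def phi_def coh idf_simps)
  \<comment> \<open>The caps for the right evaluation contain the pivotal structures of both
    categories; their compatibility is the hypothesis \<open>preserves_piv\<close>.\<close>
  have pev: "pevm X w = T.pevm (FO M X) w \<bullet> lw X (phi X w)" for X w
  proof -
    note h = FM_in_Hom[OF piv_in_Hom] T.piv_in_Hom T.dual_mor_in_Hom[OF dc]
    have "tgt.opr (FO M X) (dual_comparison C D M (du X) \<cdot>\<^bsub>D\<^esub> FM M (\<pi>\<^bsub>C\<^esub> X)) (?d (du X)) u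
      = tgt.opr (FO M X) (dual_mor D (FO M (du X)) (?d X) (dual_comparison C D M X) \<cdot>\<^bsub>D\<^esub> \<pi>\<^bsub>D\<^esub> (FO M X)) (?d (du X)) u" for u
      by (simp only: preserves_piv)
    then have eq: "phi (du X) u \<bullet> pim X u
      = T.mop (dual\<^bsub>D\<^esub> (?d X)) (dual_mor D (FO M (du X)) (?d X) (dual_comparison C D M X)) (?d (du X)) u \<bullet> T.pim (FO M X) u" for u
      by (simp add: tgt.opr_comp[OF h(1) dc] tgt.opr_comp[OF h(2,3)] phi_def mop_def coh)
    have "pevm X w = T.evm (FO M (du X)) w \<bullet> (phi (du X) (FO M (du X) # w) \<bullet> pim X (FO M (du X) # w))"
      by (simp add: pevm_eq ev)
    also have "\<dots> = (T.evm (?d X) w \<bullet> tgt.wl (dual\<^bsub>D\<^esub> (?d X)) (phi X w)) \<bullet> T.pim (FO M X) (FO M (du X) # w)"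
      using T.evm_slide[OF dc, of X w] unfolding eq by (simp add: phi_def coh idf_simps)
    also have "\<dots> = T.pevm (FO M X) w \<bullet> lw X (phi X w)"
      using T.mop_natural[of "phi X w" "?d X # w" "FO M X" "\<pi>\<^bsub>D\<^esub> (FO M X)"]
      by (simp add: T.pevm_eq idf_simps)
    finally show ?thesis .
  qed
  \<comment> \<open>Caps determine cups by the zigzag identities, so the comparison for cups follows
    from that for caps; likewise for \<open>pcoev\<close>.\<close>
  have coev: "T.coevm (FO M X) w = lw X (phi X w) \<bullet> coevm X w" for X w
  proof -
    have "T.coevm (FO M X) w = (lw X (evm X (?d X # w)) \<bullet> coevm X (FO M X # ?d X # w)) \<bullet> T.coevm (FO M X) w"
      by (simp add: zig_ev) (simp add: idf_simps)
    also have "\<dots> = lw X (T.evm (FO M X) (?d X # w) \<bullet> (phi X (FO M X # ?d X # w) \<bullet> lw (du X) (T.coevm (FO M X) w))) \<bullet> coevm X w"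
      by (simp add: coevm_natural idf_simps) (simp add: ev)
    also have "\<dots> = lw X ((T.evm (FO M X) (?d X # w) \<bullet> tgt.wl (?d X) (T.coevm (FO M X) w)) \<bullet> phi X w) \<bullet> coevm X w"
      by (subst phi_nat) (simp_all add: idf_simps)
    finally show ?thesis
      using T.zig_ev'[of "FO M X" w, THEN tgt.wl2_id, of "FO M X", THEN tgt.reassoc] by (simp add: idf_simps)
  qed
  have pcoev: "T.pcoevm (FO M X) w = phi X (FO M X # w) \<bullet> pcoevm X w" for X w
  proof -
    have "T.pcoevm (FO M X) w = tgt.wl (?d X) (pevm X (FO M X # w) \<bullet> lw X (pcoevm X w)) \<bullet> T.pcoevm (FO M X) w"
      by (simp only: zig_pev') (simp add: idf_simps)
    also have "\<dots> = tgt.wl (?d X) (pevm X (FO M X # w)) \<bullet> T.pcoevm (FO M X) (FO M (du X) # FO M X # w) \<bullet> pcoevm X w"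
      using T.pcoevm_natural[of "pcoevm X w" _ "FO M X", OF refl] by (simp add: idf_simps)
    also have "\<dots> = tgt.wl (?d X) (T.pevm (FO M X) (FO M X # w)) \<bullet> T.pcoevm (FO M X) (?d X # FO M X # w) \<bullet> phi X (FO M X # w) \<bullet> pcoevm X w"
      using T.pcoevm_natural[of "phi X (FO M X # w)" _ "FO M X", OF refl, THEN tgt.reassoc] by (simp add: pev idf_simps)
    finally show ?thesis
      using T.zig_pev[of "FO M X" "FO M X # w", THEN tgt.reassoc] by (simp add: idf_simps)
  qed
  have VT: "V u = T.capm v (FO M X) (FO M Y) u" for u
    by (simp add: V T.capm_def coh)
  have V_simps [simp]: "adom (V u) = FO M X # FO M Y # u" "acod (V u) = u" "tgt.ok (V u)" for u
    using v by (simp_all add: V)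
  have V_nat: "V u \<bullet> lw X (lw Y h) = h \<bullet> V (adom h)" if "acod h = u" for u h
    using T.capm_natural[OF that] by (simp add: VT idf_simps)
  have "evm X w \<bullet> lw (du X) (V (FO M X # w)) \<bullet> pcoevm X (FO M Y # FO M X # w)
    = T.evm (FO M X) w \<bullet> tgt.wl (?d X) (V (FO M X # w)) \<bullet> T.pcoevm (FO M X) (FO M Y # FO M X # w)"
    by (simp add: ev pcoev phi_nat[THEN tgt.reassoc])
  also have "\<dots> = T.pevm (FO M Y) w \<bullet> lw Y (V (?d Y # w)) \<bullet> lw Y (lw X (T.coevm (FO M Y) w))"
    using T.rotation[OF v, of w] by (simp add: VT idf_simps)
  also have "\<dots> = pevm Y w \<bullet> lw Y (V (FO M (du Y) # w)) \<bullet> lw Y (lw X (coevm Y w))"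
    by (simp add: coev pev V_nat[THEN tgt.wl2, THEN tgt.reassoc])
  finally show ?thesis .
qed

end

section \<open>Schur's lemma and decompositions into simple objects\<close>

context linear_category
begin

definition endo_pow :: "'m \<Rightarrow> 'o \<Rightarrow> nat \<Rightarrow> 'm" where
  "endo_pow f X n = ((\<cdot>) f ^^ n) (\<iota> X)"

text \<open>Evaluation of a polynomial at \<open>f\<close> in the endomorphism algebra of
  \<open>X\<close>, written out as a sum because that algebra is a subset of the type of
  morphisms.\<close>

definition endo_poly :: "'m \<Rightarrow> 'o \<Rightarrow> 'k poly \<Rightarrow> 'm" where
  "endo_poly f X p = (\<Sum>i\<le>degree p. coeff p i \<star> endo_pow f X i)"

lemma endo_pow_Suc: "endo_pow f X (Suc n) = f \<cdot> endo_pow f X n"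
  by (simp add: endo_pow_def)

lemma endo_pow_in_Hom: "f \<in> Hom C X X \<Longrightarrow> endo_pow f X n \<in> Hom C X X"
  by (induction n) (auto simp: endo_pow_def intro: id_in_Hom comp_in_Hom)

lemma endo_poly_in_Hom: "f \<in> Hom C X X \<Longrightarrow> endo_poly f X p \<in> Hom C X X"
  unfolding endo_poly_def by (intro sum_in_Hom scale_in_Hom endo_pow_in_Hom)

lemma endo_poly_bound:
  assumes "degree p \<le> n"
  shows "endo_poly f X p = (\<Sum>i\<le>n. coeff p i \<star> endo_pow f X i)"
  unfolding endo_poly_def using assms
  by (intro sum.mono_neutral_left) (auto simp: coeff_eq_0)

lemma endo_poly_factor:
  assumes "f \<in> Hom C X X"
  shows "endo_poly f X ([:- a, 1:] * q) = f \<cdot> endo_poly f X q - a \<star> endo_poly f X q"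
proof -
  have eq: "coeff ([:- a, 1:] * q) i = coeff (pCons 0 q) i - a * coeff q i" for i
    by simp
  have deg: "degree ([:- a, 1:] * q) \<le> Suc (degree q)"
    using degree_mult_le[of "[:- a, 1:]" q] by simp
  have "endo_poly f X ([:- a, 1:] * q)
    = (\<Sum>i\<le>Suc (degree q). (coeff (pCons 0 q) i - a * coeff q i) \<star> endo_pow f X i)"
    unfolding endo_poly_bound[OF deg] eq ..
  also have "\<dots> = (\<Sum>i\<le>Suc (degree q). coeff (pCons 0 q) i \<star> endo_pow f X i)
      - a \<star> (\<Sum>i\<le>Suc (degree q). coeff q i \<star> endo_pow f X i)"
    by (simp add: vs.scale_left_diff_distrib sum_subtractf vs.scale_sum_right vs.scale_right_distrib
        del: sum.atMost_Suc)
  also have "(\<Sum>i\<le>Suc (degree q). coeff q i \<star> endo_pow f X i) = endo_poly f X q"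
    by (rule endo_poly_bound[symmetric]) simp
  also have "(\<Sum>i\<le>Suc (degree q). coeff (pCons 0 q) i \<star> endo_pow f X i)
    = (\<Sum>i\<le>degree q. coeff q i \<star> (f \<cdot> endo_pow f X i))"
    by (simp add: sum.atMost_Suc_shift endo_pow_Suc del: sum.atMost_Suc)
  also have "\<dots> = (\<Sum>i\<le>degree q. f \<cdot> (coeff q i \<star> endo_pow f X i))"
    using comp_scale_right[OF endo_pow_in_Hom[OF assms] assms] by simp
  also have "\<dots> = f \<cdot> endo_poly f X q"
    unfolding endo_poly_def
    by (rule comp_sum_right[OF assms, where X = X, symmetric]) (intro scale_in_Hom endo_pow_in_Hom assms)
  finally show ?thesis .
qed

text \<open>The endomorphism space is spanned by \<open>card B\<close> elements, so it cannot
  contain \<open>card B + 1\<close> independent powers of \<open>f\<close>.\<close>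

lemma ex_annihilating_poly:
  assumes f: "f \<in> Hom C X X"
  shows "\<exists>p. p \<noteq> 0 \<and> endo_poly f X p = 0"
proof -
  obtain B where B: "finite B" "vs.span B = Hom C X X"
    using Hom_finite_dim by blast
  let ?n = "card B" and ?e = "endo_pow f X"
  show ?thesis
  proof (cases "inj_on ?e {..?n}")
    case True
    have "vs.dependent (?e ` {..?n})"
    proof (rule ccontr)
      assume "\<not> vs.dependent (?e ` {..?n})"
      then have "card (?e ` {..?n}) \<le> ?n"
        using vs.independent_span_bound[OF B(1)] B(2) endo_pow_in_Hom[OF f] by blast
      then show False
        using card_image[OF True] by simp
    qed
    then obtain u where u: "\<exists>v\<in>?e ` {..?n}. u v \<noteq> 0" "(\<Sum>v\<in>?e ` {..?n}. u v \<star> v) = 0"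
      using vs.dependent_finite[of "?e ` {..?n}"] by auto
    define p where "p = (\<Sum>i\<le>?n. monom (u (?e i)) i)"
    have cp: "coeff p i = (if i \<le> ?n then u (?e i) else 0)" for i
      unfolding p_def by (simp add: coeff_sum)
    have "degree p \<le> ?n"
      by (rule degree_le) (simp add: cp)
    then have "endo_poly f X p = (\<Sum>i\<le>?n. u (?e i) \<star> ?e i)"
      by (simp add: endo_poly_bound cp)
    also have "\<dots> = 0"
      using u(2) by (simp add: sum.reindex[OF True])
    finally have "endo_poly f X p = 0" .
    moreover have "p \<noteq> 0"
      using u(1) cp by (metis (mono_tags, lifting) atMost_iff coeff_0 imageE)
    ultimately show ?thesis
      by blast
  next
    \<comment> \<open>If two powers coincide, counting the set of powers gives no dependence; the
      difference of the two monomials annihilates \<open>f\<close> instead.\<close>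
    case False
    then obtain i j where ij: "?e i = ?e j" "i \<noteq> j"
      by (auto simp: inj_on_def)
    let ?p = "monom 1 i - monom 1 j :: 'k poly"
    have nz: "?p \<noteq> 0"
    proof
      assume "?p = 0"
      then have "coeff ?p i = 0"
        by simp
      with ij(2) show False
        by simp
    qed
    have "endo_poly f X ?p = (\<Sum>l\<le>max i j. coeff ?p l \<star> ?e l)"
      by (rule endo_poly_bound) (simp add: degree_diff_le degree_monom_eq)
    also have "\<dots> = (\<Sum>l\<le>max i j. (if l = i then ?e l else 0) - (if l = j then ?e l else 0))"
      by (rule sum.cong) (auto simp: vs.scale_left_diff_distrib)
    also have "\<dots> = 0"
      using ij(1) by (simp add: sum_subtractf)
    finally show ?thesis
      using nz by blast
  qed
qed

lemma simple_id_nonzero: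
  assumes "simple_object C X"
  shows "\<iota> X \<noteq> 0"
proof
  assume 0: "\<iota> X = 0"
  have "f = 0" if "f \<in> Hom C X Y" for f Y
    using comp_id[OF that] comp_zero_right[OF that] 0 by simp
  moreover have "f = 0" if "f \<in> Hom C Y X" for f Y
    using id_comp[OF that] comp_zero_left[OF that] 0 by simp
  ultimately have "zero_object C X"
    unfolding zero_object_def using zero_in_Hom by blast
  then show False
    using assms by (simp add: simple_object_def)
qed

lemma scale_id_inject:
  "simple_object C X \<Longrightarrow> a \<star> \<iota> X = b \<star> \<iota> X \<Longrightarrow> a = b"
  using simple_id_nonzero by simp

end

section \<open>Schur's lemma over an algebraically closed field\<close>

locale closed_semisimple_category = semisimple_category C
  for C :: "('o, 'm::ab_group_add, 'k::alg_closed_field, 'z) mon_cat_scheme" (structure)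
begin

text \<open>The kernel is a subobject of the simple object \<open>X\<close>, and not all of it since
  \<open>f\<close> is nonzero. Hence \<open>f\<close> is monic, and simplicity of \<open>Y\<close>,
  which is a condition on monics into it, makes \<open>f\<close> invertible.\<close>

lemma schur_iso:
  assumes X: "simple_object C X" and Y: "simple_object C Y"
    and f: "f \<in> Hom C X Y" "f \<noteq> 0"
  shows "is_iso C X Y f"
proof -
  obtain K i where K: "kernel_of C X Y f K i"
    using ex_kernel[OF f(1)] by blast
  then have i: "i \<in> Hom C K X" "f \<cdot> i = 0"
    and ker: "\<And>W h. h \<in> Hom C W X \<Longrightarrow> f \<cdot> h = 0 \<Longrightarrow> \<exists>!u. u \<in> Hom C W K \<and> i \<cdot> u = h"
    by (auto simp: kernel_of_def)
  have "monic C K X i"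
    unfolding monic_def
  proof (intro conjI allI ballI impI)
    fix W g h assume gh: "g \<in> Hom C W K" "h \<in> Hom C W K" "i \<cdot> g = i \<cdot> h"
    have "f \<cdot> (i \<cdot> g) = 0"
      using comp_assoc[OF gh(1) i(1) f(1)] i(2) comp_zero_left[OF gh(1)] by simp
    then show "g = h"
      using ker[OF comp_in_Hom[OF gh(1) i(1)]] gh by metis
  qed (rule i)
  then have "zero_object C K \<or> is_iso C K X i"
    using X by (auto simp: simple_object_def)
  moreover have "\<not> is_iso C K X i"
  proof
    assume iso: "is_iso C K X i"
    have "f = f \<cdot> (i \<cdot> inv_mor C K X i)"
      using inv_mor_right[OF iso] comp_id[OF f(1)] by simp
    also have "\<dots> = (f \<cdot> i) \<cdot> inv_mor C K X i"
      by (rule comp_assoc[OF inv_mor_in_Hom[OF iso] i(1) f(1), symmetric])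
    also have "\<dots> = 0"
      using i(2) comp_zero_left[OF inv_mor_in_Hom[OF iso]] by simp
    finally show False
      using f(2) by simp
  qed
  ultimately have K0: "zero_object C K"
    by simp
  have "monic C X Y f"
    unfolding monic_def
  proof (intro conjI allI ballI impI)
    fix W g h assume gh: "g \<in> Hom C W X" "h \<in> Hom C W X" "f \<cdot> g = f \<cdot> h"
    have "f \<cdot> g = f \<cdot> (g - h) + f \<cdot> h"
      using comp_add_right[OF diff_in_Hom[OF gh(1,2)] gh(2) f(1)] by simp
    then have "f \<cdot> (g - h) = 0"
      using gh(3) by simp
    then obtain u where u: "u \<in> Hom C W K" "i \<cdot> u = g - h"
      using ker[OF diff_in_Hom[OF gh(1,2)]] by blast
    have "u = 0"
      using u(1) K0 by (auto simp: zero_object_def)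
    then show "g = h"
      using u(2) comp_zero_right[OF i(1)] by simp
  qed (rule f)
  then have "zero_object C X \<or> is_iso C X Y f"
    using Y by (auto simp: simple_object_def)
  then show ?thesis
    using X by (auto simp: simple_object_def)
qed

text \<open>Split off a root \<open>a\<close> from an annihilating polynomial of least degree. By
  minimality the cofactor evaluated at \<open>f\<close> is nonzero, hence invertible, and
  \<open>f\<close> composed with it is \<open>a\<close> times it.\<close>

lemma schur_scalar:
  assumes X: "simple_object C X" and f: "f \<in> Hom C X X"
  shows "\<exists>k. f = k \<star> \<iota> X"
proof -
  obtain p where p: "p \<noteq> 0" "endo_poly f X p = 0"
    and min: "\<And>q. q \<noteq> 0 \<Longrightarrow> endo_poly f X q = 0 \<Longrightarrow> degree p \<le> degree q"
    using ex_has_least_nat[of "\<lambda>p. p \<noteq> 0 \<and> endo_poly f X p = 0" _ degree] ex_annihilating_poly[OF f]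
    by metis
  have "degree p > 0"
  proof (rule ccontr)
    assume d: "\<not> degree p > 0"
    then have "coeff p 0 \<star> \<iota> X = 0"
      using p(2) by (simp add: endo_poly_def endo_pow_def)
    then have "coeff p 0 = 0"
      using simple_id_nonzero[OF X] by simp
    then show False
      using p(1) d by (metis leading_coeff_0_iff neq0_conv)
  qed
  then obtain a where "poly p a = 0"
    using alg_closed_imp_poly_has_root by blast
  then obtain q where q: "p = [:- a, 1:] * q"
    by (metis poly_eq_0_iff_dvd dvdE)
  then have q0: "q \<noteq> 0"
    using p(1) by auto
  have "degree p = Suc (degree q)"
    unfolding q by (subst degree_mult_eq) (use q0 in auto)
  then have g0: "endo_poly f X q \<noteq> 0"
    using min[OF q0] by force
  let ?g = "endo_poly f X q"
  note g = endo_poly_in_Hom[OF f, of q]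
  have iso: "is_iso C X X ?g"
    by (rule schur_iso[OF X X g g0])
  have eq: "f \<cdot> ?g = a \<star> ?g"
    using p(2) endo_poly_factor[OF f, of a q] q by simp
  let ?h = "inv_mor C X X ?g"
  have "f = f \<cdot> (?g \<cdot> ?h)"
    using inv_mor_right[OF iso] comp_id[OF f] by simp
  also have "\<dots> = (a \<star> ?g) \<cdot> ?h"
    using comp_assoc[OF inv_mor_in_Hom[OF iso] g f] eq by simp
  also have "\<dots> = a \<star> \<iota> X"
    using comp_scale_left[OF inv_mor_in_Hom[OF iso] g] inv_mor_right[OF iso] by simp
  finally show ?thesis
    by blast
qed

section \<open>Dual bases and the resolution of the identity\<close>

context
  fixes A
  assumes A: "complete_set_of_simples C A"
begin

lemma simples: "S \<in> A \<Longrightarrow> simple_object C S"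
  using A by (auto simp: complete_set_of_simples_def)

lemma Hom_simples_zero:
  assumes "S \<in> A" "T \<in> A" "S \<noteq> T" "f \<in> Hom C S T"
  shows "f = 0"
proof (rule ccontr)
  assume "f \<noteq> 0"
  then have "isomorphic C S T"
    using schur_iso[OF simples simples] assms by (auto simp: isomorphic_def)
  then show False
    using A assms by (auto simp: complete_set_of_simples_def)
qed

lemma ex_decomposition:
  "\<exists>n S i p. (\<forall>j<n. S j \<in> A \<and> i j \<in> Hom C (S j) X \<and> p j \<in> Hom C X (S j)) \<and>
     (\<forall>j<n. \<forall>l<n. p j \<cdot> i l = (if j = l then \<iota> (S j) else 0)) \<and>
     (\<Sum>j<(n::nat). i j \<cdot> p j) = \<iota> X"
proof -
  obtain n S where S: "\<forall>j<n. simple_object C (S j)" "direct_sum C n S X"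
    using semisimple by blast
  then obtain i p where *: "\<forall>j<n. i j \<in> Hom C (S j) X \<and> p j \<in> Hom C X (S j)"
    "\<forall>j<n. \<forall>l<n. p j \<cdot> i l = (if j = l then \<iota> (S j) else 0)" "(\<Sum>j<n. i j \<cdot> p j) = \<iota> X"
    unfolding direct_sum_def by blast
  then have ip: "\<And>j. j < n \<Longrightarrow> i j \<in> Hom C (S j) X" "\<And>j. j < n \<Longrightarrow> p j \<in> Hom C X (S j)"
    "\<And>j l. j < n \<Longrightarrow> l < n \<Longrightarrow> p j \<cdot> i l = (if j = l then \<iota> (S j) else 0)"
    "(\<Sum>j<n. i j \<cdot> p j) = \<iota> X"
    by blast+
  have "\<exists>T f g. T \<in> A \<and> inverse_pair C T (S j) f g" if "j < n" for j
  proof -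
    have "simple_object C (S j)"
      using S(1) that by simp
    then obtain T where T: "T \<in> A" "isomorphic C (S j) T"
      using A by (metis complete_set_of_simples_def)
    obtain f g where "inverse_pair C T (S j) f g"
      using isomorphic_sym[OF T(2)] by (metis isomorphic_def is_iso_def)
    with T(1) show ?thesis
      by blast
  qed
  then have "\<exists>T f g. \<forall>j<n. T j \<in> A \<and> inverse_pair C (T j) (S j) (f j) (g j)"
    by metis
  then obtain T f g where Tfg: "\<forall>j<n. T j \<in> A \<and> inverse_pair C (T j) (S j) (f j) (g j)"
    by blast
  have T: "\<And>j. j < n \<Longrightarrow> T j \<in> A"
    and fg: "\<And>j. j < n \<Longrightarrow> f j \<in> Hom C (T j) (S j)" "\<And>j. j < n \<Longrightarrow> g j \<in> Hom C (S j) (T j)"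
      "\<And>j. j < n \<Longrightarrow> g j \<cdot> f j = \<iota> (T j)" "\<And>j. j < n \<Longrightarrow> f j \<cdot> g j = \<iota> (S j)"
    using Tfg by (simp_all add: inverse_pair_def)
  have 1: "(g j \<cdot> p j) \<cdot> (i l \<cdot> f l) = (if j = l then \<iota> (T j) else 0)" if "j < n" "l < n" for j l
  proof -
    have "(g j \<cdot> p j) \<cdot> (i l \<cdot> f l) = g j \<cdot> (p j \<cdot> (i l \<cdot> f l))"
      by (rule comp_assoc[OF comp_in_Hom[OF fg(1) ip(1)] ip(2) fg(2)]) (use that in auto)
    also have "p j \<cdot> (i l \<cdot> f l) = (p j \<cdot> i l) \<cdot> f l"
      by (rule comp_assoc[OF fg(1) ip(1) ip(2), symmetric]) (use that in auto)
    finally show ?thesis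
      using that fg ip(3) by (auto simp: id_comp[OF fg(1)] comp_zero_left[OF fg(1)] comp_zero_right[OF fg(2)])
  qed
  have 2: "(i j \<cdot> f j) \<cdot> (g j \<cdot> p j) = i j \<cdot> p j" if "j < n" for j
  proof -
    have "(i j \<cdot> f j) \<cdot> (g j \<cdot> p j) = i j \<cdot> (f j \<cdot> (g j \<cdot> p j))"
      by (rule comp_assoc[OF comp_in_Hom[OF ip(2) fg(2)] fg(1) ip(1)]) (use that in auto)
    also have "f j \<cdot> (g j \<cdot> p j) = (f j \<cdot> g j) \<cdot> p j"
      by (rule comp_assoc[OF ip(2) fg(2) fg(1), symmetric]) (use that in auto)
    finally show ?thesis
      using that fg by (simp add: id_comp[OF ip(2)])
  qed
  have 3: "T j \<in> A \<and> i j \<cdot> f j \<in> Hom C (T j) X \<and> g j \<cdot> p j \<in> Hom C X (T j)" if "j < n" for j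
    using T that comp_in_Hom[OF fg(1) ip(1)] comp_in_Hom[OF ip(2) fg(2)] by blast
  show ?thesis
    by (rule exI[of _ n], rule exI[of _ T], rule exI[of _ "\<lambda>j. i j \<cdot> f j"], rule exI[of _ "\<lambda>j. g j \<cdot> p j"])
       (use 1 2 3 ip(4) in auto)
qed

text \<open>In a decomposition of \<open>G\<close>, the inclusions of the summands equal to
  \<open>S\<close> form a basis with the projections as dual basis. They span because by Schur's
  lemma the remaining components of a morphism out of \<open>S\<close> vanish and these are
  scalars.\<close>

lemma ex_dual_bases:
  assumes S: "S \<in> A"
  shows "\<exists>Bd. dual_bases C S G Bd"
proof -
  obtain n T i p where T: "\<And>j. j < n \<Longrightarrow> T j \<in> A"
    and ip: "\<And>j. j < n \<Longrightarrow> i j \<in> Hom C (T j) G" "\<And>j. j < n \<Longrightarrow> p j \<in> Hom C G (T j)"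
      "\<And>j l. j < n \<Longrightarrow> l < n \<Longrightarrow> p j \<cdot> i l = (if j = l then \<iota> (T j) else 0)"
      "(\<Sum>j<(n::nat). i j \<cdot> p j) = \<iota> G"
    using ex_decomposition[of G] by blast
  let ?J = "{j. j < n \<and> T j = S}"
  \<comment> \<open>A basis is a set of morphisms, so distinct summands must have distinct
    inclusions; otherwise the identity of \<open>S\<close> would be zero.\<close>
  have inj: "inj_on i ?J"
  proof (rule inj_onI, rule ccontr)
    fix j l assume *: "j \<in> ?J" "l \<in> ?J" "i j = i l" "j \<noteq> l"
    then have "\<iota> S = 0"
      using ip(3)[of j j] ip(3)[of j l] by auto
    then show False
      using simple_id_nonzero[OF simples[OF S]] by simp
  qed
  define B where "B = i ` ?J"
  define d where "d = (\<lambda>b. p (inv_into ?J i b))"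
  have d: "d (i j) = p j" if "j \<in> ?J" for j
    using inv_into_f_f[OF inj that] by (simp add: d_def)
  have finB: "finite B"
    by (simp add: B_def)
  have B: "b \<in> Hom C S G" "d b \<in> Hom C G S" if "b \<in> B" for b
    using that ip d by (auto simp: B_def)
  have db: "d b \<cdot> b' = (if b = b' then \<iota> S else 0)" if "b \<in> B" "b' \<in> B" for b b'
  proof -
    from \<open>b \<in> B\<close> obtain j where j: "b = i j" "j \<in> ?J"
      unfolding B_def by (rule imageE)
    from \<open>b' \<in> B\<close> obtain l where l: "b' = i l" "l \<in> ?J"
      unfolding B_def by (rule imageE)
    note jl = j(2,1) l(2,1)
    have "i j = i l \<longleftrightarrow> j = l"
      using inj_on_eq_iff[OF inj jl(1,3)] .
    moreover have "d b \<cdot> b' = p j \<cdot> i l"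
      using d[OF jl(1)] jl by simp
    ultimately show ?thesis
      using ip(3)[of j l] jl by simp
  qed
  have "\<not> vs.dependent B"
  proof
    assume "vs.dependent B"
    then obtain u b where u: "b \<in> B" "u b \<noteq> 0" "(\<Sum>v\<in>B. u v \<star> v) = 0"
      using vs.dependent_finite[OF finB] by blast
    have "0 = d b \<cdot> (\<Sum>v\<in>B. u v \<star> v)"
      using u comp_zero_right[OF B(2)] by simp
    also have "\<dots> = (\<Sum>v\<in>B. d b \<cdot> (u v \<star> v))"
      by (rule comp_sum_right[OF B(2)[OF u(1)], where X = S]) (intro scale_in_Hom B)
    also have "\<dots> = (\<Sum>v\<in>B. u v \<star> (if b = v then \<iota> S else 0))"
      by (intro sum.cong refl, subst comp_scale_right[OF B(1) B(2)[OF u(1)]]) (auto simp: db u)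
    also have "\<dots> = (\<Sum>v\<in>B. if b = v then u b \<star> \<iota> S else 0)"
      by (intro sum.cong) auto
    also have "\<dots> = u b \<star> \<iota> S"
      using u(1) finB by simp
    finally show False
      using u(2) simple_id_nonzero[OF simples[OF S]] by simp
  qed
  moreover have "vs.span B = Hom C S G"
  proof
    show "vs.span B \<subseteq> Hom C S G"
      using vs.span_minimal[OF _ Hom_subspace] B by blast
    show "Hom C S G \<subseteq> vs.span B"
    proof
      fix f assume f: "f \<in> Hom C S G"
      have "f = (\<Sum>j<n. i j \<cdot> p j) \<cdot> f"
        using ip(4) id_comp[OF f] by simp
      also have "\<dots> = (\<Sum>j<n. (i j \<cdot> p j) \<cdot> f)"
        by (rule comp_sum_left[OF f, where Z = G]) (auto intro!: comp_in_Hom ip)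
      also have "\<dots> \<in> vs.span B"
      proof (rule vs.span_sum)
        fix j assume "j \<in> {..<n}"
        then have j: "j < n" by simp
        have eq: "(i j \<cdot> p j) \<cdot> f = i j \<cdot> (p j \<cdot> f)"
          by (rule comp_assoc[OF f ip(2,1)[OF j]])
        have h: "p j \<cdot> f \<in> Hom C S (T j)"
          by (rule comp_in_Hom[OF f ip(2)[OF j]])
        show "(i j \<cdot> p j) \<cdot> f \<in> vs.span B"
        proof (cases "T j = S")
          case True
          obtain k where "p j \<cdot> f = k \<star> \<iota> S"
            using schur_scalar[OF simples[OF S]] h True by auto
          then have "(i j \<cdot> p j) \<cdot> f = k \<star> i j"
            using eq comp_scale_right[OF id_in_Hom ip(1)[OF j]] comp_id[OF ip(1)[OF j]] True by simp
          moreover have "i j \<in> B"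
            using True j by (auto simp: B_def)
          ultimately show ?thesis
            by (simp add: vs.span_base vs.span_scale)
        next
          case False
          then have "p j \<cdot> f = 0"
            using Hom_simples_zero[OF S T[OF j] _ h] by simp
          then show ?thesis
            using eq comp_zero_right[OF ip(1)[OF j]] by (simp add: vs.span_zero)
        qed
      qed
      finally show "f \<in> vs.span B" .
    qed
  qed
  ultimately have "dual_bases C S G (B, d)"
    unfolding dual_bases_def using B db by auto
  then show ?thesis ..
qed

text \<open>Composing \<open>f\<close> with a dual basis vector yields the corresponding coordinate
  times the identity of \<open>S\<close>.\<close>

lemma dual_bases_expand:
  assumes S: "S \<in> A" and Bd: "dual_bases C S G (B, d)"
  shows "finite B" "\<And>b. b \<in> B \<Longrightarrow> b \<in> Hom C S G" "\<And>b. b \<in> B \<Longrightarrow> d b \<in> Hom C G S"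
    and "f \<in> Hom C S G \<Longrightarrow> (\<Sum>b\<in>B. b \<cdot> (d b \<cdot> f)) = f"
proof -
  have ind: "\<not> vs.dependent B" and sp: "vs.span B = Hom C S G"
    and dH: "\<And>b. b \<in> B \<Longrightarrow> d b \<in> Hom C G S"
    and db: "\<And>b b'. b \<in> B \<Longrightarrow> b' \<in> B \<Longrightarrow> d b \<cdot> b' = (if b = b' then \<iota> S else 0)"
    using Bd by (auto simp: dual_bases_def)
  obtain F where F: "finite F" "vs.span F = Hom C S G"
    using Hom_finite_dim by blast
  show fin: "finite B"
    using vs.independent_span_bound[OF F(1) ind] F(2) sp vs.span_superset by blast
  show BH: "b \<in> Hom C S G" if "b \<in> B" for b
    using sp vs.span_base that by blast
  show "d b \<in> Hom C G S" if "b \<in> B" for b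
    by (rule dH[OF that])
  show "(\<Sum>b\<in>B. b \<cdot> (d b \<cdot> f)) = f" if f: "f \<in> Hom C S G"
  proof -
    obtain u where u: "f = (\<Sum>b\<in>B. u b \<star> b)"
      using f sp vs.span_finite[OF fin] by auto
    have "d b \<cdot> f = u b \<star> \<iota> S" if b: "b \<in> B" for b
    proof -
      have "d b \<cdot> f = (\<Sum>v\<in>B. d b \<cdot> (u v \<star> v))"
        unfolding u by (rule comp_sum_right[OF dH[OF b], where X = S]) (intro scale_in_Hom BH)
      also have "\<dots> = (\<Sum>v\<in>B. u v \<star> (if b = v then \<iota> S else 0))"
        by (intro sum.cong refl, subst comp_scale_right[OF BH dH[OF b]]) (auto simp: db b)
      also have "\<dots> = (\<Sum>v\<in>B. if b = v then u b \<star> \<iota> S else 0)"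
        by (intro sum.cong) auto
      finally show ?thesis
        using b fin by simp
    qed
    then have "b \<cdot> (d b \<cdot> f) = u b \<star> b" if "b \<in> B" for b
      using that comp_scale_right[OF id_in_Hom BH] comp_id[OF BH] by simp
    then show ?thesis
      using u by simp
  qed
qed

lemma dual_bases_orthogonal:
  assumes "S \<in> A" "T \<in> A" "S \<noteq> T" "dual_bases C S G (B, d)" "b \<in> B" "f \<in> Hom C T G"
  shows "d b \<cdot> f = 0"
  using Hom_simples_zero[OF assms(2,1) _ comp_in_Hom[OF assms(6) dual_bases_expand(3)[OF assms(1,4,5)]]] assms(3)
  by auto

text \<open>The sum fixes every morphism from a simple object in \<open>A\<close>, and the identity
  of \<open>G\<close> is a sum of morphisms factoring through such objects.\<close>

lemma resolution_of_identity:
  assumes fin: "finite A" and Bd: "\<And>S. S \<in> A \<Longrightarrow> dual_bases C S G (B S, d S)"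
  shows "(\<Sum>S\<in>A. \<Sum>b\<in>B S. b \<cdot> d S b) = \<iota> G"
proof -
  note ex = dual_bases_expand[OF _ Bd]
  let ?N = "\<Sum>S\<in>A. \<Sum>b\<in>B S. b \<cdot> d S b"
  have bd: "b \<cdot> d S b \<in> Hom C G G" if "S \<in> A" "b \<in> B S" for S b
    by (rule comp_in_Hom[OF ex(3) ex(2)]) (use that in auto)
  have N: "?N \<in> Hom C G G"
    by (intro sum_in_Hom bd)
  have Nf: "?N \<cdot> f = f" if T: "T \<in> A" and f: "f \<in> Hom C T G" for T f
  proof -
    have "?N \<cdot> f = (\<Sum>S\<in>A. (\<Sum>b\<in>B S. b \<cdot> d S b) \<cdot> f)"
      by (rule comp_sum_left[OF f, where Z = G]) (intro sum_in_Hom bd)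
    also have "\<dots> = (\<Sum>S\<in>A. \<Sum>b\<in>B S. b \<cdot> (d S b \<cdot> f))"
    proof (intro sum.cong refl)
      fix S assume S: "S \<in> A"
      have "(\<Sum>b\<in>B S. b \<cdot> d S b) \<cdot> f = (\<Sum>b\<in>B S. (b \<cdot> d S b) \<cdot> f)"
        by (rule comp_sum_left[OF f, where Z = G]) (intro bd S)
      also have "\<dots> = (\<Sum>b\<in>B S. b \<cdot> (d S b \<cdot> f))"
        by (intro sum.cong refl comp_assoc[OF f ex(3)[OF S S] ex(2)[OF S S]])
      finally show "(\<Sum>b\<in>B S. b \<cdot> d S b) \<cdot> f = (\<Sum>b\<in>B S. b \<cdot> (d S b \<cdot> f))" .
    qed
    also have "\<dots> = (\<Sum>S\<in>A. if S = T then f else 0)"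
    proof (intro sum.cong refl)
      fix S assume S: "S \<in> A"
      show "(\<Sum>b\<in>B S. b \<cdot> (d S b \<cdot> f)) = (if S = T then f else 0)"
        using ex(4)[OF T T f] dual_bases_orthogonal[OF S T _ Bd[OF S] _ f] comp_zero_right[OF ex(2)[OF S S]]
        by (auto intro: sum.neutral)
    qed
    finally show ?thesis
      using fin T by simp
  qed
  obtain n T i p where T: "\<And>j. j < n \<Longrightarrow> T j \<in> A"
    and ip: "\<And>j. j < n \<Longrightarrow> i j \<in> Hom C (T j) G" "\<And>j. j < n \<Longrightarrow> p j \<in> Hom C G (T j)"
      "(\<Sum>j<(n::nat). i j \<cdot> p j) = \<iota> G"
    using ex_decomposition[of G] by blast
  have "?N = ?N \<cdot> (\<Sum>j<n. i j \<cdot> p j)"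
    using ip(3) comp_id[OF N] by simp
  also have "\<dots> = (\<Sum>j<n. ?N \<cdot> (i j \<cdot> p j))"
    by (rule comp_sum_right[OF N, where X = G]) (auto intro!: comp_in_Hom ip)
  also have "\<dots> = (\<Sum>j<n. i j \<cdot> p j)"
    using comp_assoc[OF ip(2) ip(1) N] Nf[OF T ip(1)] by (intro sum.cong) auto
  finally show ?thesis
    using ip(3) by simp
qed

lemma finite_complete_set:
  assumes "finite A0" "\<forall>X. simple_object C X \<longrightarrow> (\<exists>S\<in>A0. isomorphic C X S)"
  shows "finite A"
proof -
  obtain g where g: "\<And>S. S \<in> A \<Longrightarrow> g S \<in> A0 \<and> isomorphic C S (g S)"
    using assms(2) simples by metis
  have "inj_on g A"
  proof (rule inj_onI)
    fix S T assume "S \<in> A" "T \<in> A" "g S = g T"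
    then have "isomorphic C S T"
      using g isomorphic_trans isomorphic_sym by metis
    then show "S = T"
      using A \<open>S \<in> A\<close> \<open>T \<in> A\<close> by (auto simp: complete_set_of_simples_def)
  qed
  then show ?thesis
    using g assms(1) by (metis finite_subset image_subsetI finite_imageD)
qed

end

end

section \<open>The functor on the tube category\<close>

sublocale spherical_fusion_category \<subseteq> closed_semisimple_category
  by unfold_locales

context pivotal_action
begin

text \<open>A vector of the functor, drawn as a coupon that erases the letter of \<open>X\<close>.
  In contrast to \<open>mop\<close>, the morphism belongs to \<open>D\<close>.\<close>

definition vf :: "'o \<Rightarrow> 'n \<Rightarrow> 'p list \<Rightarrow> ('p, 'n) arr" where
  "vf X v w = tgt.lun w \<bullet> tgt.opr (FO M X) v \<one>\<^bsub>D\<^esub> w"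

lemma vf_simps [simp]:
  "adom (vf X v w) = FO M X # w" "acod (vf X v w) = w"
  "tgt.ok (vf X v w) \<longleftrightarrow> v \<in> Hom D (FO M X) \<one>\<^bsub>D\<^esub>"
  by (simp_all add: vf_def)

lemma vf_natural: "acod h = w \<Longrightarrow> vf X v w \<bullet> lw X h = h \<bullet> vf X v (adom h)"
  by (simp add: vf_def tgt.opr_natural tgt.lun_natural[THEN tgt.reassoc])

lemma vf_inject:
  assumes "v \<in> Hom D (FO M X) \<one>\<^bsub>D\<^esub>" "v' \<in> Hom D (FO M X) \<one>\<^bsub>D\<^esub>" "vf X v [] = vf X v' []"
  shows "v = v'"
proof -
  have "tgt.luni [] \<bullet> vf X v [] = tgt.luni [] \<bullet> vf X v' []"
    using assms(3) by simp
  then show ?thesis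
    using tgt.opr_cong_faithful[OF assms(1,2)] assms(1,2)
    by (simp add: vf_def tgt.reassoc[OF tgt.luni_lun])
qed

end

context pivotal_functor
begin

lemmas dtyping = tgt.comp_in_Hom tgt.mor_in_Hom FM_in_Hom FTens_in_Hom FTens_inv_in_Hom FUnit_inv_in_Hom

abbreviation act where "act X Y G \<alpha> \<beta> \<equiv> TM_action C D M X Y G \<alpha> \<beta>"

lemma act_in_Hom:
  assumes "\<alpha> \<in> Hom C (G \<odot>\<^bsub>C\<^esub> X) (Y \<odot>\<^bsub>C\<^esub> G)" "\<beta> \<in> Hom D (FO M Y) \<one>\<^bsub>D\<^esub>"
  shows "act X Y G \<alpha> \<beta> \<in> Hom D (FO M X) \<one>\<^bsub>D\<^esub>"
  unfolding TM_action_def by (rule dtyping typing assms)+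

text \<open>The action as a picture: a loop of colour \<open>G\<close> around the coupon of
  \<open>\<beta>\<close>, crossing its leg at \<open>\<alpha>\<close>. Identities about
  \<open>act\<close> are proved in this form and transferred back by
  \<open>vf_inject\<close>.\<close>

lemma vf_act:
  assumes "\<alpha> \<in> Hom C (G \<odot>\<^bsub>C\<^esub> X) (Y \<odot>\<^bsub>C\<^esub> G)" "\<beta> \<in> Hom D (FO M Y) \<one>\<^bsub>D\<^esub>"
  shows "vf X (act X Y G \<alpha> \<beta>) w = evm G w \<bullet> lw (du G) (vf Y \<beta> (FO M G # w) \<bullet> mu Y G w
    \<bullet> mop (G \<odot>\<^bsub>C\<^esub> X) \<alpha> (Y \<odot>\<^bsub>C\<^esub> G) w \<bullet> mui G X w) \<bullet> pcoevm G (FO M X # w)"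
proof -
  note fold = mop_def[symmetric]
  have b: "\<l>\<^bsub>D\<^esub> (FO M G) \<cdot>\<^bsub>D\<^esub> (\<beta> \<otimes>\<^bsub>D\<^esub> \<iota>\<^bsub>D\<^esub> (FO M G)) \<cdot>\<^bsub>D\<^esub> FTens_inv C D M Y G \<in> Hom D (FO M (Y \<odot>\<^bsub>C\<^esub> G)) (FO M G)"
    by (rule dtyping typing assms)+
  have F: "tgt.opr (FO M (P \<odot>\<^bsub>C\<^esub> Q)) (FTens_inv C D M P Q) (FO M P \<odot>\<^bsub>D\<^esub> FO M Q) u = tgt.asci (FO M P) (FO M Q) u \<bullet> mu P Q u" for P Q u
    by (simp add: mu_def FTens_inv_in_Hom tgt.reassoc[OF tgt.asci_asc])
  have U: "tgt.lun u \<bullet> tgt.opr (FO M \<one>\<^bsub>C\<^esub>) (FUnit_inv C D M) \<one>\<^bsub>D\<^esub> u = me u" for u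
    by (simp add: me_def)
  show ?thesis
    unfolding TM_action_def vf_def
    apply ((subst tgt.opr_comp, (rule dtyping typing assms)+)+)
    apply (subst tgt.opr_tensor[OF tgt.id_in_Hom b])
    apply ((subst tgt.opr_comp, (rule dtyping typing assms)+)+)
    apply (simp only: fold opr_FTens_eq F)
    apply (simp add: mop_tensor mop_coherence typing assms tgt.opr_tensor tgt.id_in_Hom tgt.opr_lunit
        tgt.reassoc[OF tgt.asc_asci] tgt.asc_asci[THEN tgt.wl2_id, THEN tgt.reassoc]
        U[THEN tgt.reassoc] evm_def pcoevm_def capm_def cupm_def)
    done
qed

lemma act_add_mor:
  assumes "\<alpha> \<in> Hom C (G \<odot>\<^bsub>C\<^esub> X) (Y \<odot>\<^bsub>C\<^esub> G)" "\<alpha>' \<in> Hom C (G \<odot>\<^bsub>C\<^esub> X) (Y \<odot>\<^bsub>C\<^esub> G)"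
    "\<beta> \<in> Hom D (FO M Y) \<one>\<^bsub>D\<^esub>"
  shows "act X Y G (\<alpha> + \<alpha>') \<beta> = act X Y G \<alpha> \<beta> + act X Y G \<alpha>' \<beta>"
  unfolding TM_action_def
    src.tensor_add_right[OF src.id_in_Hom assms(1,2)]
    FM_add[OF src.tensor_in_Hom[OF src.id_in_Hom assms(1)] src.tensor_in_Hom[OF src.id_in_Hom assms(2)]]
  by (subst tgt.comp_add_right, (rule dtyping typing assms)+)
     ((subst tgt.comp_add_left, (rule dtyping typing assms)+)+, rule refl)

lemma act_scale_mor:
  assumes "\<alpha> \<in> Hom C (G \<odot>\<^bsub>C\<^esub> X) (Y \<odot>\<^bsub>C\<^esub> G)" "\<beta> \<in> Hom D (FO M Y) \<one>\<^bsub>D\<^esub>"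
  shows "act X Y G (k \<star>\<^bsub>C\<^esub> \<alpha>) \<beta> = k \<star>\<^bsub>D\<^esub> act X Y G \<alpha> \<beta>"
  unfolding TM_action_def src.tensor_scale_right[OF src.id_in_Hom assms(1)]
    FM_scale[OF src.tensor_in_Hom[OF src.id_in_Hom assms(1)]]
  by (subst tgt.comp_scale_right, (rule dtyping typing assms)+)
     ((subst tgt.comp_scale_left, (rule dtyping typing assms)+)+, rule refl)

lemma act_add:
  assumes "\<alpha> \<in> Hom C (G \<odot>\<^bsub>C\<^esub> X) (Y \<odot>\<^bsub>C\<^esub> G)"
    "\<beta> \<in> Hom D (FO M Y) \<one>\<^bsub>D\<^esub>" "\<beta>' \<in> Hom D (FO M Y) \<one>\<^bsub>D\<^esub>"
  shows "act X Y G \<alpha> (\<beta> + \<beta>') = act X Y G \<alpha> \<beta> + act X Y G \<alpha> \<beta>'"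
  unfolding TM_action_def tgt.tensor_add_left[OF assms(2,3) tgt.id_in_Hom]
  apply (subst tgt.comp_add_right, (rule dtyping typing assms)+)
  apply (subst tgt.comp_add_left, (rule dtyping typing assms)+)
  apply (subst tgt.tensor_add_right, (rule dtyping typing assms)+)
  apply (subst tgt.comp_add_right, (rule dtyping typing assms)+)
  apply ((subst tgt.comp_add_left, (rule dtyping typing assms)+)+, rule refl)
  done

lemma act_scale:
  assumes "\<alpha> \<in> Hom C (G \<odot>\<^bsub>C\<^esub> X) (Y \<odot>\<^bsub>C\<^esub> G)" "\<beta> \<in> Hom D (FO M Y) \<one>\<^bsub>D\<^esub>"
  shows "act X Y G \<alpha> (k \<star>\<^bsub>D\<^esub> \<beta>) = k \<star>\<^bsub>D\<^esub> act X Y G \<alpha> \<beta>"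
  unfolding TM_action_def tgt.tensor_scale_left[OF assms(2) tgt.id_in_Hom]
  apply (subst tgt.comp_scale_right, (rule dtyping typing assms)+)
  apply (subst tgt.comp_scale_left, (rule dtyping typing assms)+)
  apply (subst tgt.tensor_scale_right, (rule dtyping typing assms)+)
  apply (subst tgt.comp_scale_right, (rule dtyping typing assms)+)
  apply ((subst tgt.comp_scale_left, (rule dtyping typing assms)+)+, rule refl)
  done

lemma act_sum_mor:
  assumes "\<And>i. i \<in> I \<Longrightarrow> \<alpha> i \<in> Hom C (G \<odot>\<^bsub>C\<^esub> X) (Y \<odot>\<^bsub>C\<^esub> G)" "\<beta> \<in> Hom D (FO M Y) \<one>\<^bsub>D\<^esub>"
  shows "act X Y G (\<Sum>i\<in>I. \<alpha> i) \<beta> = (\<Sum>i\<in>I. act X Y G (\<alpha> i) \<beta>)"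
proof -
  have "act X Y G 0 \<beta> = 0"
    using act_scale_mor[OF src.zero_in_Hom assms(2), where G = G and X = X and k = 0] by simp
  then show ?thesis
    using assms(1)
    by (induction I rule: infinite_finite_induct) (auto simp: act_add_mor[OF _ _ assms(2)] src.sum_in_Hom)
qed

lemma act_sum:
  assumes "\<alpha> \<in> Hom C (G \<odot>\<^bsub>C\<^esub> X) (Y \<odot>\<^bsub>C\<^esub> G)" "\<And>i. i \<in> I \<Longrightarrow> \<beta> i \<in> Hom D (FO M Y) \<one>\<^bsub>D\<^esub>"
  shows "act X Y G \<alpha> (\<Sum>i\<in>I. \<beta> i) = (\<Sum>i\<in>I. act X Y G \<alpha> (\<beta> i))"
proof -
  have "act X Y G \<alpha> 0 = 0"
    using act_scale[OF assms(1) tgt.zero_in_Hom, of 0] by simp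
  then show ?thesis
    using assms(2)
    by (induction I rule: infinite_finite_induct) (auto simp: act_add[OF assms(1)] tgt.sum_in_Hom)
qed

text \<open>A morphism between two loop colours travels around the loop, passing the cup and the cap
  as its dual. This is the relation by which a tube morphism is determined by its simple
  components.\<close>

lemma act_slide:
  assumes f: "f \<in> Hom C U G" and h: "h \<in> Hom C (G \<odot>\<^bsub>C\<^esub> X) (Y \<odot>\<^bsub>C\<^esub> U)"
    and v: "v \<in> Hom D (FO M Y) \<one>\<^bsub>D\<^esub>"
  shows "act X Y U (h \<cdot>\<^bsub>C\<^esub> (f \<otimes>\<^bsub>C\<^esub> \<iota>\<^bsub>C\<^esub> X)) v = act X Y G ((\<iota>\<^bsub>C\<^esub> Y \<otimes>\<^bsub>C\<^esub> f) \<cdot>\<^bsub>C\<^esub> h) v"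
proof (rule vf_inject)
  have 1: "h \<cdot>\<^bsub>C\<^esub> (f \<otimes>\<^bsub>C\<^esub> \<iota>\<^bsub>C\<^esub> X) \<in> Hom C (U \<odot>\<^bsub>C\<^esub> X) (Y \<odot>\<^bsub>C\<^esub> U)"
    by (rule typing f h)+
  have 2: "(\<iota>\<^bsub>C\<^esub> Y \<otimes>\<^bsub>C\<^esub> f) \<cdot>\<^bsub>C\<^esub> h \<in> Hom C (G \<odot>\<^bsub>C\<^esub> X) (Y \<odot>\<^bsub>C\<^esub> G)"
    by (rule typing f h)+
  show "act X Y U (h \<cdot>\<^bsub>C\<^esub> (f \<otimes>\<^bsub>C\<^esub> \<iota>\<^bsub>C\<^esub> X)) v \<in> Hom D (FO M X) \<one>\<^bsub>D\<^esub>"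
    "act X Y G ((\<iota>\<^bsub>C\<^esub> Y \<otimes>\<^bsub>C\<^esub> f) \<cdot>\<^bsub>C\<^esub> h) v \<in> Hom D (FO M X) \<one>\<^bsub>D\<^esub>"
    by (rule act_in_Hom 1 2 v)+
  define B where "B = vf Y v (FO M U # []) \<bullet> mu Y U [] \<bullet> mop (G \<odot>\<^bsub>C\<^esub> X) h (Y \<odot>\<^bsub>C\<^esub> U) [] \<bullet> mui G X []"
  have B: "adom B = FO M G # FO M X # []" "acod B = FO M U # []"
    by (simp_all add: B_def)
  have "vf X (act X Y U (h \<cdot>\<^bsub>C\<^esub> (f \<otimes>\<^bsub>C\<^esub> \<iota>\<^bsub>C\<^esub> X)) v) []
    = evm U [] \<bullet> lw (du U) (B \<bullet> mop U f G (FO M X # [])) \<bullet> pcoevm U (FO M X # [])"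
    by (simp add: vf_act[OF 1 v] mop_comp[OF src.tensor_in_Hom[OF f src.id_in_Hom] h]
        mop_tensor[OF f src.id_in_Hom] B_def f)
  also have "\<dots> = evm U [] \<bullet> (lw (du U) B \<bullet> mop (du G) (dual_mor C U G f) (du U) (FO M G # FO M X # []))
      \<bullet> pcoevm G (FO M X # [])"
    by (simp add: pcoevm_slide[OF f])
  also have "\<dots> = (evm U [] \<bullet> mop (du G) (dual_mor C U G f) (du U) (FO M U # [])) \<bullet> lw (du G) B
      \<bullet> pcoevm G (FO M X # [])"
    using mop_natural[of B _ "du G" "dual_mor C U G f" "du U", OF refl, THEN tgt.reassoc] B by simp
  also have "\<dots> = evm G [] \<bullet> lw (du G) (mop U f G [] \<bullet> B) \<bullet> pcoevm G (FO M X # [])"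
    by (simp add: evm_slide[OF f, symmetric])
  also have "mop U f G [] \<bullet> B = vf Y v (FO M G # []) \<bullet> lw Y (mop U f G []) \<bullet> mu Y U [] \<bullet> mop (G \<odot>\<^bsub>C\<^esub> X) h (Y \<odot>\<^bsub>C\<^esub> U) [] \<bullet> mui G X []"
    by (simp add: B_def vf_natural[THEN tgt.reassoc])
  also have "evm G [] \<bullet> lw (du G) \<dots> \<bullet> pcoevm G (FO M X # [])
    = vf X (act X Y G ((\<iota>\<^bsub>C\<^esub> Y \<otimes>\<^bsub>C\<^esub> f) \<cdot>\<^bsub>C\<^esub> h) v) []"
    by (simp add: vf_act[OF 2 v] mop_comp[OF h src.tensor_in_Hom[OF src.id_in_Hom f]]
        mop_tensor[OF src.id_in_Hom f] f h)
  finally show "vf X (act X Y U (h \<cdot>\<^bsub>C\<^esub> (f \<otimes>\<^bsub>C\<^esub> \<iota>\<^bsub>C\<^esub> X)) v) [] = vf X (act X Y G ((\<iota>\<^bsub>C\<^esub> Y \<otimes>\<^bsub>C\<^esub> f) \<cdot>\<^bsub>C\<^esub> h) v) []" .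
qed

text \<open>Naturality pulls the vector out of the unit loop, which is trivial by
  \<open>loop_unit\<close>.\<close>

lemma act_unit:
  assumes v: "v \<in> Hom D (FO M X) \<one>\<^bsub>D\<^esub>"
  shows "act X X \<one>\<^bsub>C\<^esub> (runit_inv C X \<cdot>\<^bsub>C\<^esub> \<l>\<^bsub>C\<^esub> X) v = v"
proof (rule vf_inject)
  have 1: "runit_inv C X \<cdot>\<^bsub>C\<^esub> \<l>\<^bsub>C\<^esub> X \<in> Hom C (\<one>\<^bsub>C\<^esub> \<odot>\<^bsub>C\<^esub> X) (X \<odot>\<^bsub>C\<^esub> \<one>\<^bsub>C\<^esub>)"
    by (rule typing)+
  show "act X X \<one>\<^bsub>C\<^esub> (runit_inv C X \<cdot>\<^bsub>C\<^esub> \<l>\<^bsub>C\<^esub> X) v \<in> Hom D (FO M X) \<one>\<^bsub>D\<^esub>"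
    by (rule act_in_Hom 1 v)+
  let ?w = "FO M X # []"
  have "vf X v (FO M \<one>\<^bsub>C\<^esub> # []) \<bullet> lw X (mei []) \<bullet> me ?w = mei [] \<bullet> me [] \<bullet> lw \<one>\<^bsub>C\<^esub> (vf X v [])"
    by (simp add: vf_natural[THEN tgt.reassoc] me_natural del: me_inv')
  then have "vf X v (FO M \<one>\<^bsub>C\<^esub> # []) \<bullet> lw X (mei []) \<bullet> me ?w = lw \<one>\<^bsub>C\<^esub> (vf X v [])"
    using v by simp
  note eq = this[THEN tgt.wl_eq[of _ _ "FO M (du \<one>\<^bsub>C\<^esub>)"], unfolded tgt.wl_cmp, THEN tgt.reassoc2]
  have "vf X (act X X \<one>\<^bsub>C\<^esub> (runit_inv C X \<cdot>\<^bsub>C\<^esub> \<l>\<^bsub>C\<^esub> X) v) []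
    = evm \<one>\<^bsub>C\<^esub> [] \<bullet> lw (du \<one>\<^bsub>C\<^esub>) (lw \<one>\<^bsub>C\<^esub> (vf X v [])) \<bullet> pcoevm \<one>\<^bsub>C\<^esub> ?w"
    using v by (simp add: vf_act[OF 1 v] mop_comp[OF src.lunit_in_Hom src.runit_inv_in_Hom] mop_coherence eq)
  also have "\<dots> = vf X v [] \<bullet> loop \<one>\<^bsub>C\<^esub> ?w"
    by (simp add: evm_natural[THEN tgt.reassoc] loop_def)
  finally show "vf X (act X X \<one>\<^bsub>C\<^esub> (runit_inv C X \<cdot>\<^bsub>C\<^esub> \<l>\<^bsub>C\<^esub> X) v) [] = vf X v []"
    using v by (simp add: loop_unit)
qed (rule v)

text \<open>A loop coloured by a product is two nested loops: the identification of the dual of the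
  product, present in its cup and in its cap, cancels by naturality.\<close>

lemma act_act:
  assumes \<alpha>: "\<alpha> \<in> Hom C (T \<odot>\<^bsub>C\<^esub> X) (Y \<odot>\<^bsub>C\<^esub> T)" and \<beta>: "\<beta> \<in> Hom C (S \<odot>\<^bsub>C\<^esub> Y) (Z \<odot>\<^bsub>C\<^esub> S)"
    and v: "v \<in> Hom D (FO M Z) \<one>\<^bsub>D\<^esub>"
  shows "act X Z (S \<odot>\<^bsub>C\<^esub> T) (\<a>\<^bsub>C\<^esub> Z S T \<cdot>\<^bsub>C\<^esub> (\<beta> \<otimes>\<^bsub>C\<^esub> \<iota>\<^bsub>C\<^esub> T) \<cdot>\<^bsub>C\<^esub> assoc_inv C S Y T \<cdot>\<^bsub>C\<^esub> (\<iota>\<^bsub>C\<^esub> S \<otimes>\<^bsub>C\<^esub> \<alpha>) \<cdot>\<^bsub>C\<^esub> \<a>\<^bsub>C\<^esub> S T X) v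
    = act X Y T \<alpha> (act Y Z S \<beta> v)" (is "act X Z ?ST ?g v = _")
proof (rule vf_inject)
  have g: "?g \<in> Hom C (?ST \<odot>\<^bsub>C\<^esub> X) (Z \<odot>\<^bsub>C\<^esub> ?ST)"
    by (rule typing \<alpha> \<beta>)+
  show "act X Z ?ST ?g v \<in> Hom D (FO M X) \<one>\<^bsub>D\<^esub>" "act X Y T \<alpha> (act Y Z S \<beta> v) \<in> Hom D (FO M X) \<one>\<^bsub>D\<^esub>"
    by (rule act_in_Hom g \<alpha> \<beta> v)+
  let ?x = "FO M X # []" and ?t = "FO M T # []"
  define a where "a = mu Y T [] \<bullet> mop (T \<odot>\<^bsub>C\<^esub> X) \<alpha> (Y \<odot>\<^bsub>C\<^esub> T) [] \<bullet> mui T X []"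
  define b where "b = mu Z S ?t \<bullet> mop (S \<odot>\<^bsub>C\<^esub> Y) \<beta> (Z \<odot>\<^bsub>C\<^esub> S) ?t \<bullet> mui S Y ?t"
  have a: "adom a = FO M T # ?x" "acod a = FO M Y # ?t" "tgt.ok a"
    and b: "adom b = FO M S # FO M Y # ?t" "acod b = FO M Z # FO M S # ?t" "tgt.ok b"
    using \<alpha> \<beta> by (simp_all add: a_def b_def)
  define m where "m = vf Z v (FO M S # ?t) \<bullet> b \<bullet> lw S a"
  have m: "adom m = FO M S # FO M T # ?x" "acod m = FO M S # ?t" "tgt.ok m"
    using a b v by (simp_all add: m_def)
  have "mu Z ?ST [] \<bullet> mop (?ST \<odot>\<^bsub>C\<^esub> X) ?g (Z \<odot>\<^bsub>C\<^esub> ?ST) [] \<bullet> mui ?ST X []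
    = lw Z (mui S T []) \<bullet> b \<bullet> lw S a \<bullet> mu S T ?x"
    apply ((subst mop_comp, (rule typing \<alpha> \<beta>)+)+)
    apply (simp add: mop_tensor \<alpha> \<beta> src.id_in_Hom mop_coherence a_def b_def)
    done
  then have "vf X (act X Z ?ST ?g v) []
    = evm ?ST [] \<bullet> lw (du ?ST) (vf Z v (FO M ?ST # []) \<bullet> lw Z (mui S T []) \<bullet> b \<bullet> lw S a \<bullet> mu S T ?x) \<bullet> pcoevm ?ST ?x"
    by (simp add: vf_act[OF g v])
  also have "\<dots> = evm ?ST [] \<bullet> lw (du ?ST) (mui S T [] \<bullet> m \<bullet> mu S T ?x) \<bullet> pcoevm ?ST ?x"
    by (simp add: vf_natural[THEN tgt.wl2, THEN tgt.reassoc] m_def)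
  also have "\<dots> = evm ?ST [] \<bullet> (lw (du ?ST) (mui S T [] \<bullet> m \<bullet> mu S T ?x) \<bullet> dtm S T (FO M ?ST # ?x))
      \<bullet> mui (du T) (du S) (FO M ?ST # ?x) \<bullet> lw (du T) (lw (du S) (mui S T ?x)) \<bullet> lw (du T) (pcoevm S (FO M T # ?x)) \<bullet> pcoevm T ?x"
    by (simp add: pcoevm_tensor)
  also have "lw (du ?ST) (mui S T [] \<bullet> m \<bullet> mu S T ?x) \<bullet> dtm S T (FO M ?ST # ?x)
    = dtm S T (FO M ?ST # []) \<bullet> lw (du T \<odot>\<^bsub>C\<^esub> du S) (mui S T [] \<bullet> m \<bullet> mu S T ?x)"
    using mop_natural[of "mui S T [] \<bullet> m \<bullet> mu S T ?x" _ "du T \<odot>\<^bsub>C\<^esub> du S" "dten S T" "du ?ST", OF refl] by simp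
  also have "evm ?ST [] \<bullet> (dtm S T (FO M ?ST # []) \<bullet> lw (du T \<odot>\<^bsub>C\<^esub> du S) (mui S T [] \<bullet> m \<bullet> mu S T ?x))
      \<bullet> mui (du T) (du S) (FO M ?ST # ?x) \<bullet> lw (du T) (lw (du S) (mui S T ?x)) \<bullet> lw (du T) (pcoevm S (FO M T # ?x)) \<bullet> pcoevm T ?x
    = evm T [] \<bullet> lw (du T) (evm S ?t \<bullet> lw (du S) m \<bullet> pcoevm S (FO M T # ?x)) \<bullet> pcoevm T ?x"
    using m by (simp add: evm_tensor[THEN tgt.reassoc] mu_natural[THEN tgt.reassoc])
  also have "lw (du S) m \<bullet> pcoevm S (FO M T # ?x)
    = lw (du S) (vf Z v (FO M S # ?t) \<bullet> b) \<bullet> pcoevm S (FO M Y # ?t) \<bullet> a"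
    using a by (simp add: m_def pcoevm_natural)
  also have "evm T [] \<bullet> lw (du T) (evm S ?t \<bullet> lw (du S) (vf Z v (FO M S # ?t) \<bullet> b) \<bullet> pcoevm S (FO M Y # ?t) \<bullet> a) \<bullet> pcoevm T ?x
    = vf X (act X Y T \<alpha> (act Y Z S \<beta> v)) []"
    by (simp add: vf_act[OF \<alpha> act_in_Hom[OF \<beta> v]] vf_act[OF \<beta> v] a_def b_def)
  finally show "vf X (act X Z ?ST ?g v) [] = vf X (act X Y T \<alpha> (act Y Z S \<beta> v)) []" .
qed

end

section \<open>Functoriality on the tube category\<close>

locale fusion_functor =
  src: spherical_fusion_category C + pivotal_functor C D M
  for C :: "('o, 'm::ab_group_add, 'k::alg_closed_field, 'z) piv_cat_scheme"
    and D :: "('p, 'n::ab_group_add, 'k, 'y) piv_cat_scheme"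
    and M :: "('o, 'm, 'p, 'n) mon_fun" +
  fixes A :: "'o set"
  assumes complete: "complete_set_of_simples C A"
begin

lemma finite_simples: "finite A"
  using src.finitely_many_simples src.finite_complete_set[OF complete] by blast

text \<open>With \<open>cob\<close>, names the very choice made inside \<open>tube_mor\<close>, so
  that its components can be expanded.\<close>

definition bas :: "'o \<Rightarrow> 'o \<Rightarrow> 'm set" where "bas S G = fst (SOME Bd. dual_bases C S G Bd)"
definition cob :: "'o \<Rightarrow> 'o \<Rightarrow> 'm \<Rightarrow> 'm" where "cob S G = snd (SOME Bd. dual_bases C S G Bd)"

lemma dual_bases_bas: "S \<in> A \<Longrightarrow> dual_bases C S G (bas S G, cob S G)"
  using someI_ex[OF src.ex_dual_bases[OF complete]] by (simp add: bas_def cob_def)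

lemmas bas_in_Hom = src.dual_bases_expand(2)[OF complete _ dual_bases_bas]
lemmas cob_in_Hom = src.dual_bases_expand(3)[OF complete _ dual_bases_bas]

lemma bas_resolution: "(\<Sum>S\<in>A. \<Sum>b\<in>bas S G. b \<cdot>\<^bsub>C\<^esub> cob S G b) = \<iota>\<^bsub>C\<^esub> G"
  by (rule src.resolution_of_identity[OF complete finite_simples dual_bases_bas])

lemma tube_mor_eq:
  "S \<in> A \<Longrightarrow> tube_mor C A X Y G \<alpha> S
    = (\<Sum>b\<in>bas S G. (\<iota>\<^bsub>C\<^esub> Y \<otimes>\<^bsub>C\<^esub> cob S G b) \<cdot>\<^bsub>C\<^esub> \<alpha> \<cdot>\<^bsub>C\<^esub> (b \<otimes>\<^bsub>C\<^esub> \<iota>\<^bsub>C\<^esub> X))"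
  by (simp add: tube_mor_def bas_def cob_def case_prod_beta)

lemma tube_mor_term_in_Hom:
  assumes "S \<in> A" "b \<in> bas S G" "\<alpha> \<in> Hom C (G \<odot>\<^bsub>C\<^esub> X) (Y \<odot>\<^bsub>C\<^esub> G)"
  shows "(\<iota>\<^bsub>C\<^esub> Y \<otimes>\<^bsub>C\<^esub> cob S G b) \<cdot>\<^bsub>C\<^esub> \<alpha> \<cdot>\<^bsub>C\<^esub> (b \<otimes>\<^bsub>C\<^esub> \<iota>\<^bsub>C\<^esub> X) \<in> Hom C (S \<odot>\<^bsub>C\<^esub> X) (Y \<odot>\<^bsub>C\<^esub> S)"
  by (rule typing assms bas_in_Hom[OF assms(1,1,2)] cob_in_Hom[OF assms(1,1,2)])+

lemma tube_mor_in_Hom: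
  assumes "S \<in> A" "\<alpha> \<in> Hom C (G \<odot>\<^bsub>C\<^esub> X) (Y \<odot>\<^bsub>C\<^esub> G)"
  shows "tube_mor C A X Y G \<alpha> S \<in> Hom C (S \<odot>\<^bsub>C\<^esub> X) (Y \<odot>\<^bsub>C\<^esub> S)"
  unfolding tube_mor_eq[OF assms(1)] by (intro src.sum_in_Hom tube_mor_term_in_Hom assms)

text \<open>Sliding each basis vector around the loop puts it next to its dual vector on a loop of
  colour \<open>G\<close>, where the resolution of the identity sums the pairs to the
  identity.\<close>

lemma act_tube_mor:
  assumes \<alpha>: "\<alpha> \<in> Hom C (G \<odot>\<^bsub>C\<^esub> X) (Y \<odot>\<^bsub>C\<^esub> G)" and v: "v \<in> Hom D (FO M Y) \<one>\<^bsub>D\<^esub>"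
  shows "(\<Sum>S\<in>A. act X Y S (tube_mor C A X Y G \<alpha> S) v) = act X Y G \<alpha> v"
proof -
  have 1: "act X Y S ((\<iota>\<^bsub>C\<^esub> Y \<otimes>\<^bsub>C\<^esub> cob S G b) \<cdot>\<^bsub>C\<^esub> \<alpha> \<cdot>\<^bsub>C\<^esub> (b \<otimes>\<^bsub>C\<^esub> \<iota>\<^bsub>C\<^esub> X)) v
    = act X Y G ((\<iota>\<^bsub>C\<^esub> Y \<otimes>\<^bsub>C\<^esub> (b \<cdot>\<^bsub>C\<^esub> cob S G b)) \<cdot>\<^bsub>C\<^esub> \<alpha>) v" if "S \<in> A" "b \<in> bas S G" for S b
  proof -
    note b = bas_in_Hom[OF that(1,1,2)] and d = cob_in_Hom[OF that(1,1,2)]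
    note td = src.tensor_in_Hom[OF src.id_in_Hom[of Y] d] and tb = src.tensor_in_Hom[OF src.id_in_Hom[of Y] b]
    have "act X Y S (((\<iota>\<^bsub>C\<^esub> Y \<otimes>\<^bsub>C\<^esub> cob S G b) \<cdot>\<^bsub>C\<^esub> \<alpha>) \<cdot>\<^bsub>C\<^esub> (b \<otimes>\<^bsub>C\<^esub> \<iota>\<^bsub>C\<^esub> X)) v
      = act X Y G ((\<iota>\<^bsub>C\<^esub> Y \<otimes>\<^bsub>C\<^esub> b) \<cdot>\<^bsub>C\<^esub> ((\<iota>\<^bsub>C\<^esub> Y \<otimes>\<^bsub>C\<^esub> cob S G b) \<cdot>\<^bsub>C\<^esub> \<alpha>)) v"
      by (rule act_slide[OF b src.comp_in_Hom[OF \<alpha> td] v])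
    also have "(\<iota>\<^bsub>C\<^esub> Y \<otimes>\<^bsub>C\<^esub> b) \<cdot>\<^bsub>C\<^esub> ((\<iota>\<^bsub>C\<^esub> Y \<otimes>\<^bsub>C\<^esub> cob S G b) \<cdot>\<^bsub>C\<^esub> \<alpha>)
      = ((\<iota>\<^bsub>C\<^esub> Y \<otimes>\<^bsub>C\<^esub> b) \<cdot>\<^bsub>C\<^esub> (\<iota>\<^bsub>C\<^esub> Y \<otimes>\<^bsub>C\<^esub> cob S G b)) \<cdot>\<^bsub>C\<^esub> \<alpha>"
      by (rule src.comp_assoc[OF \<alpha> td tb, symmetric])
    also have "(\<iota>\<^bsub>C\<^esub> Y \<otimes>\<^bsub>C\<^esub> b) \<cdot>\<^bsub>C\<^esub> (\<iota>\<^bsub>C\<^esub> Y \<otimes>\<^bsub>C\<^esub> cob S G b) = \<iota>\<^bsub>C\<^esub> Y \<otimes>\<^bsub>C\<^esub> (b \<cdot>\<^bsub>C\<^esub> cob S G b)"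
      using src.tensor_comp[OF src.id_in_Hom src.id_in_Hom d b, of Y] src.comp_id[OF src.id_in_Hom] by simp
    finally show ?thesis .
  qed
  have bd: "b \<cdot>\<^bsub>C\<^esub> cob S G b \<in> Hom C G G" if "S \<in> A" "b \<in> bas S G" for S b
    by (rule src.comp_in_Hom[OF cob_in_Hom[OF that(1,1,2)] bas_in_Hom[OF that(1,1,2)]])
  \<comment> \<open>The action as an additive function of an endomorphism inserted on the strand of
    \<open>G\<close>, so that the sum over all basis vectors can be taken inside.\<close>
  define L where "L = (\<lambda>f. act X Y G ((\<iota>\<^bsub>C\<^esub> Y \<otimes>\<^bsub>C\<^esub> f) \<cdot>\<^bsub>C\<^esub> \<alpha>) v)"
  have th: "\<iota>\<^bsub>C\<^esub> Y \<otimes>\<^bsub>C\<^esub> f \<in> Hom C (Y \<odot>\<^bsub>C\<^esub> G) (Y \<odot>\<^bsub>C\<^esub> G)" if "f \<in> Hom C G G" for f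
    by (rule src.tensor_in_Hom[OF src.id_in_Hom that])
  have L_add: "L (f + g) = L f + L g" if "f \<in> Hom C G G" "g \<in> Hom C G G" for f g
    unfolding L_def src.tensor_add_right[OF src.id_in_Hom that] src.comp_add_left[OF \<alpha> th th, OF that]
    by (rule act_add_mor[OF src.comp_in_Hom[OF \<alpha> th] src.comp_in_Hom[OF \<alpha> th] v, OF that])
  have L_0: "L 0 = 0"
    using L_add[OF src.zero_in_Hom src.zero_in_Hom] by simp
  have L_sum: "L (\<Sum>i\<in>I. f i) = (\<Sum>i\<in>I. L (f i))" if "\<And>i. i \<in> I \<Longrightarrow> f i \<in> Hom C G G" for I and f :: "'i \<Rightarrow> 'm"
    using that by (induction I rule: infinite_finite_induct) (auto simp: L_0 L_add src.sum_in_Hom)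
  have "(\<Sum>S\<in>A. act X Y S (tube_mor C A X Y G \<alpha> S) v) = (\<Sum>S\<in>A. \<Sum>b\<in>bas S G. L (b \<cdot>\<^bsub>C\<^esub> cob S G b))"
    by (intro sum.cong refl)
       (simp add: tube_mor_eq act_sum_mor[OF tube_mor_term_in_Hom[OF _ _ \<alpha>] v] 1 L_def)
  also have "\<dots> = (\<Sum>S\<in>A. L (\<Sum>b\<in>bas S G. b \<cdot>\<^bsub>C\<^esub> cob S G b))"
    by (intro sum.cong refl L_sum[symmetric] bd)
  also have "\<dots> = L (\<Sum>S\<in>A. \<Sum>b\<in>bas S G. b \<cdot>\<^bsub>C\<^esub> cob S G b)"
    by (intro L_sum[symmetric] src.sum_in_Hom bd)
  also have "\<dots> = act X Y G \<alpha> v"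
    using src.id_comp[OF \<alpha>] by (simp add: bas_resolution L_def src.tensor_id)
  finally show ?thesis .
qed

text \<open>The content is in the identity and composition laws: \<open>act_tube_mor\<close>
  reassembles the simple components, after which \<open>act_unit\<close> and \<open>act_act\<close>
  evaluate the action.\<close>

lemma TM_functor: "contravariant_tube_functor C A (TM C A D M)"
proof (rule contravariant_tube_functor.intro)
  fix X Y Z \<alpha> \<beta> v w k
  let ?F = "TM C A D M"
  have obj: "VObj ?F X = Hom D (FO M X) \<one>\<^bsub>D\<^esub>" and sc: "VScale ?F = Scale D"
    and mor: "VMor ?F X Y \<alpha> v = (\<Sum>S\<in>A. act X Y S (\<alpha> S) v)" for X Y \<alpha> v
    by (simp_all add: TM_def)
  have tube: "\<alpha> S \<in> Hom C (S \<odot>\<^bsub>C\<^esub> X) (Y \<odot>\<^bsub>C\<^esub> S)" if "\<alpha> \<in> tube_hom C A X Y" "S \<in> A" for \<alpha> X Y S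
    using that by (auto simp: tube_hom_def)
  show "vector_space (VScale ?F)"
    unfolding sc by (rule tgt.vector_space)
  show "module.subspace (VScale ?F) (VObj ?F X)"
    unfolding sc obj by (rule tgt.Hom_subspace)
  show "\<exists>B. finite B \<and> module.span (VScale ?F) B = VObj ?F X"
    unfolding sc obj by (rule tgt.Hom_finite_dim)
  show "VMor ?F X Y \<alpha> v \<in> VObj ?F X" if "\<alpha> \<in> tube_hom C A X Y" "v \<in> VObj ?F Y"
    using that unfolding mor obj by (intro tgt.sum_in_Hom act_in_Hom tube)
  show "VMor ?F X Y \<alpha> (v + w) = VMor ?F X Y \<alpha> v + VMor ?F X Y \<alpha> w"
    if "\<alpha> \<in> tube_hom C A X Y" "v \<in> VObj ?F Y" "w \<in> VObj ?F Y"
    using that unfolding mor obj by (simp add: act_add tube flip: sum.distrib)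
  show "VMor ?F X Y \<alpha> (VScale ?F k v) = VScale ?F k (VMor ?F X Y \<alpha> v)"
    if "\<alpha> \<in> tube_hom C A X Y" "v \<in> VObj ?F Y"
    using that unfolding mor obj sc by (simp add: act_scale tube tgt.vs.scale_sum_right)
  show "VMor ?F X Y (\<lambda>S. \<alpha> S + \<beta> S) v = VMor ?F X Y \<alpha> v + VMor ?F X Y \<beta> v"
    if "\<alpha> \<in> tube_hom C A X Y" "\<beta> \<in> tube_hom C A X Y" "v \<in> VObj ?F Y"
    using that unfolding mor obj by (simp add: act_add_mor tube flip: sum.distrib)
  show "VMor ?F X Y (\<lambda>S. k \<star>\<^bsub>C\<^esub> \<alpha> S) v = VScale ?F k (VMor ?F X Y \<alpha> v)"
    if "\<alpha> \<in> tube_hom C A X Y" "v \<in> VObj ?F Y"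
    using that unfolding mor obj sc by (simp add: act_scale_mor tube tgt.vs.scale_sum_right)
  show "VMor ?F X X (tube_id C A X) v = v" if "v \<in> VObj ?F X"
    using that act_tube_mor[OF src.comp_in_Hom[OF src.lunit_in_Hom src.runit_inv_in_Hom]]
    unfolding mor obj tube_id_def by (simp add: act_unit)
  show "VMor ?F X Z (tube_comp C A X Y Z \<beta> \<alpha>) v = VMor ?F X Y \<alpha> (VMor ?F Y Z \<beta> v)"
    if \<alpha>: "\<alpha> \<in> tube_hom C A X Y" and \<beta>: "\<beta> \<in> tube_hom C A Y Z" and v: "v \<in> VObj ?F Z"
  proof -
    let ?g = "\<lambda>S T. \<a>\<^bsub>C\<^esub> Z S T \<cdot>\<^bsub>C\<^esub> (\<beta> S \<otimes>\<^bsub>C\<^esub> \<iota>\<^bsub>C\<^esub> T) \<cdot>\<^bsub>C\<^esub> assoc_inv C S Y T \<cdot>\<^bsub>C\<^esub> (\<iota>\<^bsub>C\<^esub> S \<otimes>\<^bsub>C\<^esub> \<alpha> T) \<cdot>\<^bsub>C\<^esub> \<a>\<^bsub>C\<^esub> S T X"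
    have v': "v \<in> Hom D (FO M Z) \<one>\<^bsub>D\<^esub>"
      using v obj by simp
    have g: "?g S T \<in> Hom C ((S \<odot>\<^bsub>C\<^esub> T) \<odot>\<^bsub>C\<^esub> X) (Z \<odot>\<^bsub>C\<^esub> (S \<odot>\<^bsub>C\<^esub> T))" if "S \<in> A" "T \<in> A" for S T
      by (rule typing tube[OF \<alpha> that(2)] tube[OF \<beta> that(1)])+
    note tm = tube_mor_in_Hom[OF _ g]
    have "VMor ?F X Z (tube_comp C A X Y Z \<beta> \<alpha>) v
      = (\<Sum>U\<in>A. \<Sum>S\<in>A. \<Sum>T\<in>A. act X Z U (tube_mor C A X Z (S \<odot>\<^bsub>C\<^esub> T) (?g S T) U) v)"
      unfolding mor tube_comp_def
      by (intro sum.cong refl) (simp add: act_sum_mor src.sum_in_Hom tm v')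
    also have "\<dots> = (\<Sum>S\<in>A. \<Sum>U\<in>A. \<Sum>T\<in>A. act X Z U (tube_mor C A X Z (S \<odot>\<^bsub>C\<^esub> T) (?g S T) U) v)"
      by (rule sum.swap)
    also have "\<dots> = (\<Sum>S\<in>A. \<Sum>T\<in>A. \<Sum>U\<in>A. act X Z U (tube_mor C A X Z (S \<odot>\<^bsub>C\<^esub> T) (?g S T) U) v)"
      by (intro sum.cong refl sum.swap)
    also have "\<dots> = (\<Sum>S\<in>A. \<Sum>T\<in>A. act X Y T (\<alpha> T) (act Y Z S (\<beta> S) v))"
      by (intro sum.cong refl) (simp add: act_tube_mor[OF g v'] act_act[OF tube[OF \<alpha>] tube[OF \<beta>] v'])
    also have "\<dots> = (\<Sum>T\<in>A. \<Sum>S\<in>A. act X Y T (\<alpha> T) (act Y Z S (\<beta> S) v))"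
      by (rule sum.swap)
    also have "\<dots> = (\<Sum>T\<in>A. act X Y T (\<alpha> T) (\<Sum>S\<in>A. act Y Z S (\<beta> S) v))"
      by (intro sum.cong refl act_sum[symmetric] tube[OF \<alpha>] act_in_Hom[OF tube[OF \<beta>] v'])
    finally show ?thesis
      unfolding mor .
  qed
qed

end

section \<open>Linear combinations of arrows\<close>

context monoidal_category
begin

lemma tensor_sum_left:
  assumes g: "g \<in> Hom C Z W" and "\<And>i. i \<in> I \<Longrightarrow> f i \<in> Hom C X Y"
  shows "(\<Sum>i\<in>I. f i) \<otimes> g = (\<Sum>i\<in>I. f i \<otimes> g)"
proof -
  have "0 \<otimes> g = 0"
    using tensor_scale_left[OF zero_in_Hom g, of 0] by simp
  then show ?thesis
    using assms(2)
    by (induction I rule: infinite_finite_induct) (auto simp: tensor_add_left[of _ X Y _ g Z W] g sum_in_Hom)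
qed

lemma tensor_sum_right:
  assumes g: "g \<in> Hom C Z W" and "\<And>i. i \<in> I \<Longrightarrow> f i \<in> Hom C X Y"
  shows "g \<otimes> (\<Sum>i\<in>I. f i) = (\<Sum>i\<in>I. g \<otimes> f i)"
proof -
  have "g \<otimes> 0 = 0"
    using tensor_scale_right[OF g zero_in_Hom, of 0] by simp
  then show ?thesis
    using assms(2)
    by (induction I rule: infinite_finite_induct) (auto simp: tensor_add_right[OF g, of _ X Y] sum_in_Hom)
qed

definition scl :: "'k \<Rightarrow> ('o, 'm) arr \<Rightarrow> ('o, 'm) arr" where
  "scl k f = mk (ok f) (adom f) (k \<star> amor f) (acod f)"

lemma scl_simps [simp]: "adom (scl k f) = adom f" "acod (scl k f) = acod f" "ok (scl k f) \<longleftrightarrow> ok f"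
  unfolding scl_def ok_mk by (auto intro: scale_in_Hom dest: ok_in_Hom)

lemma amor_scl: "ok f \<Longrightarrow> amor (scl k f) = k \<star> amor f"
  by (simp add: scl_def mk_def)

lemma nice_scl [simp]: "nice (scl k f)"
  unfolding scl_def by (rule nice_mk) (auto intro: scale_in_Hom dest: ok_in_Hom)

lemma scl_cmp [simp]: "scl k g \<bullet> f = scl k (g \<bullet> f)"
proof (rule arr_eqI)
  assume "ok (scl k (g \<bullet> f))"
  then show "amor (scl k g \<bullet> f) = amor (scl k (g \<bullet> f))"
    using comp_scale_left[OF ok_in_Hom[of f], of "amor g" "ob (acod g)" k] ok_in_Hom[of g]
    by (simp add: amor_simps amor_scl)
qed auto

lemma cmp_scl [simp]: "g \<bullet> scl k f = scl k (g \<bullet> f)"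
proof (rule arr_eqI)
  assume "ok (scl k (g \<bullet> f))"
  then show "amor (g \<bullet> scl k f) = amor (scl k (g \<bullet> f))"
    using comp_scale_right[OF ok_in_Hom[of f], of "amor g" "ob (acod g)" k] ok_in_Hom[of g]
    by (simp add: amor_simps amor_scl)
qed auto

lemma wl_scl [simp]: "wl x (scl k f) = scl k (wl x f)"
proof (rule arr_eqI)
  assume "ok (scl k (wl x f))"
  then show "amor (wl x (scl k f)) = amor (scl k (wl x f))"
    using tensor_scale_right[OF id_in_Hom ok_in_Hom[of f]]
    by (simp add: amor_simps amor_scl)
qed auto

lemma scl_scl [simp]: "scl k (scl l f) = scl (k * l) f"
  by (rule arr_eqI) (auto simp: amor_scl)

lemma scl_one [simp]: "ok f \<Longrightarrow> scl 1 f = f"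
  by (rule arr_ok_eqI) (auto simp: amor_scl)

lemma opr_scale: "f \<in> Hom C X Y \<Longrightarrow> opr X (k \<star> f) Y w = scl k (opr X f Y w)"
  by (rule arr_ok_eqI) (auto simp: amor_scl amor_simps scale_in_Hom tensor_scale_left[OF _ id_in_Hom])

text \<open>Source and target are explicit since the index set may be empty. The flag is always set,
  so well-typed summands become the side condition \<open>typed\<close> of the lemmas.\<close>

definition asum :: "'o list \<Rightarrow> 'o list \<Rightarrow> 'i set \<Rightarrow> ('i \<Rightarrow> ('o, 'm) arr) \<Rightarrow> ('o, 'm) arr" where
  "asum xs ys I F = mk True xs (\<Sum>i\<in>I. amor (F i)) ys"

definition typed :: "'o list \<Rightarrow> 'o list \<Rightarrow> ('o, 'm) arr \<Rightarrow> bool" where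
  "typed xs ys f \<longleftrightarrow> ok f \<and> adom f = xs \<and> acod f = ys"

lemma asum_simps [simp]: "adom (asum xs ys I F) = xs" "acod (asum xs ys I F) = ys"
  by (auto simp: asum_def)

lemma typed_amor: "typed xs ys f \<Longrightarrow> amor f \<in> Hom C (ob xs) (ob ys)"
  using ok_in_Hom by (auto simp: typed_def)

lemma ok_asum: "(\<And>i. i \<in> I \<Longrightarrow> typed xs ys (F i)) \<Longrightarrow> ok (asum xs ys I F)"
  unfolding asum_def ok_mk by (auto intro!: sum_in_Hom typed_amor)

lemma amor_asum: "amor (asum xs ys I F) = (\<Sum>i\<in>I. amor (F i))"
  by (simp add: asum_def mk_def)

lemma asum_cong: "(\<And>i. i \<in> I \<Longrightarrow> F i = G i) \<Longrightarrow> asum xs ys I F = asum xs ys I G"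
  by (simp add: asum_def cong: sum.cong)

lemma cmp_asum:
  assumes "typed ys zs g" "\<And>i. i \<in> I \<Longrightarrow> typed xs ys (F i)"
  shows "g \<bullet> asum xs ys I F = asum xs zs I (\<lambda>i. g \<bullet> F i)"
proof (rule arr_ok_eqI)
  have "typed xs zs (g \<bullet> F i)" if "i \<in> I" for i
    using assms that by (auto simp: typed_def)
  then show "ok (asum xs zs I (\<lambda>i. g \<bullet> F i))"
    by (rule ok_asum)
  show "ok (g \<bullet> asum xs ys I F)"
    using assms ok_asum[OF assms(2)] by (simp add: typed_def)
  then show "amor (g \<bullet> asum xs ys I F) = amor (asum xs zs I (\<lambda>i. g \<bullet> F i))"
    using assms comp_sum_right[OF typed_amor[OF assms(1)] typed_amor[OF assms(2)]]
    by (simp add: amor_asum amor_simps typed_def)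
qed (use assms in \<open>auto simp: typed_def\<close>)

lemma asum_cmp:
  assumes "typed xs ys f" "\<And>i. i \<in> I \<Longrightarrow> typed ys zs (F i)"
  shows "asum ys zs I F \<bullet> f = asum xs zs I (\<lambda>i. F i \<bullet> f)"
proof (rule arr_ok_eqI)
  have "typed xs zs (F i \<bullet> f)" if "i \<in> I" for i
    using assms that by (auto simp: typed_def)
  then show "ok (asum xs zs I (\<lambda>i. F i \<bullet> f))"
    by (rule ok_asum)
  show "ok (asum ys zs I F \<bullet> f)"
    using assms ok_asum[OF assms(2)] by (simp add: typed_def)
  have "(\<Sum>i\<in>I. amor (F i)) \<cdot> amor f = (\<Sum>i\<in>I. amor (F i) \<cdot> amor f)"
    by (rule comp_sum_left[OF typed_amor[OF assms(1)] typed_amor[OF assms(2)]])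
  moreover have "ok (asum ys zs I F)"
    by (rule ok_asum[OF assms(2)])
  moreover have "ok f" "adom (asum ys zs I F) = acod f"
    using assms(1) by (auto simp: typed_def)
  ultimately show "amor (asum ys zs I F \<bullet> f) = amor (asum xs zs I (\<lambda>i. F i \<bullet> f))"
    using assms by (simp add: amor_asum amor_simps(1) typed_def)
qed (use assms in \<open>auto simp: typed_def\<close>)

lemma wl_asum:
  assumes "\<And>i. i \<in> I \<Longrightarrow> typed xs ys (F i)"
  shows "wl x (asum xs ys I F) = asum (x # xs) (x # ys) I (\<lambda>i. wl x (F i))"
proof (rule arr_ok_eqI)
  have "typed (x # xs) (x # ys) (wl x (F i))" if "i \<in> I" for i
    using assms that by (auto simp: typed_def)
  then show "ok (asum (x # xs) (x # ys) I (\<lambda>i. wl x (F i)))"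
    by (rule ok_asum)
  show "ok (wl x (asum xs ys I F))"
    using ok_asum[OF assms] by simp
  then show "amor (wl x (asum xs ys I F)) = amor (asum (x # xs) (x # ys) I (\<lambda>i. wl x (F i)))"
    using assms tensor_sum_right[OF id_in_Hom typed_amor[OF assms]]
    by (simp add: amor_asum amor_simps typed_def)
qed auto

lemma opr_sum:
  assumes "\<And>i. i \<in> I \<Longrightarrow> f i \<in> Hom C X Y"
  shows "opr X (\<Sum>i\<in>I. f i) Y w = asum (X # w) (Y # w) I (\<lambda>i. opr X (f i) Y w)"
proof (rule arr_ok_eqI)
  have s: "(\<Sum>i\<in>I. f i) \<in> Hom C X Y"
    by (rule sum_in_Hom[OF assms])
  then show "ok (opr X (\<Sum>i\<in>I. f i) Y w)"
    by simp
  show "ok (asum (X # w) (Y # w) I (\<lambda>i. opr X (f i) Y w))"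
    by (rule ok_asum) (use assms in \<open>auto simp: typed_def\<close>)
  show "amor (opr X (\<Sum>i\<in>I. f i) Y w) = amor (asum (X # w) (Y # w) I (\<lambda>i. opr X (f i) Y w))"
    using s assms by (simp add: amor_asum amor_simps tensor_sum_left[OF id_in_Hom, of I f X Y])
qed auto

end

context monoidal_functor
begin

lemma mop_scale: "f \<in> Hom C X Y \<Longrightarrow> mop X (k \<star>\<^bsub>C\<^esub> f) Y w = tgt.scl k (mop X f Y w)"
  by (simp add: mop_def FM_scale tgt.opr_scale FM_in_Hom)

lemma FM_sum:
  assumes "\<And>i. i \<in> I \<Longrightarrow> f i \<in> Hom C X Y"
  shows "FM M (\<Sum>i\<in>I. f i) = (\<Sum>i\<in>I. FM M (f i))"
proof -
  have "FM M 0 = 0"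
    using FM_add[OF src.zero_in_Hom src.zero_in_Hom] by simp
  then show ?thesis
    using assms by (induction I rule: infinite_finite_induct) (auto simp: FM_add[of _ X Y] src.sum_in_Hom)
qed

lemma mop_sum:
  assumes "\<And>i. i \<in> I \<Longrightarrow> f i \<in> Hom C X Y"
  shows "mop X (\<Sum>i\<in>I. f i) Y w = tgt.asum (FO M X # w) (FO M Y # w) I (\<lambda>i. mop X (f i) Y w)"
  using assms by (simp add: mop_def FM_sum[OF assms] tgt.opr_sum FM_in_Hom)

end

section \<open>Braided calculus\<close>

locale braided_action =
  src: pre_modular_category C + pivotal_action C D M
  for C :: "('o, 'm::ab_group_add, 'k::alg_closed_field, 'z) braided_cat_scheme"
    and D :: "('p, 'n::ab_group_add, 'k, 'y) mon_cat_scheme"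
    and M :: "('o, 'm, 'p, 'n) mon_fun"
begin

abbreviation ibr where "ibr X Y \<equiv> inv_mor C (X \<odot>\<^bsub>C\<^esub> Y) (Y \<odot>\<^bsub>C\<^esub> X) (\<c>\<^bsub>C\<^esub> X Y)"

definition brm where "brm X Y w = mu Y X w \<bullet> mop (X \<odot>\<^bsub>C\<^esub> Y) (\<c>\<^bsub>C\<^esub> X Y) (Y \<odot>\<^bsub>C\<^esub> X) w \<bullet> mui X Y w"
text \<open>Inverse to \<open>brm X Y\<close>, and therefore starting from the letters in the order
  \<open>Y\<close>, \<open>X\<close>.\<close>

definition bri where "bri X Y w = mu X Y w \<bullet> mop (Y \<odot>\<^bsub>C\<^esub> X) (ibr X Y) (X \<odot>\<^bsub>C\<^esub> Y) w \<bullet> mui Y X w"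

lemmas braid_in_Hom = src.iso_in_Hom[OF src.braid_iso]
lemmas ibr_in_Hom = src.inv_mor_in_Hom[OF src.braid_iso]

lemma dom_cod_br [simp]:
  "adom (brm X Y w) = FO M X # FO M Y # w" "acod (brm X Y w) = FO M Y # FO M X # w"
  "adom (bri X Y w) = FO M Y # FO M X # w" "acod (bri X Y w) = FO M X # FO M Y # w"
  "tgt.ok (brm X Y w)" "tgt.ok (bri X Y w)"
  by (simp_all add: brm_def bri_def braid_in_Hom ibr_in_Hom)

lemma br_inv:
  "brm X Y w \<bullet> bri X Y w = tgt.idn (FO M Y # FO M X # w)"
  "bri X Y w \<bullet> brm X Y w = tgt.idn (FO M X # FO M Y # w)"
  using mop_inverse[OF src.inv_mor_pair[OF src.braid_iso], THEN tgt.reassoc]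
  by (simp_all add: brm_def bri_def braid_in_Hom ibr_in_Hom)

lemma brm_natural:
  "acod h = w \<Longrightarrow> brm X Y w \<bullet> lw X (lw Y h) = lw Y (lw X h) \<bullet> brm X Y (adom h)"
  by (simp add: brm_def mui_natural mop_natural[THEN tgt.reassoc] mu_natural[THEN tgt.reassoc])

lemma bri_natural:
  "acod h = w \<Longrightarrow> bri X Y w \<bullet> lw Y (lw X h) = lw X (lw Y h) \<bullet> bri X Y (adom h)"
  by (simp add: bri_def mui_natural mop_natural[THEN tgt.reassoc] mu_natural[THEN tgt.reassoc])

lemma brm_natural_left:
  assumes "f \<in> Hom C X X'"
  shows "brm X' Y w \<bullet> mop X f X' (FO M Y # w) = lw Y (mop X f X' w) \<bullet> brm X Y w"
proof -
  have "mop (X \<odot>\<^bsub>C\<^esub> Y) (\<c>\<^bsub>C\<^esub> X' Y \<cdot>\<^bsub>C\<^esub> (f \<otimes>\<^bsub>C\<^esub> \<iota>\<^bsub>C\<^esub> Y)) (Y \<odot>\<^bsub>C\<^esub> X') w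
    = mop (X \<odot>\<^bsub>C\<^esub> Y) ((\<iota>\<^bsub>C\<^esub> Y \<otimes>\<^bsub>C\<^esub> f) \<cdot>\<^bsub>C\<^esub> \<c>\<^bsub>C\<^esub> X Y) (Y \<odot>\<^bsub>C\<^esub> X') w"
    by (simp add: src.braid_natural[OF assms src.id_in_Hom])
  then have "mop (X' \<odot>\<^bsub>C\<^esub> Y) (\<c>\<^bsub>C\<^esub> X' Y) (Y \<odot>\<^bsub>C\<^esub> X') w \<bullet> mui X' Y w \<bullet> mop X f X' (FO M Y # w) \<bullet> mu X Y w
    = mui Y X' w \<bullet> lw Y (mop X f X' w) \<bullet> mu Y X w \<bullet> mop (X \<odot>\<^bsub>C\<^esub> Y) (\<c>\<^bsub>C\<^esub> X Y) (Y \<odot>\<^bsub>C\<^esub> X) w"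
    using assms by (simp add: mop_comp[OF src.tensor_in_Hom[OF assms src.id_in_Hom] braid_in_Hom]
        mop_comp[OF braid_in_Hom src.tensor_in_Hom[OF src.id_in_Hom assms]]
        mop_tensor[OF assms src.id_in_Hom] mop_tensor[OF src.id_in_Hom assms] braid_in_Hom)
  then have "mu Y X' w \<bullet> (mop (X' \<odot>\<^bsub>C\<^esub> Y) (\<c>\<^bsub>C\<^esub> X' Y) (Y \<odot>\<^bsub>C\<^esub> X') w \<bullet> mui X' Y w \<bullet> mop X f X' (FO M Y # w) \<bullet> mu X Y w) \<bullet> mui X Y w
    = mu Y X' w \<bullet> (mui Y X' w \<bullet> lw Y (mop X f X' w) \<bullet> mu Y X w \<bullet> mop (X \<odot>\<^bsub>C\<^esub> Y) (\<c>\<^bsub>C\<^esub> X Y) (Y \<odot>\<^bsub>C\<^esub> X) w) \<bullet> mui X Y w"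
    by (simp only:)
  then show ?thesis
    using assms by (simp add: brm_def braid_in_Hom)
qed

lemma brm_natural_right:
  assumes "g \<in> Hom C Y Y'"
  shows "brm X Y' w \<bullet> lw X (mop Y g Y' w) = mop Y g Y' (FO M X # w) \<bullet> brm X Y w"
proof -
  have "mop (X \<odot>\<^bsub>C\<^esub> Y) (\<c>\<^bsub>C\<^esub> X Y' \<cdot>\<^bsub>C\<^esub> (\<iota>\<^bsub>C\<^esub> X \<otimes>\<^bsub>C\<^esub> g)) (Y' \<odot>\<^bsub>C\<^esub> X) w
    = mop (X \<odot>\<^bsub>C\<^esub> Y) ((g \<otimes>\<^bsub>C\<^esub> \<iota>\<^bsub>C\<^esub> X) \<cdot>\<^bsub>C\<^esub> \<c>\<^bsub>C\<^esub> X Y) (Y' \<odot>\<^bsub>C\<^esub> X) w"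
    by (simp add: src.braid_natural[OF src.id_in_Hom assms])
  then have "mop (X \<odot>\<^bsub>C\<^esub> Y') (\<c>\<^bsub>C\<^esub> X Y') (Y' \<odot>\<^bsub>C\<^esub> X) w \<bullet> mui X Y' w \<bullet> lw X (mop Y g Y' w) \<bullet> mu X Y w
    = mui Y' X w \<bullet> mop Y g Y' (FO M X # w) \<bullet> mu Y X w \<bullet> mop (X \<odot>\<^bsub>C\<^esub> Y) (\<c>\<^bsub>C\<^esub> X Y) (Y \<odot>\<^bsub>C\<^esub> X) w"
    using assms by (simp add: mop_comp[OF src.tensor_in_Hom[OF src.id_in_Hom assms] braid_in_Hom]
        mop_comp[OF braid_in_Hom src.tensor_in_Hom[OF assms src.id_in_Hom]]
        mop_tensor[OF assms src.id_in_Hom] mop_tensor[OF src.id_in_Hom assms] braid_in_Hom)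
  then have "mu Y' X w \<bullet> (mop (X \<odot>\<^bsub>C\<^esub> Y') (\<c>\<^bsub>C\<^esub> X Y') (Y' \<odot>\<^bsub>C\<^esub> X) w \<bullet> mui X Y' w \<bullet> lw X (mop Y g Y' w) \<bullet> mu X Y w) \<bullet> mui X Y w
    = mu Y' X w \<bullet> (mui Y' X w \<bullet> mop Y g Y' (FO M X # w) \<bullet> mu Y X w \<bullet> mop (X \<odot>\<^bsub>C\<^esub> Y) (\<c>\<^bsub>C\<^esub> X Y) (Y \<odot>\<^bsub>C\<^esub> X) w) \<bullet> mui X Y w"
    by (simp only:)
  then show ?thesis
    using assms by (simp add: brm_def braid_in_Hom)
qed

lemma brm_tensor_right:
  "lw Y (brm X Z w) \<bullet> brm X Y (FO M Z # w) = mu Y Z (FO M X # w) \<bullet> brm X (Y \<odot>\<^bsub>C\<^esub> Z) w \<bullet> lw X (mui Y Z w)"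
proof -
  let ?m = "\<lambda>f. mop ((X \<odot>\<^bsub>C\<^esub> Y) \<odot>\<^bsub>C\<^esub> Z) f (Y \<odot>\<^bsub>C\<^esub> (Z \<odot>\<^bsub>C\<^esub> X)) w"
  let ?c = "\<lambda>f. lw Y (mu Z X w) \<bullet> mu Y (Z \<odot>\<^bsub>C\<^esub> X) w \<bullet> f \<bullet> mui (X \<odot>\<^bsub>C\<^esub> Y) Z w \<bullet> mui X Y (FO M Z # w)"
  have "?c (?m (\<a>\<^bsub>C\<^esub> Y Z X \<cdot>\<^bsub>C\<^esub> \<c>\<^bsub>C\<^esub> X (Y \<odot>\<^bsub>C\<^esub> Z) \<cdot>\<^bsub>C\<^esub> \<a>\<^bsub>C\<^esub> X Y Z))
    = mu Y Z (FO M X # w) \<bullet> brm X (Y \<odot>\<^bsub>C\<^esub> Z) w \<bullet> lw X (mui Y Z w)"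
    by ((subst mop_comp, (rule typing braid_in_Hom)+)+) (simp add: mop_coherence brm_def braid_in_Hom)
  moreover have "?c (?m ((\<iota>\<^bsub>C\<^esub> Y \<otimes>\<^bsub>C\<^esub> \<c>\<^bsub>C\<^esub> X Z) \<cdot>\<^bsub>C\<^esub> \<a>\<^bsub>C\<^esub> Y X Z \<cdot>\<^bsub>C\<^esub> (\<c>\<^bsub>C\<^esub> X Y \<otimes>\<^bsub>C\<^esub> \<iota>\<^bsub>C\<^esub> Z)))
    = lw Y (brm X Z w) \<bullet> brm X Y (FO M Z # w)"
    by ((subst mop_comp, (rule typing braid_in_Hom)+)+)
       (simp add: mop_coherence mop_tensor src.id_in_Hom brm_def braid_in_Hom)
  ultimately show ?thesis
    by (simp only: src.hexagon)
qed

lemma brm_tensor_left: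
  "brm X Z (FO M Y # w) \<bullet> lw X (brm Y Z w) = lw Z (mu X Y w) \<bullet> brm (X \<odot>\<^bsub>C\<^esub> Y) Z w \<bullet> mui X Y (FO M Z # w)"
proof -
  let ?m = "\<lambda>f. mop (X \<odot>\<^bsub>C\<^esub> (Y \<odot>\<^bsub>C\<^esub> Z)) f ((Z \<odot>\<^bsub>C\<^esub> X) \<odot>\<^bsub>C\<^esub> Y) w"
  let ?c = "\<lambda>f. mu Z X (FO M Y # w) \<bullet> mu (Z \<odot>\<^bsub>C\<^esub> X) Y w \<bullet> f \<bullet> mui X (Y \<odot>\<^bsub>C\<^esub> Z) w \<bullet> lw X (mui Y Z w)"
  have "?c (?m (assoc_inv C Z X Y \<cdot>\<^bsub>C\<^esub> \<c>\<^bsub>C\<^esub> (X \<odot>\<^bsub>C\<^esub> Y) Z \<cdot>\<^bsub>C\<^esub> assoc_inv C X Y Z))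
    = lw Z (mu X Y w) \<bullet> brm (X \<odot>\<^bsub>C\<^esub> Y) Z w \<bullet> mui X Y (FO M Z # w)"
    by ((subst mop_comp, (rule typing braid_in_Hom)+)+) (simp add: mop_coherence brm_def braid_in_Hom)
  moreover have "?c (?m ((\<c>\<^bsub>C\<^esub> X Z \<otimes>\<^bsub>C\<^esub> \<iota>\<^bsub>C\<^esub> Y) \<cdot>\<^bsub>C\<^esub> assoc_inv C X Z Y \<cdot>\<^bsub>C\<^esub> (\<iota>\<^bsub>C\<^esub> X \<otimes>\<^bsub>C\<^esub> \<c>\<^bsub>C\<^esub> Y Z)))
    = brm X Z (FO M Y # w) \<bullet> lw X (brm Y Z w)"
    by ((subst mop_comp, (rule typing braid_in_Hom)+)+)
       (simp add: mop_coherence mop_tensor src.id_in_Hom brm_def braid_in_Hom)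
  ultimately show ?thesis
    by (simp only: src.hexagon_inv)
qed

text \<open>The hexagon for the product of two units, compared with naturality along its
  identification with one unit, shows two crossings where there is one. Crossings are invertible, so
  one of them cancels.\<close>

lemma brm_unit_right: "me (FO M X # w) \<bullet> brm X \<one>\<^bsub>C\<^esub> w = lw X (me w)"
proof -
  let ?b = "brm X \<one>\<^bsub>C\<^esub>"
  have "?b w \<bullet> lw X (me (FO M \<one>\<^bsub>C\<^esub> # w)) = me (FO M \<one>\<^bsub>C\<^esub> # FO M X # w) \<bullet> (mu \<one>\<^bsub>C\<^esub> \<one>\<^bsub>C\<^esub> (FO M X # w)
      \<bullet> brm X (\<one>\<^bsub>C\<^esub> \<odot>\<^bsub>C\<^esub> \<one>\<^bsub>C\<^esub>) w \<bullet> lw X (mui \<one>\<^bsub>C\<^esub> \<one>\<^bsub>C\<^esub> w))" for w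
    using brm_natural_right[OF src.lunit_in_Hom[of "\<one>\<^bsub>C\<^esub>"], of X w, THEN tgt.reassoc[of _ _ _ "lw X (mui \<one>\<^bsub>C\<^esub> \<one>\<^bsub>C\<^esub> w)"]]
    by (simp add: mop_lunit)
  then have 1: "?b w \<bullet> lw X (me (FO M \<one>\<^bsub>C\<^esub> # w)) = ?b w \<bullet> me (FO M X # FO M \<one>\<^bsub>C\<^esub> # w) \<bullet> ?b (FO M \<one>\<^bsub>C\<^esub> # w)" for w
    by (simp add: brm_tensor_right[symmetric] me_natural[THEN tgt.reassoc])
  have 2: "lw X (me (FO M \<one>\<^bsub>C\<^esub> # w)) = me (FO M X # FO M \<one>\<^bsub>C\<^esub> # w) \<bullet> ?b (FO M \<one>\<^bsub>C\<^esub> # w)" for w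
    using arg_cong[OF 1, of "\<lambda>f. bri X \<one>\<^bsub>C\<^esub> w \<bullet> f" w] by (simp add: tgt.reassoc[OF br_inv(2)])
  have "me (FO M X # w) \<bullet> (?b w \<bullet> lw X (lw \<one>\<^bsub>C\<^esub> (me w))) = lw X (me w) \<bullet> lw X (lw \<one>\<^bsub>C\<^esub> (me w))"
    by (simp add: brm_natural me_natural[THEN tgt.reassoc] 2[symmetric])
       (simp add: me_natural[THEN tgt.wl2])
  then have "(me (FO M X # w) \<bullet> (?b w \<bullet> lw X (lw \<one>\<^bsub>C\<^esub> (me w)))) \<bullet> lw X (lw \<one>\<^bsub>C\<^esub> (mei w))
    = (lw X (me w) \<bullet> lw X (lw \<one>\<^bsub>C\<^esub> (me w))) \<bullet> lw X (lw \<one>\<^bsub>C\<^esub> (mei w))"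
    by simp
  then show ?thesis
    by simp
qed

text \<open>The strand \<open>X\<close> can be pulled off a cup: the hexagon merges its crossings
  with the two legs into one crossing with the product, and naturality reduces that to a crossing
  with the unit.\<close>

lemma cupm_under:
  assumes "k \<in> Hom C \<one>\<^bsub>C\<^esub> (P \<odot>\<^bsub>C\<^esub> Q)"
  shows "lw P (brm X Q w) \<bullet> brm X P (FO M Q # w) \<bullet> lw X (cupm k P Q w) = cupm k P Q (FO M X # w)"
proof -
  have u: "brm X \<one>\<^bsub>C\<^esub> w \<bullet> lw X (mei w) = mei (FO M X # w)"
    using arg_cong[OF brm_unit_right, of "\<lambda>f. mei (FO M X # w) \<bullet> f \<bullet> lw X (mei w)" X w] by simp
  show ?thesis
    using assms by (simp add: brm_tensor_right[THEN tgt.reassoc] cupm_def brm_natural_right[THEN tgt.reassoc] u)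
qed

subsection \<open>Twists\<close>

lemma right_partial_trace_in_Hom:
  assumes "f \<in> Hom C (X \<odot>\<^bsub>C\<^esub> Y) (Z \<odot>\<^bsub>C\<^esub> Y)"
  shows "right_partial_trace C X Y Z f \<in> Hom C X Z"
  unfolding right_partial_trace_def by (rule typing assms)+

lemma mop_right_partial_trace:
  assumes "f \<in> Hom C (X \<odot>\<^bsub>C\<^esub> Y) (Z \<odot>\<^bsub>C\<^esub> Y)"
  shows "mop X (right_partial_trace C X Y Z f) Z w
    = lw Z (pevm Y w) \<bullet> mu Z Y (FO M (du Y) # w) \<bullet> mop (X \<odot>\<^bsub>C\<^esub> Y) f (Z \<odot>\<^bsub>C\<^esub> Y) (FO M (du Y) # w)
      \<bullet> mui X Y (FO M (du Y) # w) \<bullet> lw X (coevm Y w)"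
  unfolding right_partial_trace_def
  by ((subst mop_comp, (rule typing assms)+)+)
     (simp add: mop_tensor mop_coherence typing assms pevm_def coevm_def capm_def cupm_def)

abbreviation twm where "twm X w \<equiv> mop X (twist C X) X w"

lemma twist_in_Hom: "twist C X \<in> Hom C X X"
  unfolding twist_def by (rule right_partial_trace_in_Hom[OF braid_in_Hom])

lemma twm_eq: "twm X w = lw X (pevm X w) \<bullet> brm X X (FO M (du X) # w) \<bullet> lw X (coevm X w)"
  unfolding twist_def by (simp add: mop_right_partial_trace[OF braid_in_Hom] brm_def)

text \<open>The two kinks formed from the inverse crossing, closed on the left here and on the right
  in \<open>rtw\<close>. Each is to be identified with the inverse twist, the right one for simple
  objects only.\<close>

definition ltw where "ltw X w = evm X (FO M X # w) \<bullet> lw (du X) (bri X X w) \<bullet> pcoevm X (FO M X # w)"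
definition rtw where "rtw X w = lw X (pevm X w) \<bullet> bri X X (FO M (du X) # w) \<bullet> lw X (coevm X w)"

lemma ltw_simps [simp]:
  "adom (ltw X w) = FO M X # w" "acod (ltw X w) = FO M X # w" "tgt.ok (ltw X w)"
  "adom (rtw X w) = FO M X # w" "acod (rtw X w) = FO M X # w" "tgt.ok (rtw X w)"
  by (simp_all add: ltw_def rtw_def)

lemma ltw_natural: "acod h = w \<Longrightarrow> ltw X w \<bullet> lw X h = lw X h \<bullet> ltw X (adom h)"
  by (simp add: ltw_def pcoevm_natural bri_natural[THEN tgt.wl2, THEN tgt.reassoc] evm_natural[THEN tgt.reassoc])

lemma rtw_mop: "rtw X w = mop X (right_partial_trace C X X X (ibr X X)) X w"
  by (simp add: mop_right_partial_trace[OF ibr_in_Hom] rtw_def bri_def)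

text \<open>Pulling the strand off the cup inside the kink, by \<open>cupm_under\<close>, leaves a
  single inverse crossing below a cap.\<close>

lemma evm_twist: "evm X w \<bullet> lw (du X) (twm X w) = pevm X w \<bullet> bri X (du X) w"
proof -
  have "lw X (bri X (du X) w) \<bullet> (lw X (brm X (du X) w) \<bullet> brm X X (FO M (du X) # w) \<bullet> lw X (coevm X w))
    = lw X (bri X (du X) w) \<bullet> coevm X (FO M X # w)"
    using cupm_under[OF src.coev_in_Hom, of X X w] by (simp add: coevm_def)
  then have "brm X X (FO M (du X) # w) \<bullet> lw X (coevm X w) = lw X (bri X (du X) w) \<bullet> coevm X (FO M X # w)"
    by (simp add: br_inv(2)[THEN tgt.wl2_id, THEN tgt.reassoc])
  then show ?thesis
    by (simp add: twm_eq nats' zigs')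
qed

text \<open>Again \<open>cupm_under\<close> opens a kink, now the left one, into a single crossing.
  With \<open>evm_twist\<close> this relates the two kinks through a crossing and its
  inverse.\<close>

lemma evm_brm: "evm X w \<bullet> brm X (du X) w = pevm X w \<bullet> ltw X (FO M (du X) # w)"
proof -
  let ?w = "FO M (du X) # w"
  have "lw (du X) (bri X X ?w) \<bullet> (lw (du X) (brm X X ?w) \<bullet> brm X (du X) (FO M X # ?w) \<bullet> lw X (pcoevm X ?w))
    = lw (du X) (bri X X ?w) \<bullet> pcoevm X (FO M X # ?w)"
    using cupm_under[OF piv_coev_in_Hom, of X X ?w] by (simp add: pcoevm_def)
  then have "ltw X ?w = evm X (FO M X # ?w) \<bullet> brm X (du X) (FO M X # ?w) \<bullet> lw X (pcoevm X ?w)"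
    by (simp add: br_inv(2)[THEN tgt.wl2_id, THEN tgt.reassoc] ltw_def)
  then have "pevm X w \<bullet> ltw X ?w = evm X w \<bullet> (lw (du X) (lw X (pevm X w)) \<bullet> brm X (du X) (FO M X # ?w)) \<bullet> lw X (pcoevm X ?w)"
    by (simp add: evm_natural[THEN tgt.reassoc])
  also have "\<dots> = evm X w \<bullet> brm X (du X) w \<bullet> lw X (lw (du X) (pevm X w)) \<bullet> lw X (pcoevm X ?w)"
    by (simp add: brm_natural[THEN tgt.reassoc])
  finally show ?thesis
    by (simp add: zigs')
qed

text \<open>The Whitney trick.\<close>

lemma ltw_twm: "ltw X w \<bullet> twm X w = tgt.idn (FO M X # w)"
proof -
  \<comment> \<open>Below a cap, insert a crossing and its inverse and turn each of them into a
    kink; both kinks end up on the strand of \<open>X\<close>.\<close>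
  have pev: "pevm X w = pevm X w \<bullet> ltw X (FO M (du X) # w) \<bullet> twm X (FO M (du X) # w)" for w
  proof -
    have "pevm X w = (pevm X w \<bullet> bri X (du X) w) \<bullet> brm X (du X) w"
      by (simp add: br_inv(2))
    also have "\<dots> = evm X w \<bullet> (lw (du X) (twm X w) \<bullet> brm X (du X) w)"
      by (simp add: evm_twist[symmetric])
    also have "\<dots> = (evm X w \<bullet> brm X (du X) w) \<bullet> twm X (FO M (du X) # w)"
      by (simp add: brm_natural_left[OF twist_in_Hom, symmetric])
    finally show ?thesis
      by (simp add: evm_brm)
  qed
  have "tgt.idn (FO M X # w) = pevm X (FO M X # w) \<bullet> lw X (pcoevm X w)"
    by (simp add: zig_pev')
  also have "\<dots> = pevm X (FO M X # w) \<bullet> ltw X (FO M (du X) # FO M X # w) \<bullet> twm X (FO M (du X) # FO M X # w) \<bullet> lw X (pcoevm X w)"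
    using pev[of "FO M X # w"] by (metis tgt.cmp_assoc)
  also have "\<dots> = (pevm X (FO M X # w) \<bullet> lw X (pcoevm X w)) \<bullet> ltw X w \<bullet> twm X w"
    by (simp add: mop_natural ltw_natural[THEN tgt.reassoc])
  finally show ?thesis
    by (simp add: zig_pev' twist_in_Hom)
qed

text \<open>Both sides close the inverse crossing completely, one strand to the left and the other
  to the right; they differ only in which strand is closed first.\<close>

lemma ltw_rtw_trace: "evm X w \<bullet> lw (du X) (rtw X w) \<bullet> pcoevm X w = pevm X w \<bullet> ltw X (FO M (du X) # w) \<bullet> coevm X w"
proof -
  have "pevm X w \<bullet> ltw X (FO M (du X) # w) \<bullet> coevm X w
    = evm X w \<bullet> lw (du X) (lw X (pevm X w)) \<bullet> lw (du X) (bri X X (FO M (du X) # w)) \<bullet> pcoevm X (FO M X # FO M (du X) # w) \<bullet> coevm X w"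
    by (simp add: ltw_def evm_natural[THEN tgt.reassoc])
  also have "pcoevm X (FO M X # FO M (du X) # w) \<bullet> coevm X w = lw (du X) (lw X (coevm X w)) \<bullet> pcoevm X w"
    by (simp add: pcoevm_natural)
  finally show ?thesis
    by (simp add: rtw_def)
qed

end

section \<open>Dimensions\<close>

locale spherical_action =
  src: spherical_fusion_category C + pivotal_action C D M
  for C :: "('o, 'm::ab_group_add, 'k::alg_closed_field, 'z) piv_cat_scheme"
    and D :: "('p, 'n::ab_group_add, 'k, 'y) mon_cat_scheme"
    and M :: "('o, 'm, 'p, 'n) mon_fun"
begin

lemma right_trace_in_Hom: "f \<in> Hom C X X \<Longrightarrow> right_trace C X f \<in> Hom C \<one>\<^bsub>C\<^esub> \<one>\<^bsub>C\<^esub>"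
  unfolding right_trace_def by (rule typing | assumption)+

lemma right_trace_id: "right_trace C X (\<iota>\<^bsub>C\<^esub> X) = qdim C X \<star>\<^bsub>C\<^esub> \<iota>\<^bsub>C\<^esub> \<one>\<^bsub>C\<^esub>"
proof -
  obtain k where k: "right_trace C X (\<iota>\<^bsub>C\<^esub> X) = k \<star>\<^bsub>C\<^esub> \<iota>\<^bsub>C\<^esub> \<one>\<^bsub>C\<^esub>"
    using src.schur_scalar[OF src.unit_simple right_trace_in_Hom[OF src.id_in_Hom]] by blast
  then have "qdim C X = k"
    unfolding qdim_def using src.scale_id_inject[OF src.unit_simple] by (intro the_equality) auto
  with k show ?thesis
    by simp
qed

lemma pevm_coevm: "pevm X w \<bullet> coevm X w = tgt.scl (qdim C X) (tgt.idn w)"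
proof -
  have "me w \<bullet> mop \<one>\<^bsub>C\<^esub> (right_trace C X (\<iota>\<^bsub>C\<^esub> X)) \<one>\<^bsub>C\<^esub> w \<bullet> mei w = pevm X w \<bullet> coevm X w"
    unfolding right_trace_def
    by ((subst mop_comp, (rule typing)+)+)
       (simp add: src.tensor_id typing pevm_def coevm_def capm_def cupm_def)
  then show ?thesis
    by (simp add: right_trace_id mop_scale src.id_in_Hom)
qed

text \<open>The left loop has the same value as the right one by sphericality.\<close>

lemma evm_pcoevm: "evm X w \<bullet> pcoevm X w = tgt.scl (qdim C X) (tgt.idn w)"
proof -
  have "me w \<bullet> mop \<one>\<^bsub>C\<^esub> (left_trace C X (\<iota>\<^bsub>C\<^esub> X)) \<one>\<^bsub>C\<^esub> w \<bullet> mei w = evm X w \<bullet> pcoevm X w"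
    unfolding left_trace_def
    by ((subst mop_comp, (rule typing)+)+)
       (simp add: src.tensor_id typing evm_def pcoevm_def capm_def cupm_def)
  then show ?thesis
    by (simp add: src.spherical[OF src.id_in_Hom] right_trace_id mop_scale src.id_in_Hom)
qed

end

lemma (in spherical_fusion_category) idf_spherical_action: "spherical_action C C (idf C)"
  using idf_pivotal_action spherical_fusion_category_axioms by (simp add: spherical_action_def)

context monoidal_category
begin

lemma opr_mop_faithful:
  assumes "f \<in> Hom C X Y" "g \<in> Hom C X Y"
    "monoidal_functor.mop C (idf C) X f Y [] = monoidal_functor.mop C (idf C) X g Y []"
  shows "f = g"
  using assms opr_cong_faithful by (simp add: idf_coherence)

lemma scl_idn_inject:
  assumes "simple_object C \<one>" "scl a (idn []) = scl b (idn [])"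
  shows "a = b"
  using arg_cong[OF assms(2), of amor] scale_id_inject[OF assms(1)] by (simp add: amor_scl amor_simps)

end

context spherical_fusion_category
begin

text \<open>Semisimplicity provides a morphism \<open>q\<close> from \<open>X \<odot> dual X\<close>
  to the unit that does not kill the coevaluation. Bending \<open>q\<close> and Schur's lemma make
  it a multiple of the right evaluation, so its nonzero value on the coevaluation is a multiple of
  the dimension.\<close>

lemma qdim_nonzero:
  assumes A: "complete_set_of_simples C A" and one: "\<one> \<in> A" and X: "simple_object C X"
  shows "qdim C X \<noteq> 0"
proof -
  interpret self: spherical_action C C "idf C"
    by (rule idf_spherical_action)
  \<comment> \<open>Otherwise the zigzag identity would make the identity of \<open>X\<close>
    zero.\<close>
  have "coev X \<noteq> 0"
  proof
    assume 0: "coev X = 0"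
    have "self.cupm (k \<star> coev X) X (dual X) w = scl k (self.cupm (coev X) X (dual X) w)" for k w
      by (simp add: self.cupm_def self.mop_scale coev_in_Hom)
    from this[of 0] 0 have "self.coevm X w = scl 0 (self.coevm X w)" for w
      by (simp add: self.coevm_def)
    then have "idn (FO (idf C) X # []) = scl 0 (idn (FO (idf C) X # []))"
      using self.zig_ev[of X "[]"] by (metis cmp_scl)
    then have "self.mop X (\<iota> X) X [] = self.mop X (0 \<star> \<iota> X) X []"
      by (simp only: self.mop_scale[OF id_in_Hom] self.mop_id)
    then have "\<iota> X = 0"
      using opr_mop_faithful[OF id_in_Hom scale_in_Hom[OF id_in_Hom], of X 0] by simp
    then show False
      using simple_id_nonzero[OF X] by simp
  qed
  obtain B d where Bd: "dual_bases C \<one> (X \<odot> dual X) (B, d)"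
    using ex_dual_bases[OF A one] by (metis surj_pair)
  note ex = dual_bases_expand[OF A one Bd]
  have "(\<Sum>b\<in>B. b \<cdot> (d b \<cdot> coev X)) \<noteq> 0"
    using ex(4)[OF coev_in_Hom] \<open>coev X \<noteq> 0\<close> by simp
  then obtain b where b: "b \<in> B" "b \<cdot> (d b \<cdot> coev X) \<noteq> 0"
    by (meson sum.not_neutral_contains_not_neutral)
  then have nz: "d b \<cdot> coev X \<noteq> 0"
    using comp_zero_right[OF ex(2)] by auto
  define q where "q = d b"
  have q: "q \<in> Hom C (X \<odot> dual X) \<one>"
    unfolding q_def by (rule ex(3)[OF b(1)])
  \<comment> \<open>The endomorphism of \<open>X\<close> obtained by bending the dual leg of
    \<open>q\<close>; a zigzag recovers \<open>q\<close> from it.\<close>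
  define t where "t = \<l> X \<cdot> (q \<otimes> \<iota> X) \<cdot> assoc_inv C X (dual X) X \<cdot> (\<iota> X \<otimes> piv_coev C X) \<cdot> runit_inv C X"
  have t: "t \<in> Hom C X X"
    unfolding t_def by (rule self.typing q)+
  have mt: "self.mop X t X w = self.capm q X (dual X) (FO (idf C) X # w) \<bullet> self.lw X (self.pcoevm X w)" for w
    unfolding t_def
    by ((subst self.mop_comp, (rule self.typing q)+)+)
       (simp add: self.mop_tensor self.mop_coherence self.typing self.pcoevm_def self.capm_def self.cupm_def q)
  have "self.capm q X (dual X) [] = self.pevm X [] \<bullet> self.mop X t X (FO (idf C) (dual X) # [])"
  proof -
    have "self.pevm X [] \<bullet> self.mop X t X (FO (idf C) (dual X) # [])
      = self.capm q X (dual X) [] \<bullet> self.lw X (self.lw (dual X) (self.pevm X []) \<bullet> self.pcoevm X (FO (idf C) (dual X) # []))"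
      by (simp add: mt self.caps')
    then show ?thesis
      using q by (simp only: self.zig_pev) simp
  qed
  moreover obtain k where "t = k \<star> \<iota> X"
    using schur_scalar[OF X t] by blast
  ultimately have "self.capm q X (dual X) [] = scl k (self.pevm X [])"
    by (simp add: self.mop_scale id_in_Hom)
  then have "self.capm q X (dual X) [] \<bullet> self.coevm X [] = scl (k * qdim C X) (idn [])"
    by (simp add: self.pevm_coevm)
  moreover have "self.capm q X (dual X) [] \<bullet> self.coevm X [] = self.me [] \<bullet> self.mop \<one> (q \<cdot> coev X) \<one> [] \<bullet> self.mei []"
    by (simp add: self.capm_def self.coevm_def self.cupm_def self.mop_comp[OF coev_in_Hom q] coev_in_Hom)
  moreover obtain s where s: "q \<cdot> coev X = s \<star> \<iota> \<one>"
    using schur_scalar[OF unit_simple comp_in_Hom[OF coev_in_Hom q]] by blast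
  ultimately have "scl (k * qdim C X) (idn []) = scl s (idn [])"
    by (simp add: self.mop_scale id_in_Hom)
  then have "k * qdim C X = s"
    by (rule scl_idn_inject[OF unit_simple])
  moreover have "s \<noteq> 0"
    using nz s by (auto simp: q_def)
  ultimately show ?thesis
    by auto
qed

text \<open>Schur's lemma for duals of simple objects, obtained by transporting morphisms back to
  \<open>S\<close> and \<open>T\<close>. This bypasses simplicity of the duals themselves, a
  statement about monics.\<close>

lemma dual_simples_Hom:
  assumes A: "complete_set_of_simples C A" and ST: "S \<in> A" "T \<in> A" and g: "g \<in> Hom C (dual S) (dual T)"
  shows "if S = T then \<exists>k. g = k \<star> \<iota> (dual T) else g = 0"
proof -
  interpret self: spherical_action C C "idf C"
    by (rule idf_spherical_action)
  \<comment> \<open>The morphism from \<open>T\<close> to \<open>S\<close> whose dual is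
    \<open>g\<close>; \<open>eq\<close> expresses this relation through the caps.\<close>
  define h where "h = inv_mor C S (dual (dual S)) (\<pi> S) \<cdot> (dual_mor C (dual S) (dual T) g \<cdot> \<pi> T)"
  note gd = self.dual_mor_in_Hom[OF g]
  have h: "h \<in> Hom C T S"
    unfolding h_def by (rule self.typing gd)+
  have eq: "self.pevm T w \<bullet> self.lw T (self.mop (dual S) g (dual T) w) = self.pevm S w \<bullet> self.mop T h S (FO (idf C) (dual S) # w)" for w
  proof -
    have "self.pevm T w \<bullet> self.lw T (self.mop (dual S) g (dual T) w)
      = (self.evm (dual T) w \<bullet> self.lw (dual (dual T)) (self.mop (dual S) g (dual T) w)) \<bullet> self.pim T (FO (idf C) (dual S) # w)"
      by (simp add: self.pevm_eq self.mop_natural)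
    also have "\<dots> = self.pevm S w \<bullet> self.mop T h S (FO (idf C) (dual S) # w)"
      by (simp add: self.evm_slide[OF g] self.pevm_eq h_def gd self.piv_in_Hom self.pim_inv[THEN reassoc]
          self.mop_comp[OF self.piv_in_Hom gd] self.mop_comp[OF comp_in_Hom[OF self.piv_in_Hom gd] self.piv_inv_in_Hom])
    finally show ?thesis .
  qed
  have inj: "g = k \<star> f" if f: "f \<in> Hom C (dual S) (dual T)"
    and e: "self.pevm T [] \<bullet> self.lw T (self.mop (dual S) g (dual T) []) = scl k (self.pevm T [] \<bullet> self.lw T (self.mop (dual S) f (dual T) []))" for k f
  proof -
    have "self.mop (dual S) g (dual T) [] = self.mop (dual S) (k \<star> f) (dual T) []"
      by (rule self.pevm_inj[of _ _ T "[]"]) (use e in \<open>simp_all add: g f self.mop_scale scale_in_Hom\<close>)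
    then show ?thesis
      using opr_mop_faithful[OF g scale_in_Hom[OF f]] by blast
  qed
  show ?thesis
  proof (cases "S = T")
    case True
    obtain k where "h = k \<star> \<iota> T"
      using schur_scalar[OF simples[OF A ST(2)]] h True by auto
    then have "self.pevm T [] \<bullet> self.lw T (self.mop (dual S) g (dual T) []) = scl k (self.pevm T [])"
      using eq[of "[]"] True by (simp add: self.mop_scale id_in_Hom)
    then have "g = k \<star> \<iota> (dual T)"
      using True by (intro inj id_in_Hom) (simp_all add: id_in_Hom)
    then show ?thesis
      using True by auto
  next
    case False
    then have "h = 0"
      using Hom_simples_zero[OF A ST(2,1) _ h] by simp
    then have z: "self.mop T h S (FO (idf C) (dual S) # []) = scl 0 (self.mop T h S (FO (idf C) (dual S) # []))"
      using self.mop_scale[OF h, of 0] by simp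
    have "self.pevm S [] \<bullet> self.mop T h S (FO (idf C) (dual S) # [])
      = scl 0 (self.pevm S [] \<bullet> self.mop T h S (FO (idf C) (dual S) # []))"
      by (subst z) simp
    then have "self.pevm T [] \<bullet> self.lw T (self.mop (dual S) g (dual T) []) = scl 0 (self.pevm T [] \<bullet> self.lw T (self.mop (dual S) g (dual T) []))"
      by (simp only: eq)
    then have "g = 0 \<star> g"
      by (rule inj[OF g])
    then show ?thesis
      using False by simp
  qed
qed

text \<open>Dualising is additive and reverses composites; both facts are checked below the cap
  \<open>evm\<close>, which determines the arrow. The result writes an object as a sum of duals of
  simple objects.\<close>

lemma dual_decomposition:
  assumes ip: "\<And>j. j < n \<Longrightarrow> i j \<in> Hom C (T j) X" "\<And>j. j < n \<Longrightarrow> p j \<in> Hom C X (T j)"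
    "(\<Sum>j<(n::nat). i j \<cdot> p j) = \<iota> X"
  shows "(\<Sum>j<n. dual_mor C X (T j) (p j) \<cdot> dual_mor C (T j) X (i j)) = \<iota> (dual X)"
proof -
  interpret self: spherical_action C C "idf C"
    by (rule idf_spherical_action)
  let ?h = "\<lambda>j. dual_mor C X (T j) (p j) \<cdot> dual_mor C (T j) X (i j)"
  have d: "dual_mor C X (T j) (p j) \<in> Hom C (dual (T j)) (dual X)" "dual_mor C (T j) X (i j) \<in> Hom C (dual X) (dual (T j))"
    if "j < n" for j
    using that by (auto intro: self.dual_mor_in_Hom ip)
  have h: "?h j \<in> Hom C (dual X) (dual X)" if "j < n" for j
    by (rule comp_in_Hom[OF d(2) d(1)]) (use that in auto)
  have ipH: "i j \<cdot> p j \<in> Hom C X X" if "j < n" for j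
    by (rule comp_in_Hom[OF ip(2) ip(1)]) (use that in auto)
  let ?x = "FO (idf C) X" and ?d = "FO (idf C) (dual X)"
  have "self.evm X w \<bullet> self.mop (dual X) (?h j) (dual X) (?x # w)
    = self.evm X w \<bullet> self.lw (dual X) (self.mop X (i j \<cdot> p j) X w)" if j: "j < n" for j w
  proof -
    have "self.evm X w \<bullet> self.mop (dual X) (?h j) (dual X) (?x # w)
      = (self.evm (T j) w \<bullet> self.lw (dual (T j)) (self.mop X (p j) (T j) w)) \<bullet> self.mop (dual X) (dual_mor C (T j) X (i j)) (dual (T j)) (?x # w)"
      by (simp add: self.evm_slide[OF ip(2)[OF j]] self.mop_comp[OF d(2)[OF j] d(1)[OF j]])
    also have "\<dots> = (self.evm (T j) w \<bullet> self.mop (dual X) (dual_mor C (T j) X (i j)) (dual (T j)) (FO (idf C) (T j) # w)) \<bullet> self.lw (dual X) (self.mop X (p j) (T j) w)"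
      by (simp add: self.mop_natural)
    finally show ?thesis
      by (simp add: self.evm_slide[OF ip(1)[OF j], symmetric] self.mop_comp[OF ip(2)[OF j] ip(1)[OF j]])
  qed
  then have eq: "self.evm X w \<bullet> self.mop (dual X) (\<Sum>j<n. ?h j) (dual X) (?x # w) = self.evm X w" for w
  proof -
    assume *: "\<And>j w. j < n \<Longrightarrow> self.evm X w \<bullet> self.mop (dual X) (?h j) (dual X) (?x # w)
      = self.evm X w \<bullet> self.lw (dual X) (self.mop X (i j \<cdot> p j) X w)"
    have ty: "typed (?d # ?x # w) w (self.evm X w)"
      by (simp add: typed_def)
    have "self.evm X w \<bullet> self.mop (dual X) (\<Sum>j<n. ?h j) (dual X) (?x # w)
      = asum (?d # ?x # w) w {..<n} (\<lambda>j. self.evm X w \<bullet> self.mop (dual X) (?h j) (dual X) (?x # w))"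
      by (subst self.mop_sum[of "{..<n}" ?h "dual X" "dual X"], use h in simp,
          rule cmp_asum[OF ty], use h in \<open>auto simp: typed_def\<close>)
    also have "\<dots> = asum (?d # ?x # w) w {..<n} (\<lambda>j. self.evm X w \<bullet> self.lw (dual X) (self.mop X (i j \<cdot> p j) X w))"
      by (rule asum_cong) (simp add: *)
    also have "\<dots> = self.evm X w \<bullet> self.lw (dual X) (self.mop X (\<Sum>j<n. i j \<cdot> p j) X w)"
      by (subst self.mop_sum[of "{..<n}" "\<lambda>j. i j \<cdot> p j" X X], use ipH in simp,
          subst wl_asum[of _ "?x # w" "?x # w"], use ipH in \<open>simp add: typed_def\<close>,
          rule cmp_asum[OF ty, symmetric], use ipH in \<open>auto simp: typed_def\<close>)
    finally show ?thesis
      by (simp add: ip(3))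
  qed
  have H: "(\<Sum>j<n. ?h j) \<in> Hom C (dual X) (dual X)"
    by (rule sum_in_Hom) (use h in auto)
  let ?m = "self.mop (dual X) (\<Sum>j<n. ?h j) (dual X)"
  have "?m [] = (self.evm X (?d # []) \<bullet> self.lw (dual X) (self.coevm X [])) \<bullet> ?m []"
    using H by (simp add: self.zig_ev')
  also have "\<dots> = (self.evm X (?d # []) \<bullet> ?m (?x # ?d # [])) \<bullet> self.lw (dual X) (self.coevm X [])"
    by (simp add: self.mop_natural)
  also have "\<dots> = idn (?d # [])"
    by (simp only: eq self.zig_ev')
  finally have "?m [] = self.mop (dual X) (\<iota> (dual X)) (dual X) []"
    by simp
  then show ?thesis
    by (rule opr_mop_faithful[OF H id_in_Hom])
qed

end

section \<open>Bending dual bases\<close>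

context pivotal_category
begin

text \<open>
  A morphism \<open>b : U \<rightarrow> T S\<close> is bent to \<open>T\<^sup>\<or> \<rightarrow> S U\<^sup>\<or>\<close>, and \<open>d : T S \<rightarrow> U\<close> to
  \<open>S U\<^sup>\<or> \<rightarrow> T\<^sup>\<or>\<close>, in two steps each.
\<close>

definition flat :: "'o \<Rightarrow> 'o \<Rightarrow> 'o \<Rightarrow> 'm \<Rightarrow> 'm" where
  "flat T S U b = \<l> S \<cdot> (ev T \<otimes> \<iota> S) \<cdot> assoc_inv C (dual T) T S \<cdot> (\<iota> (dual T) \<otimes> b)"

definition sharp :: "'o \<Rightarrow> 'o \<Rightarrow> 'o \<Rightarrow> 'm \<Rightarrow> 'm" where
  "sharp T S U d = (\<iota> (dual T) \<otimes> d) \<cdot> \<a> (dual T) T S \<cdot> (piv_coev C T \<otimes> \<iota> S) \<cdot> lunit_inv C S"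

definition bend :: "'o \<Rightarrow> 'o \<Rightarrow> 'o \<Rightarrow> 'm \<Rightarrow> 'm" where
  "bend T S U b = (flat T S U b \<otimes> \<iota> (dual U)) \<cdot> assoc_inv C (dual T) U (dual U)
     \<cdot> (\<iota> (dual T) \<otimes> coev U) \<cdot> runit_inv C (dual T)"

definition cobend :: "'o \<Rightarrow> 'o \<Rightarrow> 'o \<Rightarrow> 'm \<Rightarrow> 'm" where
  "cobend T S U d = \<r> (dual T) \<cdot> (\<iota> (dual T) \<otimes> piv_ev C U) \<cdot> \<a> (dual T) U (dual U)
     \<cdot> (sharp T S U d \<otimes> \<iota> (dual U))"

definition unbend :: "'o \<Rightarrow> 'o \<Rightarrow> 'o \<Rightarrow> 'm \<Rightarrow> 'm" where
  "unbend T S U g = (\<iota> T \<otimes> (\<r> S \<cdot> (\<iota> S \<otimes> ev U) \<cdot> \<a> S (dual U) U \<cdot> (g \<otimes> \<iota> U)))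
     \<cdot> \<a> T (dual T) U \<cdot> (coev T \<otimes> \<iota> U) \<cdot> lunit_inv C U"

end

context pivotal_action
begin

lemma bend_in_Hom:
  "b \<in> Hom C U (T \<odot>\<^bsub>C\<^esub> S) \<Longrightarrow> src.flat T S U b \<in> Hom C (du T \<odot>\<^bsub>C\<^esub> U) S"
  "d \<in> Hom C (T \<odot>\<^bsub>C\<^esub> S) U \<Longrightarrow> src.sharp T S U d \<in> Hom C S (du T \<odot>\<^bsub>C\<^esub> U)"
  "b \<in> Hom C U (T \<odot>\<^bsub>C\<^esub> S) \<Longrightarrow> src.bend T S U b \<in> Hom C (du T) (S \<odot>\<^bsub>C\<^esub> du U)"
  "d \<in> Hom C (T \<odot>\<^bsub>C\<^esub> S) U \<Longrightarrow> src.cobend T S U d \<in> Hom C (S \<odot>\<^bsub>C\<^esub> du U) (du T)"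
  "g \<in> Hom C (du T) (S \<odot>\<^bsub>C\<^esub> du U) \<Longrightarrow> src.unbend T S U g \<in> Hom C U (T \<odot>\<^bsub>C\<^esub> S)"
  unfolding src.bend_def src.cobend_def src.flat_def src.sharp_def src.unbend_def
  by (rule typing | assumption)+

definition flatm where "flatm T S U b w = evm T (FO M S # w) \<bullet> lw (du T) (mu T S w \<bullet> mop U b (T \<odot>\<^bsub>C\<^esub> S) w)"
definition sharpm where "sharpm T S U d w = lw (du T) (mop (T \<odot>\<^bsub>C\<^esub> S) d U w \<bullet> mui T S w) \<bullet> pcoevm T (FO M S # w)"
definition bendm where "bendm T S U b w = flatm T S U b (FO M (du U) # w) \<bullet> lw (du T) (coevm U w)"
definition cobendm where "cobendm T S U d w = lw (du T) (pevm U w) \<bullet> sharpm T S U d (FO M (du U) # w)"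

lemma bendm_simps [simp]:
  "adom (flatm T S U b w) = FO M (du T) # FO M U # w" "acod (flatm T S U b w) = FO M S # w"
  "adom (sharpm T S U d w) = FO M S # w" "acod (sharpm T S U d w) = FO M (du T) # FO M U # w"
  "adom (bendm T S U b w) = FO M (du T) # w" "acod (bendm T S U b w) = FO M S # FO M (du U) # w"
  "adom (cobendm T S U d w) = FO M S # FO M (du U) # w" "acod (cobendm T S U d w) = FO M (du T) # w"
  by (simp_all add: flatm_def sharpm_def bendm_def cobendm_def)

lemma bendm_ok [simp]:
  "b \<in> Hom C U (T \<odot>\<^bsub>C\<^esub> S) \<Longrightarrow> tgt.ok (flatm T S U b w)"
  "d \<in> Hom C (T \<odot>\<^bsub>C\<^esub> S) U \<Longrightarrow> tgt.ok (sharpm T S U d w)"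
  "b \<in> Hom C U (T \<odot>\<^bsub>C\<^esub> S) \<Longrightarrow> tgt.ok (bendm T S U b w)"
  "d \<in> Hom C (T \<odot>\<^bsub>C\<^esub> S) U \<Longrightarrow> tgt.ok (cobendm T S U d w)"
  by (simp_all add: flatm_def sharpm_def bendm_def cobendm_def)

lemma flatm_natural:
  "acod h = w \<Longrightarrow> flatm T S U b w \<bullet> lw (du T) (lw U h) = lw S h \<bullet> flatm T S U b (adom h)"
  by (simp add: flatm_def mop_natural[THEN tgt.wl2, THEN tgt.reassoc] mop_natural[THEN tgt.wl2] mu_natural[THEN tgt.wl2, THEN tgt.reassoc]
      evm_natural[THEN tgt.reassoc])

lemma sharpm_natural:
  "acod h = w \<Longrightarrow> sharpm T S U d w \<bullet> lw S h = lw (du T) (lw U h) \<bullet> sharpm T S U d (adom h)"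
  by (simp add: sharpm_def pcoevm_natural mui_natural[THEN tgt.wl2, THEN tgt.reassoc] mop_natural[THEN tgt.wl2, THEN tgt.reassoc])

lemma bendm_natural:
  "acod h = w \<Longrightarrow> bendm T S U b w \<bullet> lw (du T) h = lw S (lw (du U) h) \<bullet> bendm T S U b (adom h)"
  by (simp add: bendm_def coevm_natural[THEN tgt.wl2] flatm_natural[THEN tgt.reassoc])

lemma mop_flat:
  assumes "b \<in> Hom C U (T \<odot>\<^bsub>C\<^esub> S)"
  shows "mop (du T \<odot>\<^bsub>C\<^esub> U) (src.flat T S U b) S w = flatm T S U b w \<bullet> mu (du T) U w"
  unfolding src.flat_def
  by ((subst mop_comp, (rule typing assms)+)+)
     (simp add: mop_tensor mop_coherence typing assms flatm_def evm_def capm_def)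

lemma mop_sharp:
  assumes "d \<in> Hom C (T \<odot>\<^bsub>C\<^esub> S) U"
  shows "mop S (src.sharp T S U d) (du T \<odot>\<^bsub>C\<^esub> U) w = mui (du T) U w \<bullet> sharpm T S U d w"
  unfolding src.sharp_def
  by ((subst mop_comp, (rule typing assms)+)+)
     (simp add: mop_tensor mop_coherence typing assms sharpm_def pcoevm_def cupm_def)

lemma mop_bend:
  assumes "b \<in> Hom C U (T \<odot>\<^bsub>C\<^esub> S)"
  shows "mop (du T) (src.bend T S U b) (S \<odot>\<^bsub>C\<^esub> du U) w = mui S (du U) w \<bullet> bendm T S U b w"
proof -
  note f = bend_in_Hom(1)[OF assms]
  show ?thesis
    unfolding src.bend_def
    by ((subst mop_comp, (rule typing f)+)+)
       (simp add: mop_tensor mop_coherence typing f mop_flat[OF assms] assms bendm_def coevm_def cupm_def)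
qed

lemma mop_cobend:
  assumes "d \<in> Hom C (T \<odot>\<^bsub>C\<^esub> S) U"
  shows "mop (S \<odot>\<^bsub>C\<^esub> du U) (src.cobend T S U d) (du T) w = cobendm T S U d w \<bullet> mu S (du U) w"
proof -
  note f = bend_in_Hom(2)[OF assms]
  show ?thesis
    unfolding src.cobend_def
    by ((subst mop_comp, (rule typing f)+)+)
       (simp add: mop_tensor mop_coherence typing f mop_sharp[OF assms] assms cobendm_def pevm_def capm_def)
qed

lemma mop_unbend:
  assumes "g \<in> Hom C (du T) (S \<odot>\<^bsub>C\<^esub> du U)"
  shows "mop U (src.unbend T S U g) (T \<odot>\<^bsub>C\<^esub> S) w = mui T S w \<bullet> lw T (lw S (evm U w) \<bullet> mu S (du U) (FO M U # w)
    \<bullet> mop (du T) g (S \<odot>\<^bsub>C\<^esub> du U) (FO M U # w)) \<bullet> coevm T (FO M U # w)"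
proof -
  have f: "\<r>\<^bsub>C\<^esub> S \<cdot>\<^bsub>C\<^esub> (\<iota>\<^bsub>C\<^esub> S \<otimes>\<^bsub>C\<^esub> ev\<^bsub>C\<^esub> U) \<cdot>\<^bsub>C\<^esub> \<a>\<^bsub>C\<^esub> S (du U) U \<cdot>\<^bsub>C\<^esub> (g \<otimes>\<^bsub>C\<^esub> \<iota>\<^bsub>C\<^esub> U) \<in> Hom C (du T \<odot>\<^bsub>C\<^esub> U) S"
    by (rule typing assms)+
  show ?thesis
    unfolding src.unbend_def
    apply ((subst mop_comp, (rule typing assms)+)+)
    apply (subst mop_tensor[OF src.id_in_Hom f])
    apply ((subst mop_comp, (rule typing assms)+)+)
    apply (simp add: mop_tensor mop_coherence typing assms evm_def coevm_def cupm_def capm_def)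
    done
qed

text \<open>The two bends of \<open>unbend\<close> meet those of \<open>bend\<close> in two zigzags,
  one for \<open>T\<close> and one for \<open>U\<close>. Hence every morphism of this type is bent
  from one into \<open>T \<odot> S\<close>.\<close>

lemma bend_unbend_m:
  assumes g: "g \<in> Hom C (du T) (S \<odot>\<^bsub>C\<^esub> du U)"
  shows "bendm T S U (src.unbend T S U g) w = mu S (du U) w \<bullet> mop (du T) g (S \<odot>\<^bsub>C\<^esub> du U) w"
proof -
  let ?u = "FO M (du U) # w" and ?x = "FO M U"
  define h where "h = (\<lambda>w. mu S (du U) w \<bullet> mop (du T) g (S \<odot>\<^bsub>C\<^esub> du U) w)"
  have h_nat: "h w \<bullet> lw (du T) k = lw S (lw (du U) k) \<bullet> h (adom k)" if "acod k = w" for k w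
    using that by (simp add: h_def mop_natural mu_natural[THEN tgt.reassoc])
  have h_simps [simp]: "adom (h w) = FO M (du T) # w" "acod (h w) = FO M S # FO M (du U) # w" "tgt.ok (h w)" for w
    using g by (simp_all add: h_def)
  have "bendm T S U (src.unbend T S U g) w
    = evm T (FO M S # ?u) \<bullet> lw (du T) (lw T (lw S (evm U ?u) \<bullet> h (?x # ?u))) \<bullet> lw (du T) (coevm T (?x # ?u)) \<bullet> lw (du T) (coevm U w)"
    by (simp add: bendm_def flatm_def mop_unbend[OF g] h_def g)
  also have "\<dots> = lw S (evm U ?u) \<bullet> h (?x # ?u) \<bullet> (evm T (FO M (du T) # ?x # ?u) \<bullet> lw (du T) (coevm T (?x # ?u))) \<bullet> lw (du T) (coevm U w)"
    by (simp add: evm_natural[THEN tgt.reassoc])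
  also have "\<dots> = lw S (evm U ?u) \<bullet> (h (?x # ?u) \<bullet> lw (du T) (coevm U w))"
    by (simp add: zig_ev')
  also have "\<dots> = lw S (evm U ?u) \<bullet> lw S (lw (du U) (coevm U w)) \<bullet> h w"
    by (simp add: h_nat)
  finally show ?thesis
    by (simp add: zigs') (simp add: h_def)
qed

text \<open>Closing up with \<open>T\<close> on the left pulls the strand of \<open>T\<close> straight.\<close>

lemma cobend_bend_trace:
  assumes x: "x \<in> Hom C U (T \<odot>\<^bsub>C\<^esub> S)" and d: "d \<in> Hom C (T \<odot>\<^bsub>C\<^esub> S) U"
  shows "pevm T w \<bullet> lw T (cobendm T S U d w \<bullet> bendm T S U x w) \<bullet> coevm T w
    = pevm U w \<bullet> mop U (d \<cdot>\<^bsub>C\<^esub> x) U (FO M (du U) # w) \<bullet> coevm U w"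
proof -
  let ?u = "FO M (du U) # w"
  let ?uu = "FO M U # ?u" and ?s = "FO M S # ?u" and ?t = "FO M T # FO M S # ?u"
  let ?d = "mop (T \<odot>\<^bsub>C\<^esub> S) d U ?u \<bullet> mui T S ?u" and ?x = "mu T S ?u \<bullet> mop U x (T \<odot>\<^bsub>C\<^esub> S) ?u"
  have "pevm T w \<bullet> lw T (cobendm T S U d w \<bullet> bendm T S U x w) \<bullet> coevm T w
    = (pevm T w \<bullet> lw T (lw (du T) (pevm U w))) \<bullet> lw T (sharpm T S U d ?u \<bullet> flatm T S U x ?u) \<bullet> (lw T (lw (du T) (coevm U w)) \<bullet> coevm T w)"
    by (simp add: cobendm_def bendm_def)
  also have "\<dots> = pevm U w \<bullet> (pevm T ?uu \<bullet> lw T (sharpm T S U d ?u \<bullet> flatm T S U x ?u) \<bullet> coevm T ?uu) \<bullet> coevm U w"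
    using coevm_natural[of "coevm U w" _ T, OF refl] by (simp add: pevm_natural pevm_natural[THEN tgt.reassoc])
  also have "pevm T ?uu \<bullet> lw T (sharpm T S U d ?u \<bullet> flatm T S U x ?u) \<bullet> coevm T ?uu
    = (pevm T ?uu \<bullet> lw T (lw (du T) ?d)) \<bullet> lw T (pcoevm T ?s) \<bullet> lw T (evm T ?s) \<bullet> (lw T (lw (du T) ?x) \<bullet> coevm T ?uu)"
    by (simp add: sharpm_def flatm_def)
  also have "lw T (lw (du T) ?x) \<bullet> coevm T ?uu = coevm T ?t \<bullet> ?x"
    using coevm_natural[of ?x _ T, OF refl] by simp
  also have "pevm T ?uu \<bullet> lw T (lw (du T) ?d) = ?d \<bullet> pevm T ?t"
    using pevm_natural[of ?d _ T, OF refl] by simp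
  also have "(?d \<bullet> pevm T ?t) \<bullet> lw T (pcoevm T ?s) \<bullet> lw T (evm T ?s) \<bullet> (coevm T ?t \<bullet> ?x)
    = ?d \<bullet> (pevm T ?t \<bullet> lw T (pcoevm T ?s)) \<bullet> (lw T (evm T ?s) \<bullet> coevm T ?t) \<bullet> ?x"
    by simp
  also have "\<dots> = mop U (d \<cdot>\<^bsub>C\<^esub> x) U ?u"
    using x d by (simp only: zig_pev' zig_ev) (simp add: mop_comp)
  finally show ?thesis .
qed

end

context spherical_fusion_category
begin

lemma bend_sum:
  assumes "\<And>i. i \<in> I \<Longrightarrow> f i \<in> Hom C U (T \<odot> S)"
  shows "bend T S U (\<Sum>i\<in>I. f i) = (\<Sum>i\<in>I. bend T S U (f i))"
proof -
  interpret self: spherical_action C C "idf C"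
    by (rule idf_spherical_action)
  note ty = self.typing assms
  have 1: "flat T S U (\<Sum>i\<in>I. f i) = (\<Sum>i\<in>I. flat T S U (f i))"
    unfolding flat_def
    apply (subst tensor_sum_right[of _ "dual T" "dual T" _ _ U "T \<odot> S"], (rule ty | assumption)+)
    apply (subst comp_sum_right, (rule ty | assumption)+)
    apply (rule refl)
    done
  note ty = self.typing self.bend_in_Hom(1) assms
  show ?thesis
    unfolding bend_def 1
    apply (subst tensor_sum_left[of _ "dual U" "dual U" _ _ "dual T \<odot> U" S], (rule ty | assumption)+)
    apply (subst comp_sum_left, (rule ty | assumption)+)+
    apply (rule refl)
    done
qed

lemma bend_scale:
  assumes "f \<in> Hom C U (T \<odot> S)"
  shows "bend T S U (k \<star> f) = k \<star> bend T S U f"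
proof -
  interpret self: spherical_action C C "idf C"
    by (rule idf_spherical_action)
  have "self.mop (dual T) (bend T S U (k \<star> f)) (S \<odot> dual U) [] = self.mop (dual T) (k \<star> bend T S U f) (S \<odot> dual U) []"
    using assms by (simp add: self.mop_scale self.mop_bend self.bend_in_Hom scale_in_Hom self.bendm_def self.flatm_def)
  then show ?thesis
    using assms by (intro opr_mop_faithful[of _ "dual T" "S \<odot> dual U"] scale_in_Hom self.bend_in_Hom)
qed

text \<open>Bent dual bases pair, for equal basis vectors, to d(U) / d(T) times the identity: this
  is read off by closing the strand of \<open>T\<close>. The weight \<open>qdim C T\<close>
  compensates for it, so the sum is a resolution of the identity scaled by
  \<open>qdim C U\<close>.\<close>

theorem bend_resolution:
  assumes A: "complete_set_of_simples C A" and fin: "finite A" and U: "U \<in> A"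
    and Bd: "\<And>T. T \<in> A \<Longrightarrow> dual_bases C U (T \<odot> S) (B T, d T)"
  shows "(\<Sum>T\<in>A. \<Sum>b\<in>B T. qdim C T \<star> (bend T S U b \<cdot> cobend T S U (d T b))) = qdim C U \<star> \<iota> (S \<odot> dual U)"
    (is "?N = _")
proof -
  interpret self: spherical_action C C "idf C"
    by (rule idf_spherical_action)
  note ex = dual_bases_expand[OF A U Bd]
  let ?Q = "S \<odot> dual U"
  have bH: "bend T S U b \<in> Hom C (dual T) ?Q" and cH: "cobend T S U (d T b) \<in> Hom C ?Q (dual T)" if "T \<in> A" "b \<in> B T" for T b
    using that by (auto intro: self.bend_in_Hom ex)
  have bcH: "bend T S U b \<cdot> cobend T S U (d T b) \<in> Hom C ?Q ?Q" if "T \<in> A" "b \<in> B T" for T b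
    by (rule comp_in_Hom[OF cH bH]) (use that in auto)
  have NH: "?N \<in> Hom C ?Q ?Q"
    by (intro sum_in_Hom scale_in_Hom bcH)
  \<comment> \<open>Tests the sum on a morphism from the dual of a simple object; such a
    \<open>g\<close> is the bend of some \<open>x\<close>, which can be expanded in the given
    basis.\<close>
  have N: "?N \<cdot> g = qdim C U \<star> g" if R: "R \<in> A" and g: "g \<in> Hom C (dual R) ?Q" for R g
  proof -
    define x where "x = unbend R S U g"
    have x: "x \<in> Hom C U (R \<odot> S)"
      unfolding x_def by (rule self.bend_in_Hom(5)[OF g])
    have gx: "bend R S U x = g"
    proof (rule opr_mop_faithful[OF self.bend_in_Hom(3)[OF x] g])
      show "self.mop (dual R) (bend R S U x) ?Q [] = self.mop (dual R) g ?Q []"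
        using g by (simp add: self.mop_bend[OF x]) (simp add: x_def self.bend_unbend_m)
    qed
    have cg: "cobend T S U (d T b) \<cdot> g \<in> Hom C (dual R) (dual T)" if "T \<in> A" "b \<in> B T" for T b
      by (rule comp_in_Hom[OF g cH[OF that]])
    have tm: "qdim C T \<star> (bend T S U b \<cdot> (cobend T S U (d T b) \<cdot> g))
      = (if T = R then qdim C U \<star> bend R S U (b \<cdot> (d R b \<cdot> x)) else 0)" if T: "T \<in> A" and b: "b \<in> B T" for T b
    proof (cases "T = R")
      case True
      have dH: "d R b \<in> Hom C (R \<odot> S) U" and bH': "b \<in> Hom C U (R \<odot> S)"
        using ex T b True by auto
      obtain k where k: "cobend T S U (d T b) \<cdot> g = k \<star> \<iota> (dual R)"
        using dual_simples_Hom[OF A R T cg[OF T b]] True by auto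
      obtain s where s: "d R b \<cdot> x = s \<star> \<iota> U"
        using schur_scalar[OF simples[OF A U] comp_in_Hom[OF x dH]] by blast
      have "self.mop (dual R) (cobend R S U (d R b) \<cdot> g) (dual R) [] = self.cobendm R S U (d R b) [] \<bullet> self.bendm R S U x []"
        using x dH by (simp add: gx[symmetric] self.mop_comp[OF self.bend_in_Hom(3)[OF x] self.bend_in_Hom(4)[OF dH]]
            self.mop_bend self.mop_cobend)
      then have "self.cobendm R S U (d R b) [] \<bullet> self.bendm R S U x [] = scl k (idn (FO (idf C) (dual R) # []))"
        using k True by (simp add: self.mop_scale id_in_Hom)
      then have "self.pevm R [] \<bullet> self.lw R (scl k (idn (FO (idf C) (dual R) # []))) \<bullet> self.coevm R []
        = self.pevm U [] \<bullet> self.mop U (s \<star> \<iota> U) U (FO (idf C) (dual U) # []) \<bullet> self.coevm U []"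
        using self.cobend_bend_trace[OF x dH, of "[]"] s by simp
      then have "scl (k * qdim C R) (idn []) = scl (s * qdim C U) (idn [])"
        by (simp add: self.mop_scale id_in_Hom self.pevm_coevm)
      \<comment> \<open>\<open>k\<close> is the scalar of the bent pairing and \<open>s\<close> that
        of the original one; closing up the strands compares them through the dimensions of
        \<open>R\<close> and \<open>U\<close>.\<close>
      then have ks: "k * qdim C R = s * qdim C U"
        by (rule scl_idn_inject[OF unit_simple])
      have "bend R S U b \<cdot> (k \<star> \<iota> (dual R)) = k \<star> bend R S U b"
        using comp_scale_right[OF id_in_Hom] comp_id self.bend_in_Hom(3)[OF bH'] by simp
      moreover have "b \<cdot> (s \<star> \<iota> U) = s \<star> b"
        using comp_scale_right[OF id_in_Hom] comp_id bH' by simp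
      ultimately show ?thesis
        using True k s ks bend_scale[OF bH'] by (simp add: mult.commute)
    next
      case False
      then have "cobend T S U (d T b) \<cdot> g = 0"
        using dual_simples_Hom[OF A R T cg[OF T b]] by simp
      then show ?thesis
        using False comp_zero_right[OF bH[OF T b]] by simp
    qed
    have "?N \<cdot> g = (\<Sum>T\<in>A. (\<Sum>b\<in>B T. qdim C T \<star> (bend T S U b \<cdot> cobend T S U (d T b))) \<cdot> g)"
      by (rule comp_sum_left[OF g, where Z = ?Q]) (intro sum_in_Hom scale_in_Hom bcH)
    also have "\<dots> = (\<Sum>T\<in>A. \<Sum>b\<in>B T. qdim C T \<star> (bend T S U b \<cdot> (cobend T S U (d T b) \<cdot> g)))"
    proof (intro sum.cong refl)
      fix T assume T: "T \<in> A"
      have "(\<Sum>b\<in>B T. qdim C T \<star> (bend T S U b \<cdot> cobend T S U (d T b))) \<cdot> g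
        = (\<Sum>b\<in>B T. (qdim C T \<star> (bend T S U b \<cdot> cobend T S U (d T b))) \<cdot> g)"
        by (rule comp_sum_left[OF g, where Z = ?Q]) (intro scale_in_Hom bcH T)
      also have "\<dots> = (\<Sum>b\<in>B T. qdim C T \<star> (bend T S U b \<cdot> (cobend T S U (d T b) \<cdot> g)))"
        using comp_scale_left[OF g bcH[OF T]] comp_assoc[OF g cH[OF T] bH[OF T]] by (intro sum.cong) auto
      finally show "(\<Sum>b\<in>B T. qdim C T \<star> (bend T S U b \<cdot> cobend T S U (d T b))) \<cdot> g
        = (\<Sum>b\<in>B T. qdim C T \<star> (bend T S U b \<cdot> (cobend T S U (d T b) \<cdot> g)))" .
    qed
    also have "\<dots> = (\<Sum>T\<in>A. if T = R then \<Sum>b\<in>B R. qdim C U \<star> bend R S U (b \<cdot> (d R b \<cdot> x)) else 0)"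
      by (intro sum.cong refl) (auto simp: tm)
    also have "\<dots> = (\<Sum>b\<in>B R. qdim C U \<star> bend R S U (b \<cdot> (d R b \<cdot> x)))"
      using fin R by simp
    also have "\<dots> = qdim C U \<star> bend R S U (\<Sum>b\<in>B R. b \<cdot> (d R b \<cdot> x))"
    proof -
      have "b \<cdot> (d R b \<cdot> x) \<in> Hom C U (R \<odot> S)" if "b \<in> B R" for b
        by (rule comp_in_Hom[OF comp_in_Hom[OF x ex(3)] ex(2)]) (use that R in auto)
      then show ?thesis
        by (simp add: bend_sum vs.scale_sum_right)
    qed
    finally show ?thesis
      using ex(4)[OF R x] gx by simp
  qed
  \<comment> \<open>Such test morphisms suffice: a decomposition of the dual of \<open>?Q\<close>
    dualises to one of the double dual into duals of simple objects, and the pivotal structure leads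
    back to \<open>?Q\<close>.\<close>
  obtain n T i p where T: "\<And>j. j < n \<Longrightarrow> T j \<in> A"
    and ip: "\<And>j. j < n \<Longrightarrow> i j \<in> Hom C (T j) (dual ?Q)" "\<And>j. j < n \<Longrightarrow> p j \<in> Hom C (dual ?Q) (T j)"
      "(\<Sum>j<(n::nat). i j \<cdot> p j) = \<iota> (dual ?Q)"
    using ex_decomposition[OF A, of "dual ?Q"] by blast
  define P where "P = (\<lambda>j. dual_mor C (dual ?Q) (T j) (p j))"
  define I where "I = (\<lambda>j. dual_mor C (T j) (dual ?Q) (i j))"
  have PI: "(\<Sum>j<n. P j \<cdot> I j) = \<iota> (dual (dual ?Q))"
    unfolding P_def I_def by (rule dual_decomposition[OF ip])
  have PH: "P j \<in> Hom C (dual (T j)) (dual (dual ?Q))" and IH: "I j \<in> Hom C (dual (dual ?Q)) (dual (T j))" if "j < n" for j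
    unfolding P_def I_def using that by (auto intro: self.dual_mor_in_Hom ip)
  let ?pi = "inv_mor C ?Q (dual (dual ?Q)) (\<pi> ?Q)"
  note piH = self.piv_inv_in_Hom[of ?Q]
  define N where "N = ?N"
  have lin: "E \<cdot> ?pi = (\<Sum>j<n. (E \<cdot> (?pi \<cdot> P j)) \<cdot> I j)" if E: "E \<in> Hom C ?Q ?Q" for E
  proof -
    have "E \<cdot> ?pi = (E \<cdot> ?pi) \<cdot> (\<Sum>j<n. P j \<cdot> I j)"
      using comp_id[OF comp_in_Hom[OF piH E]] PI by simp
    also have "\<dots> = (\<Sum>j<n. (E \<cdot> ?pi) \<cdot> (P j \<cdot> I j))"
      by (rule comp_sum_right[OF comp_in_Hom[OF piH E], where X = "dual (dual ?Q)"]) (auto intro!: comp_in_Hom IH PH)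
    also have "\<dots> = (\<Sum>j<n. (E \<cdot> (?pi \<cdot> P j)) \<cdot> I j)"
    proof (intro sum.cong refl)
      fix j assume "j \<in> {..<n}"
      then have j: "j < n" by simp
      have "(E \<cdot> ?pi) \<cdot> (P j \<cdot> I j) = ((E \<cdot> ?pi) \<cdot> P j) \<cdot> I j"
        by (rule comp_assoc[OF IH[OF j] PH[OF j] comp_in_Hom[OF piH E], symmetric])
      then show "(E \<cdot> ?pi) \<cdot> (P j \<cdot> I j) = (E \<cdot> (?pi \<cdot> P j)) \<cdot> I j"
        using comp_assoc[OF PH[OF j] piH E] by simp
    qed
    finally show ?thesis .
  qed
  have "N \<cdot> ?pi = (\<Sum>j<n. (qdim C U \<star> (?pi \<cdot> P j)) \<cdot> I j)"
    using lin[OF NH] N[OF T comp_in_Hom[OF PH piH]] unfolding N_def by simp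
  also have "\<dots> = (\<Sum>j<n. ((qdim C U \<star> \<iota> ?Q) \<cdot> (?pi \<cdot> P j)) \<cdot> I j)"
    using comp_scale_left[OF comp_in_Hom[OF PH piH] id_in_Hom] id_comp[OF comp_in_Hom[OF PH piH]]
    by (intro sum.cong) auto
  also have "\<dots> = (qdim C U \<star> \<iota> ?Q) \<cdot> ?pi"
    by (rule lin[OF scale_in_Hom[OF id_in_Hom], symmetric])
  finally have "(N \<cdot> ?pi) \<cdot> \<pi> ?Q = ((qdim C U \<star> \<iota> ?Q) \<cdot> ?pi) \<cdot> \<pi> ?Q"
    by simp
  then show ?thesis
    using comp_assoc[OF self.piv_in_Hom piH NH] comp_assoc[OF self.piv_in_Hom piH scale_in_Hom[OF id_in_Hom]]
      inv_mor_left[OF piv_iso] comp_id[OF NH] comp_id[OF scale_in_Hom[OF id_in_Hom]]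
    unfolding N_def by simp
qed

end

section \<open>Twist scalars\<close>

lemma (in pre_modular_category) idf_braided_action: "braided_action C C (idf C)"
  using idf_pivotal_action pre_modular_category_axioms by (simp add: braided_action_def)

sublocale braided_action \<subseteq> spherical_action
  by unfold_locales

context pre_modular_category
begin

lemma twist_eq:
  assumes X: "simple_object C X"
  shows "twist C X = twist_scalar C X \<star> \<iota> X"
proof -
  interpret self: braided_action C C "idf C"
    by (rule idf_braided_action)
  obtain k where k: "twist C X = k \<star> \<iota> X"
    using schur_scalar[OF X self.twist_in_Hom] by blast
  then have "twist_scalar C X = k"
    unfolding twist_scalar_def using scale_id_inject[OF X] by (intro the_equality) auto
  with k show ?thesis
    by simp
qed

text \<open>The left kink is a one-sided inverse of the twist, so a vanishing scalar would make the
  identity of \<open>X\<close> zero.\<close>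

lemma twist_scalar_nonzero:
  assumes X: "simple_object C X"
  shows "twist_scalar C X \<noteq> 0"
proof
  interpret self: braided_action C C "idf C"
    by (rule idf_braided_action)
  assume "twist_scalar C X = 0"
  then have "twist C X = 0 \<star> \<iota> X"
    using twist_eq[OF X] by simp
  then have "self.twm X [] = scl 0 (idn (FO (idf C) X # []))"
    by (simp only: self.mop_scale[OF id_in_Hom] self.mop_id)
  then have e: "scl 0 (self.ltw X []) = idn (FO (idf C) X # [])"
    using self.ltw_twm[of X "[]"] by simp
  have "scl 0 (idn (FO (idf C) X # [])) = idn (FO (idf C) X # [])"
    by (simp flip: e)
  then have "self.mop X (\<iota> X) X [] = self.mop X (0 \<star> \<iota> X) X []"
    by (simp only: self.mop_scale[OF id_in_Hom] self.mop_id)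
  then have "\<iota> X = 0"
    using opr_mop_faithful[OF id_in_Hom scale_in_Hom[OF id_in_Hom], of X 0] by simp
  then show False
    using simple_id_nonzero[OF X] by simp
qed

end

context braided_action
begin

lemma ltw_scalar:
  assumes X: "simple_object C X"
  shows "ltw X w = tgt.scl (1 / twist_scalar C X) (tgt.idn (FO M X # w))"
proof -
  let ?t = "twist_scalar C X"
  have "tgt.scl ?t (ltw X w) = tgt.idn (FO M X # w)"
    using ltw_twm[of X w] by (simp add: src.twist_eq[OF X] mop_scale src.id_in_Hom)
  then have "tgt.scl (1 / ?t) (tgt.scl ?t (ltw X w)) = tgt.scl (1 / ?t) (tgt.idn (FO M X # w))"
    by simp
  then show ?thesis
    using src.twist_scalar_nonzero[OF X] by simp
qed

end

context pre_modular_category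
begin

text \<open>Both partial traces of the inverse braiding have the same trace, by sphericality.\<close>

lemma inverse_braid_trace:
  assumes A: "complete_set_of_simples C A" "\<one> \<in> A" and X: "simple_object C X"
  shows "right_partial_trace C X X X (inv_mor C (X \<odot> X) (X \<odot> X) (\<c>\<^bsub>C\<^esub> X X)) = (1 / twist_scalar C X) \<star> \<iota> X"
proof -
  interpret self: braided_action C C "idf C"
    by (rule idf_braided_action)
  obtain k where k: "right_partial_trace C X X X (self.ibr X X) = k \<star> \<iota> X"
    using schur_scalar[OF X self.right_partial_trace_in_Hom[OF self.ibr_in_Hom]] by blast
  then have "self.rtw X [] = scl k (idn (FO (idf C) X # []))"
    by (simp add: self.rtw_mop self.mop_scale id_in_Hom)
  then have "scl (k * qdim C X) (idn []) = scl (1 / twist_scalar C X * qdim C X) (idn [])"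
    using self.ltw_rtw_trace[of X "[]"]
    by (simp add: self.ltw_scalar[OF X] self.evm_pcoevm self.pevm_coevm)
  then have "k * qdim C X = 1 / twist_scalar C X * qdim C X"
    by (rule scl_idn_inject[OF unit_simple])
  \<comment> \<open>Equal traces give equal scalars because the dimension of a simple object is
    nonzero.\<close>
  then have "k = 1 / twist_scalar C X"
    using mult_right_cancel[OF qdim_nonzero[OF A X]] by blast
  with k show ?thesis
    by simp
qed

end

section \<open>The sliding property\<close>

locale modular_functor =
  src: pre_modular_category C + pivotal_functor C D M
  for C :: "('o, 'm::ab_group_add, 'k::alg_closed_field, 'z) braided_cat_scheme"
    and D :: "('p, 'n::ab_group_add, 'k, 'y) piv_cat_scheme"
    and M :: "('o, 'm, 'p, 'n) mon_fun" +
  fixes A :: "'o set"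
  assumes complete_A: "complete_set_of_simples C A" and unit_in_A: "\<one>\<^bsub>C\<^esub> \<in> A"
    and global_dim_nonzero: "global_dim C A \<noteq> 0"
begin

sublocale fusion_functor C D M A
  by unfold_locales (rule complete_A)

sublocale braided_action C D M
  by unfold_locales

lemma bri_natural_right:
  assumes f: "f \<in> Hom C T T'"
  shows "bri X T' w \<bullet> mop T f T' (FO M X # w) = lw X (mop T f T' w) \<bullet> bri X T w"
proof -
  have "bri X T' w \<bullet> (brm X T' w \<bullet> lw X (mop T f T' w)) \<bullet> bri X T w
    = bri X T' w \<bullet> (mop T f T' (FO M X # w) \<bullet> brm X T w) \<bullet> bri X T w"
    by (simp only: brm_natural_right[OF f])
  then show ?thesis
    using f by (simp add: br_inv br_inv[THEN tgt.reassoc])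
qed

text \<open>Both sides are inverse to the two sides of \<open>brm_tensor_right\<close>.\<close>

lemma bri_tensor_right:
  "bri X T (FO M S # w) \<bullet> lw T (bri X S w) = lw X (mu T S w) \<bullet> bri X (T \<odot>\<^bsub>C\<^esub> S) w \<bullet> mui T S (FO M X # w)"
proof -
  let ?L = "bri X T (FO M S # w) \<bullet> lw T (bri X S w)" and ?R = "lw X (mu T S w) \<bullet> bri X (T \<odot>\<^bsub>C\<^esub> S) w \<bullet> mui T S (FO M X # w)"
  let ?a = "lw T (brm X S w) \<bullet> brm X T (FO M S # w)"
  have "?L \<bullet> ?a = tgt.idn (FO M X # FO M T # FO M S # w)"
    by (simp add: br_inv br_inv(2)[THEN tgt.wl2_id, THEN tgt.reassoc])
  then have "?R = (?L \<bullet> ?a) \<bullet> ?R"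
    by simp
  also have "\<dots> = ?L \<bullet> (mu T S (FO M X # w) \<bullet> brm X (T \<odot>\<^bsub>C\<^esub> S) w \<bullet> lw X (mui T S w)) \<bullet> ?R"
    by (simp only: tgt.cmp_assoc brm_tensor_right)
  also have "\<dots> = ?L"
    by (simp add: br_inv(1)[THEN tgt.reassoc])
  finally show ?thesis ..
qed

section \<open>The handle slide for a vector fixed by the idempotent\<close>

context
  fixes I J :: 'o and v :: 'n
  assumes v: "v \<in> Hom D (FO M (I \<odot>\<^bsub>C\<^esub> J)) \<one>\<^bsub>D\<^esub>"
    and fixed: "(\<Sum>T\<in>A. act (I \<odot>\<^bsub>C\<^esub> J) (I \<odot>\<^bsub>C\<^esub> J) T (tube_eps C A I J T) v) = v"
begin

text \<open>The half-braiding of I J that uses the braiding on the first factor and the inverse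
  braiding on the second; it is the morphism inside \<open>tube_eps\<close>.\<close>

definition tau where "tau T w = lw I (bri J T w) \<bullet> brm T I (FO M J # w)"
definition vv where "vv w = vf (I \<odot>\<^bsub>C\<^esub> J) v w \<bullet> mui I J w"
definition encircle where
  "encircle T w = evm T w \<bullet> lw (du T) (vv (FO M T # w) \<bullet> tau T w) \<bullet> pcoevm T (FO M I # FO M J # w)"

abbreviation IJ where "IJ w \<equiv> FO M I # FO M J # w"

lemma tau_simps [simp]:
  "adom (tau T w) = FO M T # IJ w" "acod (tau T w) = IJ (FO M T # w)" "tgt.ok (tau T w)"
  "adom (vv w) = IJ w" "acod (vv w) = w" "tgt.ok (vv w)"
  "adom (encircle T w) = IJ w" "acod (encircle T w) = w" "tgt.ok (encircle T w)"
  using v by (simp_all add: tau_def vv_def encircle_def)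

lemma vv_natural: "acod h = w \<Longrightarrow> vv w \<bullet> lw I (lw J h) = h \<bullet> vv (adom h)"
  by (simp add: vv_def mui_natural vf_natural[THEN tgt.reassoc])

lemma tau_natural_left:
  "f \<in> Hom C U T \<Longrightarrow> tau T w \<bullet> mop U f T (IJ w) = lw I (lw J (mop U f T w)) \<bullet> tau U w"
  by (simp add: tau_def brm_natural_left bri_natural_right[THEN tgt.wl2, THEN tgt.reassoc])

text \<open>Multiplicativity of the half-braiding in the strand: after exchanging two independent
  crossings, the hexagons for the braiding and for its inverse apply separately.\<close>

lemma tau_tensor:
  "tau T (FO M S # w) \<bullet> lw T (tau S w) = lw I (lw J (mu T S w)) \<bullet> tau (T \<odot>\<^bsub>C\<^esub> S) w \<bullet> mui T S (IJ w)"
proof -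
  have "tau T (FO M S # w) \<bullet> lw T (tau S w)
    = lw I (bri J T (FO M S # w)) \<bullet> (brm T I (FO M J # FO M S # w) \<bullet> lw T (lw I (bri J S w))) \<bullet> lw T (brm S I (FO M J # w))"
    by (simp add: tau_def)
  also have "\<dots> = lw I (bri J T (FO M S # w) \<bullet> lw T (bri J S w)) \<bullet> (brm T I (FO M S # FO M J # w) \<bullet> lw T (brm S I (FO M J # w)))"
    by (simp add: brm_natural)
  also have "\<dots> = lw I (lw J (mu T S w)) \<bullet> tau (T \<odot>\<^bsub>C\<^esub> S) w \<bullet> mui T S (IJ w)"
    unfolding bri_tensor_right brm_tensor_left by (simp add: tau_def)
  finally show ?thesis .
qed

lemma tube_eps_in_Hom:
  "T \<in> A \<Longrightarrow> tube_eps C A I J T \<in> Hom C (T \<odot>\<^bsub>C\<^esub> (I \<odot>\<^bsub>C\<^esub> J)) ((I \<odot>\<^bsub>C\<^esub> J) \<odot>\<^bsub>C\<^esub> T)"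
  unfolding tube_eps_def by (simp, rule src.scale_in_Hom) (rule typing braid_in_Hom ibr_in_Hom)+

lemma vf_tube_eps:
  assumes T: "T \<in> A"
  shows "vf (I \<odot>\<^bsub>C\<^esub> J) (act (I \<odot>\<^bsub>C\<^esub> J) (I \<odot>\<^bsub>C\<^esub> J) T (tube_eps C A I J T) v) w \<bullet> mui I J w
    = tgt.scl (qdim C T / global_dim C A) (encircle T w)"
proof -
  let ?X = "I \<odot>\<^bsub>C\<^esub> J"
  have H: "assoc_inv C I J T \<cdot>\<^bsub>C\<^esub> (\<iota>\<^bsub>C\<^esub> I \<otimes>\<^bsub>C\<^esub> ibr J T) \<cdot>\<^bsub>C\<^esub> \<a>\<^bsub>C\<^esub> I T J \<cdot>\<^bsub>C\<^esub> (\<c>\<^bsub>C\<^esub> T I \<otimes>\<^bsub>C\<^esub> \<iota>\<^bsub>C\<^esub> J) \<cdot>\<^bsub>C\<^esub> assoc_inv C T I J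
    \<in> Hom C (T \<odot>\<^bsub>C\<^esub> ?X) (?X \<odot>\<^bsub>C\<^esub> T)" (is "?e \<in> _")
    by (rule typing braid_in_Hom ibr_in_Hom)+
  have e: "mop (T \<odot>\<^bsub>C\<^esub> ?X) ?e (?X \<odot>\<^bsub>C\<^esub> T) w
    = mui ?X T w \<bullet> mui I J (FO M T # w) \<bullet> tau T w \<bullet> lw T (mu I J w) \<bullet> mu T ?X w"
    by ((subst mop_comp, (rule typing braid_in_Hom ibr_in_Hom)+)+)
       (simp add: mop_tensor mop_coherence src.id_in_Hom braid_in_Hom ibr_in_Hom tau_def brm_def bri_def)
  have "mop (T \<odot>\<^bsub>C\<^esub> ?X) (tube_eps C A I J T) (?X \<odot>\<^bsub>C\<^esub> T) w
    = tgt.scl (qdim C T / global_dim C A) (mui ?X T w \<bullet> mui I J (FO M T # w) \<bullet> tau T w \<bullet> lw T (mu I J w) \<bullet> mu T ?X w)"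
    using T by (simp add: tube_eps_def mop_scale[OF H] e)
  then show ?thesis
    using v by (simp add: vf_act[OF tube_eps_in_Hom[OF T] v] encircle_def vv_def pcoevm_natural)
qed

lemma vv_expand:
  "vv w = tgt.asum (IJ w) w A (\<lambda>T. tgt.scl (qdim C T / global_dim C A) (encircle T w))"
proof -
  let ?X = "I \<odot>\<^bsub>C\<^esub> J"
  have a: "act ?X ?X T (tube_eps C A I J T) v \<in> Hom D (FO M ?X) \<one>\<^bsub>D\<^esub>" if "T \<in> A" for T
    by (rule act_in_Hom[OF tube_eps_in_Hom[OF that] v])
  have "vf ?X v w = tgt.lun w \<bullet> tgt.opr (FO M ?X) (\<Sum>T\<in>A. act ?X ?X T (tube_eps C A I J T) v) \<one>\<^bsub>D\<^esub> w"
    by (simp add: fixed vf_def)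
  also have "\<dots> = tgt.lun w \<bullet> tgt.asum (FO M ?X # w) (\<one>\<^bsub>D\<^esub> # w) A (\<lambda>T. tgt.opr (FO M ?X) (act ?X ?X T (tube_eps C A I J T) v) \<one>\<^bsub>D\<^esub> w)"
    by (subst tgt.opr_sum[OF a]) auto
  also have "\<dots> = tgt.asum (FO M ?X # w) w A (\<lambda>T. vf ?X (act ?X ?X T (tube_eps C A I J T) v) w)"
    unfolding vf_def by (rule tgt.cmp_asum) (auto simp: tgt.typed_def a)
  finally have "vv w = tgt.asum (FO M ?X # w) w A (\<lambda>T. vf ?X (act ?X ?X T (tube_eps C A I J T) v) w) \<bullet> mui I J w"
    by (simp add: vv_def)
  also have "\<dots> = tgt.asum (IJ w) w A (\<lambda>T. vf ?X (act ?X ?X T (tube_eps C A I J T) v) w \<bullet> mui I J w)"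
    by (rule tgt.asum_cmp) (auto simp: tgt.typed_def a)
  also have "\<dots> = tgt.asum (IJ w) w A (\<lambda>T. tgt.scl (qdim C T / global_dim C A) (encircle T w))"
    by (rule tgt.asum_cong) (rule vf_tube_eps)
  finally show ?thesis .
qed

text \<open>The common picture of the handle slide: strand \<open>S\<close> and loop
  \<open>T\<close> fused into a simple \<open>U\<close> along a basis vector. Summed over
  \<open>U\<close> it gives a loop \<open>T\<close> crossed by \<open>S\<close>; summed over
  \<open>T\<close> with weights it gives a loop \<open>U\<close> beside a straight strand
  \<open>S\<close>.\<close>

definition splice where
  "splice T S U b w = flatm T S U b w \<bullet> lw (du T) (vv (FO M U # w) \<bullet> tau U w) \<bullet> sharpm T S U (cob U (T \<odot>\<^bsub>C\<^esub> S) b) (IJ w)"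

lemma splice_typed:
  "U \<in> A \<Longrightarrow> b \<in> bas U (T \<odot>\<^bsub>C\<^esub> S) \<Longrightarrow> tgt.typed (FO M S # IJ w) (FO M S # w) (splice T S U b w)"
  using bas_in_Hom[of U b "T \<odot>\<^bsub>C\<^esub> S"] cob_in_Hom[of U b "T \<odot>\<^bsub>C\<^esub> S"]
  by (simp add: tgt.typed_def splice_def)

lemma finite_bas: "U \<in> A \<Longrightarrow> finite (bas U G)"
  by (rule src.dual_bases_expand(1)[OF complete_A _ dual_bases_bas])

lemma sandwich_asum:
  assumes "tgt.typed ys zs g" "tgt.typed ws xs f" "\<And>i. i \<in> K \<Longrightarrow> tgt.typed xs ys (F i)"
  shows "g \<bullet> tgt.asum xs ys K F \<bullet> f = tgt.asum ws zs K (\<lambda>i. g \<bullet> F i \<bullet> f)"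
proof -
  have 1: "tgt.typed ws ys (F i \<bullet> f)" if "i \<in> K" for i
    using assms(2) assms(3)[OF that] by (auto simp: tgt.typed_def)
  show ?thesis
    using tgt.asum_cmp[of ws xs f K ys F] assms tgt.cmp_asum[OF assms(1) 1] by simp
qed

text \<open>A strand of colour \<open>S\<close> passing the loop of colour \<open>T\<close> is fused with it.\<close>

lemma encircle_tau:
  assumes T: "T \<in> A"
  shows "encircle T (FO M S # w) \<bullet> tau S w
    = tgt.asum (FO M S # IJ w) (FO M S # w) (SIGMA U:A. bas U (T \<odot>\<^bsub>C\<^esub> S)) (\<lambda>(U, b). splice T S U b w)"
proof -
  let ?P = "T \<odot>\<^bsub>C\<^esub> S"
  let ?K = "SIGMA U:A. bas U ?P"
  have bd: "b \<in> Hom C U ?P" "cob U ?P b \<in> Hom C ?P U" "b \<cdot>\<^bsub>C\<^esub> cob U ?P b \<in> Hom C ?P ?P" if "(U, b) \<in> ?K" for U b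
    using that bas_in_Hom[of U b ?P] cob_in_Hom[of U b ?P] by (auto intro: src.comp_in_Hom)
  have res: "(\<Sum>(U, b)\<in>?K. b \<cdot>\<^bsub>C\<^esub> cob U ?P b) = \<iota>\<^bsub>C\<^esub> ?P"
    using bas_resolution[of ?P] finite_simples finite_bas by (simp add: sum.Sigma)
  let ?m = "\<lambda>(U, b). mop ?P (b \<cdot>\<^bsub>C\<^esub> cob U ?P b) ?P (IJ w)"
  have id: "tgt.idn (FO M ?P # IJ w) = tgt.asum (FO M ?P # IJ w) (FO M ?P # IJ w) ?K ?m"
  proof -
    have "tgt.idn (FO M ?P # IJ w) = mop ?P (\<Sum>p\<in>?K. case p of (U, b) \<Rightarrow> b \<cdot>\<^bsub>C\<^esub> cob U ?P b) ?P (IJ w)"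
      by (simp add: res)
    also have "\<dots> = tgt.asum (FO M ?P # IJ w) (FO M ?P # IJ w) ?K (\<lambda>p. mop ?P (case p of (U, b) \<Rightarrow> b \<cdot>\<^bsub>C\<^esub> cob U ?P b) ?P (IJ w))"
      by (rule mop_sum) (use bd in auto)
    also have "\<dots> = tgt.asum (FO M ?P # IJ w) (FO M ?P # IJ w) ?K ?m"
      by (rule tgt.asum_cong) auto
    finally show ?thesis .
  qed
  have m: "tgt.typed (FO M ?P # IJ w) (FO M ?P # IJ w) (?m p)" if "p \<in> ?K" for p
    using that bd by (cases p) (auto simp: tgt.typed_def)
  let ?g = "evm T (FO M S # w) \<bullet> lw (du T) (mu T S w \<bullet> vv (FO M ?P # w) \<bullet> tau ?P w)"
  let ?f = "lw (du T) (mui T S (IJ w)) \<bullet> pcoevm T (FO M S # IJ w)"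
  have "encircle T (FO M S # w) \<bullet> tau S w
    = evm T (FO M S # w) \<bullet> lw (du T) (vv (FO M T # FO M S # w) \<bullet> (tau T (FO M S # w) \<bullet> lw T (tau S w))) \<bullet> pcoevm T (FO M S # IJ w)"
    by (simp add: encircle_def pcoevm_natural)
  also have "\<dots> = evm T (FO M S # w) \<bullet> lw (du T) ((vv (FO M T # FO M S # w) \<bullet> lw I (lw J (mu T S w))) \<bullet> tau ?P w \<bullet> mui T S (IJ w)) \<bullet> pcoevm T (FO M S # IJ w)"
    by (simp add: tau_tensor)
  also have "\<dots> = ?g \<bullet> lw (du T) (tgt.idn (FO M ?P # IJ w)) \<bullet> ?f"
    by (simp add: vv_natural)
  also have "lw (du T) (tgt.idn (FO M ?P # IJ w))
    = tgt.asum (FO M (du T) # FO M ?P # IJ w) (FO M (du T) # FO M ?P # IJ w) ?K (\<lambda>p. lw (du T) (?m p))"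
    unfolding id by (rule tgt.wl_asum[OF m])
  also have "?g \<bullet> \<dots> \<bullet> ?f = tgt.asum (FO M S # IJ w) (FO M S # w) ?K (\<lambda>p. ?g \<bullet> lw (du T) (?m p) \<bullet> ?f)"
    by (rule sandwich_asum) (use m in \<open>auto simp: tgt.typed_def\<close>)
  also have "\<dots> = tgt.asum (FO M S # IJ w) (FO M S # w) ?K (\<lambda>(U, b). splice T S U b w)"
  proof (rule tgt.asum_cong)
    fix p assume p: "p \<in> ?K"
    obtain U b where Ub: "p = (U, b)"
      by (cases p)
    have b: "b \<in> Hom C U ?P" "cob U ?P b \<in> Hom C ?P U"
      using bd p Ub by auto
    have "vv (FO M ?P # w) \<bullet> tau ?P w \<bullet> mop U b ?P (IJ w) = mop U b ?P w \<bullet> vv (FO M U # w) \<bullet> tau U w"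
      by (simp add: tau_natural_left[OF b(1)] vv_natural[THEN tgt.reassoc])
    note eq = this[THEN tgt.wl_eq[of _ _ "FO M (du T)"], unfolded tgt.wl_cmp, THEN tgt.reassoc2]
    show "?g \<bullet> lw (du T) (?m p) \<bullet> ?f = (case p of (U, b) \<Rightarrow> splice T S U b w)"
      unfolding Ub by (simp add: mop_comp[OF b(2,1)] eq splice_def flatm_def sharpm_def)
  qed
  finally show ?thesis .
qed

text \<open>Straightening the strand of \<open>U\<close> exhibits a splice as the loop of
  \<open>U\<close> with a bend and a cobend inserted beside \<open>S\<close>. The sum over
  \<open>T\<close> then collapses by \<open>bend_resolution\<close>, which exchanges the weights
  \<open>qdim C T\<close> for \<open>qdim C U\<close>.\<close>

lemma scaled_encircle:
  assumes U: "U \<in> A"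
  shows "tgt.scl (qdim C U) (lw S (encircle U w))
    = tgt.asum (FO M S # IJ w) (FO M S # w) (SIGMA T:A. bas U (T \<odot>\<^bsub>C\<^esub> S)) (\<lambda>(T, b). tgt.scl (qdim C T) (splice T S U b w))"
proof -
  let ?K = "SIGMA T:A. bas U (T \<odot>\<^bsub>C\<^esub> S)" and ?Q = "S \<odot>\<^bsub>C\<^esub> du U" and ?u = "FO M U # IJ w"
  let ?c = "\<lambda>T b. cob U (T \<odot>\<^bsub>C\<^esub> S) b"
  let ?r = "\<lambda>p. case p of (T, b) \<Rightarrow> qdim C T \<star>\<^bsub>C\<^esub> (src.bend T S U b \<cdot>\<^bsub>C\<^esub> src.cobend T S U (?c T b))"
  have bd: "b \<in> Hom C U (T \<odot>\<^bsub>C\<^esub> S)" "?c T b \<in> Hom C (T \<odot>\<^bsub>C\<^esub> S) U" if "(T, b) \<in> ?K" for T b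
    using that U bas_in_Hom[of U b "T \<odot>\<^bsub>C\<^esub> S"] cob_in_Hom[of U b "T \<odot>\<^bsub>C\<^esub> S"] by auto
  have bb: "src.bend T S U b \<cdot>\<^bsub>C\<^esub> src.cobend T S U (?c T b) \<in> Hom C ?Q ?Q" if "(T, b) \<in> ?K" for T b
    by (rule src.comp_in_Hom[OF bend_in_Hom(4)[OF bd(2)[OF that]] bend_in_Hom(3)[OF bd(1)[OF that]]])
  have rH: "?r p \<in> Hom C ?Q ?Q" if "p \<in> ?K" for p
    using that bb by (cases p) (auto intro: src.scale_in_Hom)
  have sum: "(\<Sum>p\<in>?K. ?r p) = qdim C U \<star>\<^bsub>C\<^esub> \<iota>\<^bsub>C\<^esub> ?Q"
    using src.bend_resolution[OF complete_A finite_simples U dual_bases_bas[OF U]] finite_simples finite_bas[OF U]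
    by (simp add: sum.Sigma)
  let ?g = "lw S (evm U w) \<bullet> lw S (lw (du U) (vv (FO M U # w) \<bullet> tau U w)) \<bullet> mu S (du U) ?u"
  let ?f = "mui S (du U) ?u \<bullet> lw S (pcoevm U (IJ w))"
  have m: "tgt.typed (FO M ?Q # ?u) (FO M ?Q # ?u) (mop ?Q (?r p) ?Q ?u)" if "p \<in> ?K" for p
    using rH[OF that] by (simp add: tgt.typed_def)
  have "tgt.scl (qdim C U) (lw S (encircle U w)) = ?g \<bullet> mop ?Q (\<Sum>p\<in>?K. ?r p) ?Q ?u \<bullet> ?f"
    unfolding sum by (simp add: mop_scale src.id_in_Hom encircle_def)
  also have "\<dots> = ?g \<bullet> tgt.asum (FO M ?Q # ?u) (FO M ?Q # ?u) ?K (\<lambda>p. mop ?Q (?r p) ?Q ?u) \<bullet> ?f"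
    using mop_sum[OF rH, of ?K "\<lambda>p. p"] by simp
  also have "\<dots> = tgt.asum (FO M S # IJ w) (FO M S # w) ?K (\<lambda>p. ?g \<bullet> mop ?Q (?r p) ?Q ?u \<bullet> ?f)"
    by (rule sandwich_asum) (use m in \<open>auto simp: tgt.typed_def\<close>)
  also have "\<dots> = tgt.asum (FO M S # IJ w) (FO M S # w) ?K (\<lambda>(T, b). tgt.scl (qdim C T) (splice T S U b w))"
  proof (rule tgt.asum_cong)
    fix p assume p: "p \<in> ?K"
    obtain T b where Tb: "p = (T, b)"
      by (cases p)
    have b: "b \<in> Hom C U (T \<odot>\<^bsub>C\<^esub> S)" "?c T b \<in> Hom C (T \<odot>\<^bsub>C\<^esub> S) U"
      using bd p Tb by auto
    let ?V = "vv (FO M U # w) \<bullet> tau U w"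
    \<comment> \<open>Here and in \<open>f2\<close>, the bent leg of \<open>U\<close> meets the cap
      or the cup of its loop in a zigzag, undoing the second of the two bending steps.\<close>
    have f1: "lw S (evm U w) \<bullet> bendm T S U b (FO M U # w) = flatm T S U b w"
    proof -
      have "lw S (evm U w) \<bullet> bendm T S U b (FO M U # w)
        = flatm T S U b w \<bullet> lw (du T) (lw U (evm U w) \<bullet> coevm U (FO M U # w))"
        by (simp add: bendm_def flatm_natural[THEN tgt.reassoc])
      then show ?thesis
        using b by (simp only: zig_ev) simp
    qed
    have f2: "cobendm T S U (?c T b) ?u \<bullet> lw S (pcoevm U (IJ w)) = sharpm T S U (?c T b) (IJ w)"
    proof -
      have "cobendm T S U (?c T b) ?u \<bullet> lw S (pcoevm U (IJ w))
        = lw (du T) (pevm U ?u \<bullet> lw U (pcoevm U (IJ w))) \<bullet> sharpm T S U (?c T b) (IJ w)"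
        by (simp add: cobendm_def sharpm_natural)
      then show ?thesis
        using b by (simp only: zig_pev') simp
    qed
    have "?g \<bullet> mop ?Q (?r p) ?Q ?u \<bullet> ?f
      = tgt.scl (qdim C T) (lw S (evm U w) \<bullet> (lw S (lw (du U) ?V) \<bullet> bendm T S U b ?u) \<bullet> (cobendm T S U (?c T b) ?u \<bullet> lw S (pcoevm U (IJ w))))"
      using bb[of T b] p Tb b
      by (simp add: mop_scale mop_comp[OF bend_in_Hom(4)[OF b(2)] bend_in_Hom(3)[OF b(1)]] mop_bend mop_cobend)
    also have "lw S (lw (du U) ?V) \<bullet> bendm T S U b ?u = bendm T S U b (FO M U # w) \<bullet> lw (du T) ?V"
      using bendm_natural[of ?V "FO M U # w" T S U b] by simp
    also have "lw S (evm U w) \<bullet> (bendm T S U b (FO M U # w) \<bullet> lw (du T) ?V) \<bullet> (cobendm T S U (?c T b) ?u \<bullet> lw S (pcoevm U (IJ w)))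
      = splice T S U b w"
      unfolding f2 by (simp add: f1[THEN tgt.reassoc] splice_def)
    finally show "?g \<bullet> mop ?Q (?r p) ?Q ?u \<bullet> ?f = (case p of (T, b) \<Rightarrow> tgt.scl (qdim C T) (splice T S U b w))"
      by (simp add: Tb)
  qed
  finally show ?thesis .
qed

text \<open>Both sides equal the sum of all splices with weight d(T) / d(C). On the left it is
  grouped by the old loop \<open>T\<close> through \<open>encircle_tau\<close>, on the right by the
  new loop \<open>U\<close> through \<open>scaled_encircle\<close>; exchanging the two summations
  proves the handle slide.\<close>

lemma sliding: "vv (FO M S # w) \<bullet> tau S w = lw S (vv w)"
proof (rule tgt.arr_ok_eqI)
  let ?d = "global_dim C A" and ?xs = "FO M S # IJ w" and ?ys = "FO M S # w"
  let ?a = "\<lambda>T U. \<Sum>b\<in>bas U (T \<odot>\<^bsub>C\<^esub> S). amor (splice T S U b w)"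
  have "vv (FO M S # w) \<bullet> tau S w = tgt.asum ?xs ?ys A (\<lambda>T. tgt.scl (qdim C T / ?d) (encircle T ?ys) \<bullet> tau S w)"
    by (subst vv_expand, rule tgt.asum_cmp) (auto simp: tgt.typed_def)
  then have "amor (vv (FO M S # w) \<bullet> tau S w) = (\<Sum>T\<in>A. amor (tgt.scl (qdim C T / ?d) (encircle T ?ys \<bullet> tau S w)))"
    by (simp add: tgt.amor_asum)
  also have "\<dots> = (\<Sum>T\<in>A. \<Sum>U\<in>A. (qdim C T / ?d) \<star>\<^bsub>D\<^esub> ?a T U)"
  proof (intro sum.cong refl)
    fix T assume T: "T \<in> A"
    have "amor (tgt.scl (qdim C T / ?d) (encircle T ?ys \<bullet> tau S w)) = (qdim C T / ?d) \<star>\<^bsub>D\<^esub> amor (encircle T ?ys \<bullet> tau S w)"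
      by (rule tgt.amor_scl) simp
    also have "amor (encircle T ?ys \<bullet> tau S w) = (\<Sum>U\<in>A. ?a T U)"
      using finite_simples finite_bas by (simp add: encircle_tau[OF T] tgt.amor_asum sum.Sigma case_prod_beta)
    finally show "amor (tgt.scl (qdim C T / ?d) (encircle T ?ys \<bullet> tau S w)) = (\<Sum>U\<in>A. (qdim C T / ?d) \<star>\<^bsub>D\<^esub> ?a T U)"
      by (simp add: tgt.vs.scale_sum_right)
  qed
  also have "\<dots> = (\<Sum>U\<in>A. \<Sum>T\<in>A. (qdim C T / ?d) \<star>\<^bsub>D\<^esub> ?a T U)"
    by (rule sum.swap)
  also have "\<dots> = (\<Sum>U\<in>A. amor (tgt.scl (qdim C U / ?d) (lw S (encircle U w))))"
  proof (intro sum.cong refl)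
    fix U assume U: "U \<in> A"
    have sp: "tgt.ok (splice T S U b w)" if "b \<in> bas U (T \<odot>\<^bsub>C\<^esub> S)" for T b
      using splice_typed[OF U that] by (simp add: tgt.typed_def)
    have "amor (tgt.scl (qdim C U) (lw S (encircle U w))) = (\<Sum>T\<in>A. \<Sum>b\<in>bas U (T \<odot>\<^bsub>C\<^esub> S). amor (tgt.scl (qdim C T) (splice T S U b w)))"
      using finite_simples finite_bas[OF U] by (simp add: scaled_encircle[OF U] tgt.amor_asum sum.Sigma case_prod_beta)
    also have "\<dots> = (\<Sum>T\<in>A. qdim C T \<star>\<^bsub>D\<^esub> ?a T U)"
      by (intro sum.cong refl) (simp add: tgt.amor_scl sp tgt.vs.scale_sum_right)
    finally have "(1 / ?d) \<star>\<^bsub>D\<^esub> amor (tgt.scl (qdim C U) (lw S (encircle U w))) = (\<Sum>T\<in>A. (qdim C T / ?d) \<star>\<^bsub>D\<^esub> ?a T U)"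
      by (simp add: tgt.vs.scale_sum_right[of "1 / ?d"])
    moreover have "tgt.scl (qdim C U / ?d) (lw S (encircle U w)) = tgt.scl (1 / ?d) (tgt.scl (qdim C U) (lw S (encircle U w)))"
      by simp
    ultimately show "(\<Sum>T\<in>A. (qdim C T / ?d) \<star>\<^bsub>D\<^esub> ?a T U) = amor (tgt.scl (qdim C U / ?d) (lw S (encircle U w)))"
      by (simp only: tgt.amor_scl tgt.scl_simps tgt.ok_wl tau_simps)
  qed
  also have "\<dots> = amor (lw S (vv w))"
    by (subst vv_expand, subst tgt.wl_asum) (auto simp: tgt.typed_def tgt.amor_asum)
  finally show "amor (vv (FO M S # w) \<bullet> tau S w) = amor (lw S (vv w))" .
qed auto

text \<open>For \<open>S = I\<close> the crossing of the strand with \<open>I\<close> is a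
  self-crossing. Moved to the other side of \<open>sliding\<close> it becomes inverse, as required
  for the kink \<open>ltw\<close>.\<close>

lemma vv_ltw: "vv w \<bullet> ltw I (FO M J # w) = evm I w \<bullet> lw (du I) (vv (FO M I # w)) \<bullet> pcoevm I (FO M J # FO M I # w) \<bullet> bri J I w"
proof -
  have "vv (FO M I # w) \<bullet> lw I (bri J I w) = (vv (FO M I # w) \<bullet> tau I w) \<bullet> bri I I (FO M J # w)"
    by (simp add: tau_def br_inv)
  also have "\<dots> = lw I (vv w) \<bullet> bri I I (FO M J # w)"
    by (simp only: sliding)
  finally have eq: "lw I (vv w) \<bullet> bri I I (FO M J # w) = vv (FO M I # w) \<bullet> lw I (bri J I w)" ..
  have "vv w \<bullet> ltw I (FO M J # w) = evm I w \<bullet> lw (du I) (lw I (vv w) \<bullet> bri I I (FO M J # w)) \<bullet> pcoevm I (IJ w)"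
    by (simp add: evm_natural[THEN tgt.reassoc] ltw_def)
  then show ?thesis
    unfolding eq using pcoevm_natural[of "bri J I w" _ I, OF refl] by simp
qed

text \<open>For \<open>S = J\<close> the self-crossing in \<open>tau\<close> is already inverse and
  stays where it is; the crossing with \<open>I\<close> is moved across and appears as
  \<open>bri J I\<close>.\<close>

lemma vv_rtw: "vv w \<bullet> lw I (rtw J w) = pevm J w \<bullet> lw J (vv (FO M (du J) # w)) \<bullet> lw J (lw I (coevm J w)) \<bullet> bri J I w"
proof -
  let ?u = "FO M (du J) # w"
  have "vv (FO M J # ?u) \<bullet> lw I (bri J J ?u) = (vv (FO M J # ?u) \<bullet> tau J ?u) \<bullet> bri J I (FO M J # ?u)"
    by (simp add: tau_def br_inv)
  also have "\<dots> = lw J (vv ?u) \<bullet> bri J I (FO M J # ?u)"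
    by (simp only: sliding)
  finally have eq: "vv (FO M J # ?u) \<bullet> lw I (bri J J ?u) = lw J (vv ?u) \<bullet> bri J I (FO M J # ?u)" .
  have "vv w \<bullet> lw I (rtw J w) = pevm J w \<bullet> (vv (FO M J # ?u) \<bullet> lw I (bri J J ?u)) \<bullet> lw I (lw J (coevm J w))"
    by (simp add: rtw_def vv_natural[THEN tgt.reassoc])
  also have "\<dots> = pevm J w \<bullet> lw J (vv ?u) \<bullet> (bri J I (FO M J # ?u) \<bullet> lw I (lw J (coevm J w)))"
    unfolding eq by simp
  finally show ?thesis
    by (simp add: bri_natural)
qed

text \<open>
  Closing up the sliding relation on the left for \<open>S = I\<close> and on the right for \<open>S = J\<close> gives the
  two rotations of \<open>v\<close>, which agree by pivotality.
\<close>

lemma twist_scalars_agree: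
  assumes I: "I \<in> A" and J: "J \<in> A" and v0: "v \<noteq> 0"
  shows "twist_scalar C I = twist_scalar C J"
proof -
  let ?X = "I \<odot>\<^bsub>C\<^esub> J" and ?a = "1 / twist_scalar C I" and ?b = "1 / twist_scalar C J"
  have I': "simple_object C I" and J': "simple_object C J"
    using src.simples[OF complete_A] I J by auto
  \<comment> \<open>Composition with \<open>FTens\<close> turns \<open>v\<close> into a morphism out
    of M(I) M(J), the form in which \<open>functor_rotation\<close> rotates it.\<close>
  have "evm I w \<bullet> lw (du I) (vv (FO M I # w)) \<bullet> pcoevm I (FO M J # FO M I # w)
    = pevm J w \<bullet> lw J (vv (FO M (du J) # w)) \<bullet> lw J (lw I (coevm J w))" for w
  proof (rule functor_rotation)
    show "v \<cdot>\<^bsub>D\<^esub> FTens M I J \<in> Hom D (FO M I \<odot>\<^bsub>D\<^esub> FO M J) \<one>\<^bsub>D\<^esub>"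
      by (rule tgt.comp_in_Hom[OF FTens_in_Hom v])
    show "vv w = tgt.lun w \<bullet> tgt.opr (FO M I \<odot>\<^bsub>D\<^esub> FO M J) (v \<cdot>\<^bsub>D\<^esub> FTens M I J) \<one>\<^bsub>D\<^esub> w \<bullet> tgt.asci (FO M I) (FO M J) w" for w
      by (simp add: vv_def vf_def mui_def tgt.opr_comp[OF FTens_in_Hom v])
  qed
  then have "vv w \<bullet> ltw I (FO M J # w) = vv w \<bullet> lw I (rtw J w)" for w
    unfolding vv_ltw vv_rtw by (metis tgt.cmp_assoc)
  moreover have "rtw J w = tgt.scl ?b (tgt.idn (FO M J # w))" for w
    by (simp add: rtw_mop src.inverse_braid_trace[OF complete_A unit_in_A J'] mop_scale src.id_in_Hom)
  ultimately have "tgt.scl ?a (vv []) = tgt.scl ?b (vv [])"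
    by (simp add: ltw_scalar[OF I'])
  then have "tgt.luni [] \<bullet> tgt.scl ?a (vv []) \<bullet> mu I J [] = tgt.luni [] \<bullet> tgt.scl ?b (vv []) \<bullet> mu I J []"
    by simp
  then have "tgt.opr (FO M ?X) (?a \<star>\<^bsub>D\<^esub> v) \<one>\<^bsub>D\<^esub> [] = tgt.opr (FO M ?X) (?b \<star>\<^bsub>D\<^esub> v) \<one>\<^bsub>D\<^esub> []"
    using v by (simp add: vv_def vf_def tgt.reassoc[OF tgt.luni_lun] tgt.opr_scale)
  then have "?a \<star>\<^bsub>D\<^esub> v = ?b \<star>\<^bsub>D\<^esub> v"
    by (rule tgt.opr_cong_faithful[OF tgt.scale_in_Hom[OF v] tgt.scale_in_Hom[OF v]])
  then show ?thesis
    using v0 by simp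
qed

end

lemma TM_T_invariant: "T_invariant C A (TM C A D M)"
  unfolding T_invariant_def
proof (intro conjI ballI impI)
  show "contravariant_tube_functor C A (TM C A D M)"
    by (rule TM_functor)
  fix I J assume I: "I \<in> A" and J: "J \<in> A" and Z: "Z_matrix C A (TM C A D M) I J \<noteq> 0"
  \<comment> \<open>A nonzero integer dimension provides a nonzero fixed vector, whatever the
    characteristic of the field.\<close>
  have "\<not> eps_space C A (TM C A D M) I J \<subseteq> {0}"
  proof
    assume "eps_space C A (TM C A D M) I J \<subseteq> {0}"
    then have "tgt.vs.dim (eps_space C A (TM C A D M) I J) \<le> card ({} :: 'n set)"
      by (intro tgt.vs.dim_le_card) auto
    then show False
      using Z by (simp add: Z_matrix_def TM_def)
  qed
  then obtain v where "v \<in> eps_space C A (TM C A D M) I J" "v \<noteq> 0"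
    by blast
  then have "twist_scalar C I = twist_scalar C J"
    using twist_scalars_agree[of v I J] I J by (simp add: eps_space_def TM_def)
  then show "T_matrix C I I = T_matrix C J J"
    by (simp add: T_matrix_def)
qed

end

theorem theorem7p5:
  fixes C :: "('o, 'm::ab_group_add, 'k::alg_closed_field) braided_cat"
    and D :: "('p, 'n::ab_group_add, 'k) piv_cat"
    and M :: "('o, 'm, 'p, 'n) mon_fun"
    and A :: "'o set"
  assumes "pre_modular_category C"
    and "complete_set_of_simples C A" and "\<one>\<^bsub>C\<^esub> \<in> A"
    and "global_dim C A \<noteq> 0"
    and "pivotal_category D"
    and "pivotal_functor C D M"
  shows "T_invariant C A (TM C A D M)"
proof -
  interpret D: pivotal_category D
    by (rule assms(5))
  interpret F: pivotal_functor C D M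
    by (rule assms(6))
  interpret C: pre_modular_category C
    by (rule assms(1))
  interpret modular_functor C D M A
    by unfold_locales (rule assms)+
  show ?thesis
    by (rule TM_T_invariant)
qed

end
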